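(* For $R>0$ and $T>0$ let $H_{f}(T,R)$ be the event that, for every $t\in[0,T]$, the function $z\mapsto f(z,t)=\sum_{n=0}^\infty a_n(t)\frac{z^n}{\sqrt{n!}}$ has no zeros in the disk $D_R=\{z\in\mathbb{C}:|z|\le R\}$. Then $$\limsup_{T\to\infty}\frac1T\log \mathbb{P}(H_f(T,R))\le -e^{\left(\frac13-o(1)\right)R^2}$$ and $$\liminf_{T\to\infty}\frac1T\log \mathbb{P}(H_f(T,R))\ge -e^{\left(\frac12+o(1)\right)R^2},$$ where each $o(1)$ denotes a quantity depending only on $R$ that tends to $0$ as $R\to\infty$.
   Context: The coefficients $a_n(t)$, $n\ge 0$, $t\ge0$, are i.i.d. complex stationary Ornstein-Uhlenbeck processes: $a_n(t)=e^{-t/2}B_n(e^t)$, where $B_n=\frac{1}{\sqrt2}(B_{n,1}+iB_{n,2})$ and all $B_{n,1},B_{n,2}$ are independent standard real Brownian motions started from $0$. With probability one $f(\cdot,t)$ is an entire function for all $t$ (the time dependent planar Gaussian analytic function). *)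

theory Defs
  imports "HOL-Probability.Probability"
begin

definition standard_brownian_motion :: "'a measure \<Rightarrow> (real \<Rightarrow> 'a \<Rightarrow> real) \<Rightarrow> bool" where
  "standard_brownian_motion M W \<longleftrightarrow>
     prob_space M \<and>
     (\<forall>t\<ge>0. W t \<in> borel_measurable M) \<and>
     (AE \<omega> in M. W 0 \<omega> = 0) \<and>
     (\<forall>s t. 0 \<le> s \<and> s < t \<longrightarrow>
        distributed M lborel (\<lambda>\<omega>. W t \<omega> - W s \<omega>) (normal_density 0 (sqrt (t - s)))) \<and>
     (\<forall>(m::nat) \<tau>. 0 \<le> \<tau> 0 \<and> (\<forall>i<m. \<tau> i \<le> \<tau> (Suc i)) \<longrightarrow>
        prob_space.indep_vars M (\<lambda>_. borel) (\<lambda>i \<omega>. W (\<tau> (Suc i)) \<omega> - W (\<tau> i) \<omega>) {..<m}) \<and>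
     (AE \<omega> in M. continuous_on {0..} (\<lambda>t. W t \<omega>))"

text \<open>
  Independence is that of whole processes: each path is a random element of the product
  sigma-algebra on functions from the half-line to the reals.
  The second index only matters for the values 1 and 2.
\<close>

definition independent_brownian_motions ::
  "'a measure \<Rightarrow> (nat \<Rightarrow> nat \<Rightarrow> real \<Rightarrow> 'a \<Rightarrow> real) \<Rightarrow> bool" where
  "independent_brownian_motions M B \<longleftrightarrow>
     (\<forall>n. \<forall>j\<in>{1, 2}. standard_brownian_motion M (B n j)) \<and>
     prob_space.indep_vars M (\<lambda>_. Pi\<^sub>M {0..} (\<lambda>_. borel))
       (\<lambda>(n, j) \<omega>. \<lambda>t\<in>{0..}. B n j t \<omega>) (UNIV \<times> {1, 2})"

definition OU_coeff :: "(nat \<Rightarrow> nat \<Rightarrow> real \<Rightarrow> 'a \<Rightarrow> real) \<Rightarrow> nat \<Rightarrow> real \<Rightarrow> 'a \<Rightarrow> complex" where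
  "OU_coeff B n t \<omega> = complex_of_real (exp (- t / 2)) *
     (complex_of_real (1 / sqrt 2) *
       (complex_of_real (B n 1 (exp t) \<omega>) + \<i> * complex_of_real (B n 2 (exp t) \<omega>)))"

definition planar_GAF :: "(nat \<Rightarrow> nat \<Rightarrow> real \<Rightarrow> 'a \<Rightarrow> real) \<Rightarrow> complex \<Rightarrow> real \<Rightarrow> 'a \<Rightarrow> complex" where
  "planar_GAF B z t \<omega> = (\<Sum>n. OU_coeff B n t \<omega> * (z ^ n / complex_of_real (sqrt (fact n))))"

definition hole_event ::
  "'a measure \<Rightarrow> (nat \<Rightarrow> nat \<Rightarrow> real \<Rightarrow> 'a \<Rightarrow> real) \<Rightarrow> real \<Rightarrow> real \<Rightarrow> 'a set" where
  "hole_event M B T R =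
     {\<omega> \<in> space M. \<forall>t\<in>{0..T}. \<forall>z\<in>cball 0 R. planar_GAF B z t \<omega> \<noteq> 0}"

text \<open>
  Path continuity and convergence of the series hold only almost surely, so the hole event
  agrees with a measurable set up to a null set but need not itself belong to the sigma-algebra
  of M. Its probability is therefore taken in the completion of M, which agrees with M
  on measurable sets.
\<close>

definition hole_prob ::
  "'a measure \<Rightarrow> (nat \<Rightarrow> nat \<Rightarrow> real \<Rightarrow> 'a \<Rightarrow> real) \<Rightarrow> real \<Rightarrow> real \<Rightarrow> real" where
  "hole_prob M B T R = measure (completion M) (hole_event M B T R)"

text \<open>The real logarithm has ln 0 = 0; here the logarithm of 0 is minus infinity.\<close>

definition log_prob :: "real \<Rightarrow> ereal" where
  "log_prob p = (if p = 0 then - \<infinity> else ereal (ln p))"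

end

theory Submission
  imports Defs "HOL-Complex_Analysis.Complex_Analysis" "HOL-Real_Asymp.Real_Asymp"
begin

text \<open>
  Lower bound. Keep the real part of the constant coefficient above a level \<open>a\<close> of order
  \<open>exp (R\<^sup>2 / 4)\<close> and every other coordinate in a slowly widening interval whose width starts at
  \<open>exp (- R\<^sup>2 / 4)\<close>, so that the constant term dominates on the disk. Holding an Ornstein-Uhlenbeck
  process in \<open>[- b, b]\<close> costs at most a multiple of \<open>1 / b\<^sup>2\<close> per unit of time, holding it above \<open>a\<close>
  a multiple of \<open>a\<^sup>2\<close>, and the coordinates are independent.

  Upper bound. Observe the coefficients at times spaced so that one step is
  \<open>y \<mapsto> sqrt (1 - s) y + sqrt s g\<close> with a fresh Gaussian series \<open>g\<close> and \<open>s = exp (- R\<^sup>2 / 3)\<close>. If there is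
  no zero then \<open>1 / \<bar>f 0\<bar>\<close> is at most the mean of \<open>1 / \<bar>f\<bar>\<close> over a circle; but the fresh noise makes
  the expectation of \<open>1 / \<bar>f z\<bar>\<close> at most of order \<open>exp (- R\<^sup>2 / 2) / sqrt s\<close> whatever the past, so
  survival is unlikely unless \<open>\<bar>f 0\<bar>\<close> exceeds \<open>1 / sqrt s\<close>. In that case the drift of the
  Ornstein-Uhlenbeck process pushes it back: \<open>exp (\<bar>f 0\<bar>\<^sup>2 / 4)\<close>, killed at the first step
  with a zero, contracts by a fixed factor in every step.
\<close>

section \<open>Increments of Brownian motion and a maximal inequality\<close>

abbreviation std_normal :: "real measure" where
  "std_normal \<equiv> density lborel (\<lambda>x. ennreal (std_normal_density x))"

lemma prob_space_std_normal: "prob_space std_normal"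
  by (rule prob_space_normal_density) simp

interpretation std_normal: prob_space std_normal
  by (rule prob_space_std_normal)

lemma sbm_prob_space: "standard_brownian_motion M W \<Longrightarrow> prob_space M"
  by (simp add: standard_brownian_motion_def)

lemma sbm_measurable: "standard_brownian_motion M W \<Longrightarrow> 0 \<le> t \<Longrightarrow> W t \<in> borel_measurable M"
  by (simp add: standard_brownian_motion_def)

lemma sbm_incr_distr:
  assumes "standard_brownian_motion M W" "0 \<le> s" "s < t"
  shows "distr M borel (\<lambda>\<omega>. (W t \<omega> - W s \<omega>) / sqrt (t - s)) = std_normal"
proof -
  interpret prob_space M using assms(1) by (rule sbm_prob_space)
  have "distributed M lborel (\<lambda>\<omega>. W t \<omega> - W s \<omega>) (normal_density 0 (sqrt (t - s)))"
    using assms by (simp add: standard_brownian_motion_def)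
  then have "distributed M lborel (\<lambda>\<omega>. (W t \<omega> - W s \<omega> - 0) / sqrt (t - s)) std_normal_density"
    using assms by (subst (asm) normal_standard_normal_convert) auto
  then show ?thesis
    by (simp add: distributed_distr_eq_density[symmetric] cong: distr_cong)
qed

lemma sbm_incr_prob:
  assumes W: "standard_brownian_motion M W" and st: "0 \<le> s" "s < t" and J: "J \<in> sets borel"
  shows "measure M {\<omega> \<in> space M. (W t \<omega> - W s \<omega>) / sqrt (t - s) \<in> J} = measure std_normal J"
proof -
  note [measurable] = sbm_measurable[OF W] J
  have [measurable]: "W t \<in> borel_measurable M" "W s \<in> borel_measurable M"
    using st by (auto intro: sbm_measurable[OF W])
  show ?thesis
    by (subst sbm_incr_distr[OF W st, symmetric], subst measure_distr)
       (auto intro!: arg_cong[where f="measure M"])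
qed

lemma std_normal_tail:
  assumes "0 < c"
  shows "measure std_normal {x. c < \<bar>x\<bar>} \<le> 1 / c\<^sup>2"
proof -
  have "integrable lborel (\<lambda>x. std_normal_density x * x ^ 2)"
    by (rule integrable_std_normal_moment)
  then have i: "integrable std_normal (\<lambda>x. x^2)"
    by (subst integrable_density) auto
  have e: "(\<integral>x. x^2 \<partial>std_normal) = 1"
    using integral_std_normal_moment_even[of 1]
    by (subst integral_density) (auto simp: fact_2)
  have "measure std_normal {x. c < \<bar>x\<bar>} \<le> measure std_normal {x \<in> space std_normal. x^2 \<ge> c^2}"
    using assms by (intro std_normal.finite_measure_mono) (auto simp: abs_le_square_iff[symmetric])
  also have "\<dots> \<le> (\<integral>x. x^2 \<partial>std_normal) / c^2"
    using assms by (intro integral_Markov_inequality_measure[OF i, of "{}"]) auto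
  finally show ?thesis by (simp add: e)
qed

lemma sbm_past_future_indep:
  fixes \<tau> :: "nat \<Rightarrow> real"
  assumes W: "standard_brownian_motion M W" and \<tau>: "0 \<le> \<tau> 0" "mono \<tau>" and am: "a \<le> m"
  shows "prob_space.indep_var M
    (PiM {..a} (\<lambda>_. borel)) (\<lambda>\<omega>. \<lambda>i\<in>{..a}. W (\<tau> i) \<omega> - W (\<tau> 0) \<omega>)
    (PiM {a..m} (\<lambda>_. borel)) (\<lambda>\<omega>. \<lambda>i\<in>{a..m}. W (\<tau> i) \<omega> - W (\<tau> a) \<omega>)"
proof -
  interpret prob_space M using W by (rule sbm_prob_space)
  let ?X = "\<lambda>i \<omega>. W (\<tau> (Suc i)) \<omega> - W (\<tau> i) \<omega>"
  have "indep_vars (\<lambda>_. borel) ?X {..<m}"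
    using W \<tau> by (simp add: standard_brownian_motion_def mono_def)
  then have 1: "indep_var (PiM {..<a} (\<lambda>_. borel)) (\<lambda>\<omega>. \<lambda>i\<in>{..<a}. ?X i \<omega>)
      (PiM {a..<m} (\<lambda>_. borel)) (\<lambda>\<omega>. \<lambda>i\<in>{a..<m}. ?X i \<omega>)"
    by (rule indep_var_restrict) (use am in auto)
  have 2: "(\<lambda>x. \<lambda>i\<in>{..a}. \<Sum>j<i. x j) \<in> PiM {..<a} (\<lambda>_. borel) \<rightarrow>\<^sub>M PiM {..a} (\<lambda>_. borel::real measure)"
    by (intro measurable_restrict borel_measurable_sum measurable_component_singleton) auto
  have 3: "(\<lambda>x. \<lambda>i\<in>{a..m}. \<Sum>j=a..<i. x j) \<in> PiM {a..<m} (\<lambda>_. borel) \<rightarrow>\<^sub>M PiM {a..m} (\<lambda>_. borel::real measure)"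
    by (intro measurable_restrict borel_measurable_sum measurable_component_singleton) auto
  have t1: "(\<Sum>j<i. ?X j \<omega>) = W (\<tau> i) \<omega> - W (\<tau> 0) \<omega>" for i \<omega>
    using sum_lessThan_telescope[of "\<lambda>i. W (\<tau> i) \<omega>" i] by simp
  have t2: "(\<Sum>j=a..<i. ?X j \<omega>) = W (\<tau> i) \<omega> - W (\<tau> a) \<omega>" if "a \<le> i" for i \<omega>
    using sum_Suc_diff'[OF that, of "\<lambda>i. W (\<tau> i) \<omega>"] by simp
  have e1: "(\<lambda>x. \<lambda>i\<in>{..a}. \<Sum>j<i. x j) \<circ> (\<lambda>\<omega>. \<lambda>i\<in>{..<a}. ?X i \<omega>) = (\<lambda>\<omega>. \<lambda>i\<in>{..a}. W (\<tau> i) \<omega> - W (\<tau> 0) \<omega>)"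
  proof (intro ext)
    fix \<omega> i
    show "((\<lambda>x. \<lambda>i\<in>{..a}. \<Sum>j<i. x j) \<circ> (\<lambda>\<omega>. \<lambda>i\<in>{..<a}. ?X i \<omega>)) \<omega> i = (\<lambda>i\<in>{..a}. W (\<tau> i) \<omega> - W (\<tau> 0) \<omega>) i"
    proof (cases "i \<in> {..a}")
      case True
      then have "(\<Sum>j<i. (\<lambda>i\<in>{..<a}. ?X i \<omega>) j) = (\<Sum>j<i. ?X j \<omega>)" by (intro sum.cong) auto
      then show ?thesis using True t1 by simp
    qed simp
  qed
  have e2: "(\<lambda>x. \<lambda>i\<in>{a..m}. \<Sum>j=a..<i. x j) \<circ> (\<lambda>\<omega>. \<lambda>i\<in>{a..<m}. ?X i \<omega>) = (\<lambda>\<omega>. \<lambda>i\<in>{a..m}. W (\<tau> i) \<omega> - W (\<tau> a) \<omega>)"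
  proof (intro ext)
    fix \<omega> i
    show "((\<lambda>x. \<lambda>i\<in>{a..m}. \<Sum>j=a..<i. x j) \<circ> (\<lambda>\<omega>. \<lambda>i\<in>{a..<m}. ?X i \<omega>)) \<omega> i = (\<lambda>i\<in>{a..m}. W (\<tau> i) \<omega> - W (\<tau> a) \<omega>) i"
    proof (cases "i \<in> {a..m}")
      case True
      then have "(\<Sum>j=a..<i. (\<lambda>i\<in>{a..<m}. ?X i \<omega>) j) = (\<Sum>j=a..<i. ?X j \<omega>)" by (intro sum.cong) auto
      then show ?thesis using True t2 by simp
    qed (auto simp: restrict_def)
  qed
  show ?thesis
    using indep_var_compose[OF 1 2 3] unfolding e1 e2 .
qed

lemma sbm_past_future_prob:
  fixes \<tau> :: "nat \<Rightarrow> real"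
  assumes W: "standard_brownian_motion M W" and \<tau>: "0 \<le> \<tau> 0" "mono \<tau>" and am: "a \<le> m"
    and P: "Measurable.pred (PiM {..a} (\<lambda>_. borel)) P"
    and Q: "Measurable.pred (PiM {a..m} (\<lambda>_. borel)) Q"
  shows "measure M {\<omega>\<in>space M. P (\<lambda>i\<in>{..a}. W (\<tau> i) \<omega> - W (\<tau> 0) \<omega>) \<and> Q (\<lambda>i\<in>{a..m}. W (\<tau> i) \<omega> - W (\<tau> a) \<omega>)} =
    measure M {\<omega>\<in>space M. P (\<lambda>i\<in>{..a}. W (\<tau> i) \<omega> - W (\<tau> 0) \<omega>)} *
    measure M {\<omega>\<in>space M. Q (\<lambda>i\<in>{a..m}. W (\<tau> i) \<omega> - W (\<tau> a) \<omega>)}"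
proof -
  interpret prob_space M using W by (rule sbm_prob_space)
  show ?thesis
    using indep_varD[OF sbm_past_future_indep[OF W \<tau> am] P[unfolded pred_def] Q[unfolded pred_def]]
    by (simp add: vimage_def space_PiM PiE_def Int_def conj_ac)
qed

lemma sbm_maximal:
  fixes \<tau> :: "nat \<Rightarrow> real"
  assumes W: "standard_brownian_motion M W" and \<tau>: "0 \<le> \<tau> 0" "mono \<tau>"
    and l: "0 < l" and h: "2 * (\<tau> m - \<tau> 0) \<le> l\<^sup>2"
  shows "measure M {\<omega>\<in>space M. \<exists>i\<le>m. 2 * l < \<bar>W (\<tau> i) \<omega> - W (\<tau> 0) \<omega>\<bar>} \<le> 2 * (\<tau> m - \<tau> 0) / l\<^sup>2"
proof -
  interpret prob_space M using W by (rule sbm_prob_space)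
  have \<tau>0: "0 \<le> \<tau> i" for i using \<tau> by (meson le0 monoD order_trans)
  have [measurable]: "W (\<tau> i) \<in> borel_measurable M" for i
    using \<tau>0 by (rule sbm_measurable[OF W])
  define S where "S i \<omega> = W (\<tau> i) \<omega> - W (\<tau> 0) \<omega>" for i \<omega>
  have [measurable]: "S i \<in> borel_measurable M" for i unfolding S_def by measurable
  have tail: "prob {\<omega>\<in>space M. l < \<bar>S m \<omega> - S k \<omega>\<bar>} \<le> (\<tau> m - \<tau> 0) / l\<^sup>2" if "k \<le> m" for k
  proof (cases "\<tau> k < \<tau> m")
    case True
    let ?d = "\<tau> m - \<tau> k"
    have "prob {\<omega>\<in>space M. l < \<bar>S m \<omega> - S k \<omega>\<bar>} = prob {\<omega>\<in>space M. (W (\<tau> m) \<omega> - W (\<tau> k) \<omega>) / sqrt ?d \<in> {x. l / sqrt ?d < \<bar>x\<bar>}}"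
      using True by (intro arg_cong[where f=prob]) (auto simp: S_def divide_simps)
    also have "\<dots> = measure std_normal {x. l / sqrt ?d < \<bar>x\<bar>}"
      using \<tau>0 True by (intro sbm_incr_prob[OF W]) auto
    also have "\<dots> \<le> 1 / (l / sqrt ?d)\<^sup>2"
      using l True by (intro std_normal_tail) auto
    also have "\<dots> = ?d / l\<^sup>2" using True by (simp add: power_divide)
    also have "\<dots> \<le> (\<tau> m - \<tau> 0) / l\<^sup>2"
      using \<tau>(2) by (intro divide_right_mono) (auto dest: monoD)
    finally show ?thesis .
  next
    case False
    then have "\<tau> k = \<tau> m" using \<tau> that by (metis monoD order_le_less)
    then have "{\<omega>\<in>space M. l < \<bar>S m \<omega> - S k \<omega>\<bar>} = {}" using l by (auto simp: S_def)
    then have "prob {\<omega>\<in>space M. l < \<bar>S m \<omega> - S k \<omega>\<bar>} = 0" by (metis measure_empty)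
    moreover have "\<tau> 0 \<le> \<tau> m" using \<tau>(2) by (simp add: monoD)
    ultimately show ?thesis by simp
  qed
  have half: "prob {\<omega>\<in>space M. \<bar>S m \<omega> - S k \<omega>\<bar> \<le> l} \<ge> 1/2" if "k \<le> m" for k
  proof -
    have "prob {\<omega>\<in>space M. \<bar>S m \<omega> - S k \<omega>\<bar> \<le> l} = 1 - prob {\<omega>\<in>space M. \<not> \<bar>S m \<omega> - S k \<omega>\<bar> \<le> l}"
      by (subst prob_neg) auto
    moreover have "prob {\<omega>\<in>space M. \<not> \<bar>S m \<omega> - S k \<omega>\<bar> \<le> l} \<le> (\<tau> m - \<tau> 0) / l\<^sup>2"
      using tail[OF that] by (simp add: not_le)
    moreover have "(\<tau> m - \<tau> 0) / l\<^sup>2 \<le> 1 / 2" using h l by (simp add: divide_simps)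
    ultimately show ?thesis by linarith
  qed
  define A where "A k = {\<omega>\<in>space M. 2 * l < \<bar>S k \<omega>\<bar> \<and> (\<forall>i<k. \<bar>S i \<omega>\<bar> \<le> 2 * l)}" for k
  define F where "F k = {\<omega>\<in>space M. \<bar>S m \<omega> - S k \<omega>\<bar> \<le> l}" for k
  have [measurable]: "A k \<in> events" "F k \<in> events" for k unfolding A_def F_def by measurable
  have disj: "disjoint_family_on A {..m}"
    by (auto simp: disjoint_family_on_def A_def)
       (metis linorder_cases not_less)
  have indep: "prob (A k \<inter> F k) = prob (A k) * prob (F k)" if "k \<le> m" for k
  proof -
    define P :: "(nat \<Rightarrow> real) \<Rightarrow> bool" where "P = (\<lambda>x. 2 * l < \<bar>x k\<bar> \<and> (\<forall>i\<in>{..<k}. \<bar>x i\<bar> \<le> 2 * l))"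
    define Q :: "(nat \<Rightarrow> real) \<Rightarrow> bool" where "Q = (\<lambda>x. \<bar>x m\<bar> \<le> l)"
    have c: "i \<le> k \<Longrightarrow> (\<lambda>x. x i) \<in> borel_measurable (PiM {..k} (\<lambda>_. borel::real measure))" for i
      by (intro measurable_component_singleton) auto
    have [measurable]: "Measurable.pred (PiM {..k} (\<lambda>_. borel)) P"
      unfolding P_def
      by (intro pred_intros_logic pred_intros_finite borel_measurable_pred_less
          borel_measurable_const borel_measurable_abs c measurable_compose[OF c]) 
         (auto intro!: borel_measurable_le borel_measurable_abs c)
    have c': "(\<lambda>x. x m) \<in> borel_measurable (PiM {k..m} (\<lambda>_. borel::real measure))"
      using that by (intro measurable_component_singleton) auto
    have [measurable]: "Measurable.pred (PiM {k..m} (\<lambda>_. borel)) Q"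
      unfolding Q_def using c' by measurable
    have "A k = {\<omega>\<in>space M. P (\<lambda>i\<in>{..k}. W (\<tau> i) \<omega> - W (\<tau> 0) \<omega>)}"
      by (auto simp: A_def P_def S_def)
    moreover have "F k = {\<omega>\<in>space M. Q (\<lambda>i\<in>{k..m}. W (\<tau> i) \<omega> - W (\<tau> k) \<omega>)}"
      using that by (auto simp: F_def Q_def S_def)
    ultimately show ?thesis
      using sbm_past_future_prob[OF W \<tau> that, of P Q]
      by (simp add: Int_def conj_ac)
  qed
  have "measure M {\<omega>\<in>space M. \<exists>i\<le>m. 2 * l < \<bar>W (\<tau> i) \<omega> - W (\<tau> 0) \<omega>\<bar>} \<le> prob (\<Union>k\<in>{..m}. A k)"
  proof (intro finite_measure_mono subsetI)
    fix \<omega> assume "\<omega> \<in> {\<omega>\<in>space M. \<exists>i\<le>m. 2 * l < \<bar>W (\<tau> i) \<omega> - W (\<tau> 0) \<omega>\<bar>}"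
    then obtain i where i: "\<omega> \<in> space M" "i \<le> m" "2 * l < \<bar>S i \<omega>\<bar>" by (auto simp: S_def)
    define k where "k = (LEAST i. 2 * l < \<bar>S i \<omega>\<bar>)"
    have "2 * l < \<bar>S k \<omega>\<bar>" unfolding k_def using i(3) by (rule LeastI)
    moreover have "k \<le> i" unfolding k_def using i(3) by (rule Least_le)
    moreover have "\<forall>j<k. \<bar>S j \<omega>\<bar> \<le> 2 * l" unfolding k_def using not_less_Least by force
    ultimately show "\<omega> \<in> (\<Union>k\<in>{..m}. A k)" using i by (auto simp: A_def)
  qed auto
  also have "\<dots> = (\<Sum>k\<le>m. prob (A k))"
    by (intro finite_measure_finite_Union disj) auto
  also have "\<dots> \<le> (\<Sum>k\<le>m. 2 * prob (A k \<inter> F k))"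
  proof (intro sum_mono)
    fix k assume "k \<in> {..m}"
    then have "prob (A k \<inter> F k) \<ge> prob (A k) * (1/2)"
      using half[of k] mult_left_mono[OF half[of k], of "prob (A k)"] by (subst indep) (auto simp: F_def)
    then show "prob (A k) \<le> 2 * prob (A k \<inter> F k)" by simp
  qed
  also have "\<dots> = 2 * prob (\<Union>k\<in>{..m}. A k \<inter> F k)"
    using disj by (subst finite_measure_finite_Union)
      (auto simp: sum_distrib_left disjoint_family_on_def)
  also have "prob (\<Union>k\<in>{..m}. A k \<inter> F k) \<le> prob {\<omega>\<in>space M. l < \<bar>S m \<omega> - S 0 \<omega>\<bar>}"
    by (intro finite_measure_mono) (auto simp: A_def F_def S_def)
  also have "\<dots> \<le> (\<tau> m - \<tau> 0) / l\<^sup>2" by (rule tail) simp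
  finally show ?thesis by simp
qed

section \<open>Confining an Ornstein-Uhlenbeck process\<close>

lemma ou_stay_grid:
  fixes Good Core A J1 J2 :: "real set" and m K :: nat
  assumes W: "standard_brownian_motion M W"
    and pos: "0 < \<delta>" "0 < m" "0 < l" "0 \<le> p"
    and [measurable]: "Good \<in> sets borel" "Core \<in> sets borel" "A \<in> sets borel" "J1 \<in> sets borel" "J2 \<in> sets borel"
    and good: "\<And>x v s. x \<in> Core \<Longrightarrow> \<bar>v\<bar> \<le> 2 * l \<Longrightarrow> 0 \<le> s \<Longrightarrow> s \<le> \<delta> \<Longrightarrow> (x + v) / exp (s / 2) \<in> Good"
    and core1: "\<And>x v. x \<in> Core \<Longrightarrow> x \<in> A \<Longrightarrow> \<bar>v\<bar> \<le> 2 * l \<Longrightarrow> v \<in> J1 \<Longrightarrow> (x + v) / exp (\<delta> / 2) \<in> Core"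
    and core2: "\<And>x v. x \<in> Core \<Longrightarrow> x \<notin> A \<Longrightarrow> \<bar>v\<bar> \<le> 2 * l \<Longrightarrow> v \<in> J2 \<Longrightarrow> (x + v) / exp (\<delta> / 2) \<in> Core"
    and h: "2 * (exp \<delta> - 1) \<le> l\<^sup>2"
    and p1: "p + 2 * (exp \<delta> - 1) / l\<^sup>2 \<le> measure std_normal {x. sqrt (exp \<delta> - 1) * x \<in> J1}"
    and p2: "p + 2 * (exp \<delta> - 1) / l\<^sup>2 \<le> measure std_normal {x. sqrt (exp \<delta> - 1) * x \<in> J2}"
  shows "p ^ K * measure std_normal Core \<le>
    measure M {\<omega>\<in>space M. \<forall>j\<le>K * m. (W (exp (j * (\<delta> / m))) \<omega> - W 0 \<omega>) / exp (j * (\<delta> / m) / 2) \<in> Good}"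
proof -
  interpret prob_space M using W by (rule sbm_prob_space)
  define \<eta> where "\<eta> = \<delta> / m"
  have \<eta>: "0 < \<eta>" "m * \<eta> = \<delta>" using pos by (auto simp: \<eta>_def)
  define \<tau> where "\<tau> i = (case i of 0 \<Rightarrow> 0 | Suc j \<Rightarrow> exp (j * \<eta>))" for i
  have \<tau>S: "\<tau> (Suc j) = exp (j * \<eta>)" and \<tau>0: "\<tau> 0 = 0" for j by (auto simp: \<tau>_def)
  have mono: "mono \<tau>"
    using \<eta> by (intro monoI) (auto simp: \<tau>_def split: nat.splits)
  have \<tau>n: "0 \<le> \<tau> i" for i by (auto simp: \<tau>_def split: nat.splits)
  have [measurable]: "W (\<tau> i) \<in> borel_measurable M" for i
    using \<tau>n by (rule sbm_measurable[OF W])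
  define X where "X j \<omega> = (W (\<tau> (Suc j)) \<omega> - W (\<tau> 0) \<omega>) / exp (j * \<eta> / 2)" for j \<omega>
  define U where "U k j \<omega> = (W (\<tau> (Suc (k * m + j))) \<omega> - W (\<tau> (Suc (k * m))) \<omega>) / exp (k * \<delta> / 2)" for k j \<omega>
  have [measurable]: "X j \<in> borel_measurable M" "U k j \<in> borel_measurable M" for j k
    unfolding X_def U_def by measurable
  have X_step: "X (k * m + j) \<omega> = (X (k * m) \<omega> + U k j \<omega>) / exp (j * \<eta> / 2)" for k j \<omega>
  proof -
    have "exp (real (k * m + j) * \<eta> / 2) = exp (k * \<delta> / 2) * exp (j * \<eta> / 2)"
      by (simp add: exp_add[symmetric] \<eta>(2)[symmetric] algebra_simps add_divide_distrib)
    moreover have "exp (real (k * m) * \<eta> / 2) = exp (k * \<delta> / 2)"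
      by (simp add: \<eta>(2)[symmetric] algebra_simps)
    moreover have "(w - w0) / (a * b) = ((v - w0) / a + (w - v) / a) / b" for w w0 v a b :: real
      by (simp add: add_divide_distrib[symmetric])
    ultimately show ?thesis
      unfolding X_def U_def by presburger
  qed
  define E where "E k = {\<omega>\<in>space M. (\<forall>j\<le>k * m. X j \<omega> \<in> Good) \<and> X (k * m) \<omega> \<in> Core}" for k
  define G where "G k = {\<omega>\<in>space M. \<forall>j\<le>m. \<bar>U k j \<omega>\<bar> \<le> 2 * l}" for k
  define V where "V k J = {\<omega>\<in>space M. U k m \<omega> \<in> J}" for k J
  have E_meas[measurable]: "E k \<in> events" for k unfolding E_def by measurable
  have G_meas[measurable]: "G k \<in> events" for k unfolding G_def by measurable
  have V_meas[measurable]: "V k J \<in> events" if [measurable]: "J \<in> sets borel" for k J unfolding V_def by measurable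
  have probG: "prob (G k) \<ge> 1 - 2 * (exp \<delta> - 1) / l\<^sup>2" for k
  proof -
    define \<tau>' where "\<tau>' i = \<tau> (Suc (k * m) + i)" for i
    have d: "\<tau>' m - \<tau>' 0 = exp (k * \<delta>) * (exp \<delta> - 1)"
      unfolding \<tau>'_def by (simp add: \<tau>S) (simp add: \<eta>(2)[symmetric] exp_add[symmetric] algebra_simps)
    have sq: "(l * exp (k * \<delta> / 2))\<^sup>2 = l\<^sup>2 * exp (k * \<delta>)"
      by (simp add: power_mult_distrib exp_double[symmetric])
    have "prob {\<omega>\<in>space M. \<exists>i\<le>m. 2 * (l * exp (k * \<delta> / 2)) < \<bar>W (\<tau>' i) \<omega> - W (\<tau>' 0) \<omega>\<bar>} \<le> 2 * (\<tau>' m - \<tau>' 0) / (l * exp (k * \<delta> / 2))\<^sup>2"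
    proof (rule sbm_maximal[OF W])
      show "0 \<le> \<tau>' 0" by (simp add: \<tau>'_def \<tau>n)
      show "mono \<tau>'" using mono by (auto simp: \<tau>'_def mono_def)
      show "0 < l * exp (k * \<delta> / 2)" using pos by simp
      have "exp (k * \<delta>) * (2 * (exp \<delta> - 1)) \<le> exp (k * \<delta>) * l\<^sup>2"
        using h by (intro mult_left_mono) auto
      then show "2 * (\<tau>' m - \<tau>' 0) \<le> (l * exp (k * \<delta> / 2))\<^sup>2"
        unfolding d sq by (simp add: algebra_simps)
    qed
    also have "\<dots> = 2 * (exp \<delta> - 1) / l\<^sup>2"
      unfolding d sq by simp
    also have "{\<omega>\<in>space M. \<exists>i\<le>m. 2 * (l * exp (k * \<delta> / 2)) < \<bar>W (\<tau>' i) \<omega> - W (\<tau>' 0) \<omega>\<bar>} = {\<omega>\<in>space M. \<not> (\<forall>j\<le>m. \<bar>U k j \<omega>\<bar> \<le> 2 * l)}"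
      unfolding \<tau>'_def U_def by (auto simp: divide_simps not_le mult.assoc)
    also have "prob \<dots> = 1 - prob (G k)"
      unfolding G_def by (subst prob_neg[symmetric]) auto
    finally show ?thesis by simp
  qed
  have probV: "prob (V k J) = measure std_normal {x. sqrt (exp \<delta> - 1) * x \<in> J}"
    if [measurable]: "J \<in> sets borel" for k J
  proof -
    let ?s = "exp (k * \<delta>)" and ?t = "exp (k * \<delta> + \<delta>)"
    have st: "?t - ?s = exp (k * \<delta>) * (exp \<delta> - 1)"
      by (simp add: exp_add algebra_simps)
    have "(exp (k * \<delta> / 2))\<^sup>2 = exp (k * \<delta>)" by (simp add: exp_double[symmetric])
    then have r: "sqrt (?t - ?s) = exp (k * \<delta> / 2) * sqrt (exp \<delta> - 1)"
      unfolding st by (metis abs_exp_cancel real_sqrt_abs real_sqrt_mult)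
    have q: "sqrt (exp \<delta> - 1) > 0" using pos by simp
    have t1: "\<tau> (Suc (k * m)) = ?s" "\<tau> (Suc (k * m + m)) = ?t"
      by (simp_all add: \<tau>S \<eta>(2)[symmetric] algebra_simps)
    have "V k J = {\<omega>\<in>space M. (W ?t \<omega> - W ?s \<omega>) / sqrt (?t - ?s) \<in> {x. sqrt (exp \<delta> - 1) * x \<in> J}}"
      unfolding V_def U_def t1 r using q by auto
    then show ?thesis
      using pos by (simp only:) (intro sbm_incr_prob[OF W], auto)
  qed
  have GV: "prob (G k \<inter> V k J) \<ge> p"
    if J: "J \<in> sets borel" and "p + 2 * (exp \<delta> - 1) / l\<^sup>2 \<le> measure std_normal {x. sqrt (exp \<delta> - 1) * x \<in> J}" for k J
  proof -
    have "prob (V k J) \<le> prob (G k \<inter> V k J) + prob (space M - G k)"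
      using J by (intro order_trans[OF _ measure_Un_le] finite_measure_mono) (auto simp: V_def)
    then show ?thesis
      using that probG[of k] probV[OF J, of k] prob_compl[OF G_meas, of k] by linarith
  qed
  have indep: "prob ((E k \<inter> {\<omega>\<in>space M. X (k * m) \<omega> \<in> B}) \<inter> (G k \<inter> V k J)) =
     prob (E k \<inter> {\<omega>\<in>space M. X (k * m) \<omega> \<in> B}) * prob (G k \<inter> V k J)"
    if [measurable]: "B \<in> sets borel" "J \<in> sets borel" for k B J
  proof -
    let ?a = "Suc (k * m)" and ?b = "Suc (k * m + m)"
    define P :: "(nat \<Rightarrow> real) \<Rightarrow> bool" where
      "P = (\<lambda>x. (\<forall>j\<in>{..k * m}. x (Suc j) / exp (j * \<eta> / 2) \<in> Good) \<and> x ?a / exp (real (k * m) * \<eta> / 2) \<in> Core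
         \<and> x ?a / exp (real (k * m) * \<eta> / 2) \<in> B)"
    define Q :: "(nat \<Rightarrow> real) \<Rightarrow> bool" where
      "Q = (\<lambda>x. (\<forall>j\<in>{..m}. \<bar>x (Suc (k * m + j)) / exp (k * \<delta> / 2)\<bar> \<le> 2 * l) \<and> x ?b / exp (k * \<delta> / 2) \<in> J)"
    have c: "i \<le> ?a \<Longrightarrow> (\<lambda>x. x i / d) \<in> borel_measurable (PiM {..?a} (\<lambda>_. borel::real measure))" for i d
      by (intro borel_measurable_divide measurable_component_singleton) auto
    have c': "?a \<le> i \<Longrightarrow> i \<le> ?b \<Longrightarrow> (\<lambda>x. x i / d) \<in> borel_measurable (PiM {?a..?b} (\<lambda>_. borel::real measure))" for i d
      by (intro borel_measurable_divide measurable_component_singleton) auto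
    have P: "Measurable.pred (PiM {..?a} (\<lambda>_. borel)) P"
      unfolding P_def
      by (intro pred_intros_logic pred_intros_finite pred_sets2[OF _ c]) (auto simp: that)
    have Q: "Measurable.pred (PiM {?a..?b} (\<lambda>_. borel)) Q"
      unfolding Q_def
      by (intro pred_intros_logic pred_intros_finite pred_sets2[OF _ c'] borel_measurable_le
            borel_measurable_abs c' borel_measurable_const) (auto simp: that)
    have ab: "?a \<le> ?b" by simp
    have e1: "E k \<inter> {\<omega>\<in>space M. X (k * m) \<omega> \<in> B} = {\<omega>\<in>space M. P (\<lambda>i\<in>{..?a}. W (\<tau> i) \<omega> - W (\<tau> 0) \<omega>)}"
      unfolding E_def P_def X_def by auto
    have e2: "G k \<inter> V k J = {\<omega>\<in>space M. Q (\<lambda>i\<in>{?a..?b}. W (\<tau> i) \<omega> - W (\<tau> ?a) \<omega>)}"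
      unfolding G_def V_def Q_def U_def by (auto simp del: abs_divide)
    have e3: "(E k \<inter> {\<omega>\<in>space M. X (k * m) \<omega> \<in> B}) \<inter> (G k \<inter> V k J) =
       {\<omega>\<in>space M. P (\<lambda>i\<in>{..?a}. W (\<tau> i) \<omega> - W (\<tau> 0) \<omega>) \<and> Q (\<lambda>i\<in>{?a..?b}. W (\<tau> i) \<omega> - W (\<tau> ?a) \<omega>)}"
      unfolding e1 e2 by auto
    show ?thesis
      unfolding e3 unfolding e1 e2 by (rule sbm_past_future_prob[OF W _ mono ab P Q]) (simp add: \<tau>0)
  qed
  have step: "p * prob (E k) \<le> prob (E (Suc k))" for k
  proof -
    let ?A = "{\<omega>\<in>space M. X (k * m) \<omega> \<in> A}" and ?B = "{\<omega>\<in>space M. X (k * m) \<omega> \<in> - A}"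
    let ?E1 = "(E k \<inter> ?A) \<inter> (G k \<inter> V k J1)" and ?E2 = "(E k \<inter> ?B) \<inter> (G k \<inter> V k J2)"
    have sub: "?E1 \<union> ?E2 \<subseteq> E (Suc k)"
    proof
      fix \<omega> assume w: "\<omega> \<in> ?E1 \<union> ?E2"
      then have E: "\<omega> \<in> E k" and G: "\<omega> \<in> G k" and V: "X (k * m) \<omega> \<in> A \<and> U k m \<omega> \<in> J1 \<or> X (k * m) \<omega> \<notin> A \<and> U k m \<omega> \<in> J2"
        by (auto simp: V_def)
      have "X (Suc k * m) \<omega> = (X (k * m) \<omega> + U k m \<omega>) / exp (\<delta> / 2)"
        using X_step[of k m \<omega>] by (simp add: \<eta>(2) add.commute)
      moreover have "\<dots> \<in> Core"
        using V E G core1[of "X (k * m) \<omega>" "U k m \<omega>"] core2[of "X (k * m) \<omega>" "U k m \<omega>"]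
        by (auto simp: E_def G_def)
      moreover have "X j \<omega> \<in> Good" if "j \<le> Suc k * m" for j
      proof (cases "j \<le> k * m")
        case True then show ?thesis using E by (simp add: E_def)
      next
        case False
        then obtain i where i: "j = k * m + i" by (metis le_Suc_ex nat_le_linear)
        then have im: "i \<le> m" using that by simp
        then have "i * \<eta> \<le> m * \<eta>" using \<eta>(1) by (intro mult_right_mono) auto
        then show ?thesis
          unfolding i X_step using E G im \<eta> by (intro good) (auto simp: E_def G_def)
      qed
      ultimately show "\<omega> \<in> E (Suc k)" using E by (auto simp: E_def)
    qed
    have m1: "?E1 \<in> events" "?E2 \<in> events" "E k \<inter> ?A \<in> events" "E k \<inter> ?B \<in> events" by measurable
    have "p * prob (E k) = p * (prob (E k \<inter> ?A) + prob (E k \<inter> ?B))"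
      by (subst finite_measure_Union[symmetric]) (use m1 in \<open>auto simp: E_def intro!: arg_cong[where f=prob]\<close>)
    also have "\<dots> \<le> prob (E k \<inter> ?A) * prob (G k \<inter> V k J1) + prob (E k \<inter> ?B) * prob (G k \<inter> V k J2)"
      using mult_right_mono[OF GV[OF _ p1, of k], of "prob (E k \<inter> ?A)"] mult_right_mono[OF GV[OF _ p2, of k], of "prob (E k \<inter> ?B)"]
      by (simp add: algebra_simps)
    also have "\<dots> = prob ?E1 + prob ?E2"
      by (subst (1 2) indep) auto
    also have "\<dots> = prob (?E1 \<union> ?E2)"
      by (intro finite_measure_Union[symmetric] m1) auto
    also have "\<dots> \<le> prob (E (Suc k))"
      by (intro finite_measure_mono sub) auto
    finally show ?thesis .
  qed
  have "Core \<subseteq> Good" using good[of _ 0 0] pos by auto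
  then have "E 0 = {\<omega>\<in>space M. (W 1 \<omega> - W 0 \<omega>) / sqrt (1 - 0) \<in> Core}"
    by (auto simp: E_def X_def \<tau>S \<tau>0)
  then have "prob (E 0) = measure std_normal Core"
    by (simp only:) (intro sbm_incr_prob[OF W], auto)
  moreover have "p ^ k * prob (E 0) \<le> prob (E k)" for k
  proof (induction k)
    case (Suc k)
    have "p ^ Suc k * prob (E 0) \<le> p * prob (E k)"
      using mult_left_mono[OF Suc, of p] pos by (simp add: mult.assoc)
    then show ?case using step[of k] by linarith
  qed simp
  ultimately have "p ^ K * measure std_normal Core \<le> prob (E K)" by metis
  also have "\<dots> \<le> prob {\<omega>\<in>space M. \<forall>j\<le>K * m. X j \<omega> \<in> Good}"
    by (intro finite_measure_mono) (auto simp: E_def)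
  finally show ?thesis
    by (simp add: X_def \<tau>S \<tau>0 \<eta>_def)
qed

lemma std_normal_uminus:
  assumes [measurable]: "S \<in> sets borel"
  shows "measure std_normal {x. - x \<in> S} = measure std_normal S"
proof -
  have "distributed std_normal lborel (\<lambda>x. x) std_normal_density"
    unfolding distributed_def by (auto simp: distr_id2)
  from std_normal.normal_density_affine[OF this, of "-1" 0]
  have "distr std_normal lborel (\<lambda>x. - x) = std_normal"
    by (simp add: distributed_def)
  then have "measure std_normal S = measure (distr std_normal lborel (\<lambda>x. - x)) S" by simp
  also have "\<dots> = measure std_normal {x. - x \<in> S}"
    by (subst measure_distr) (auto simp: vimage_def)
  finally show ?thesis by simp
qed

lemma std_normal_half: "measure std_normal {0..} \<ge> 1 / 2" "measure std_normal {..0} \<ge> 1 / 2"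
proof -
  have "{x::real. - x \<in> {0..}} = {..0}" by auto
  then have eq: "measure std_normal {..0} = measure std_normal {0..}"
    using std_normal_uminus[of "{0..}"] by simp
  have "1 = measure std_normal ({0..} \<union> {..0})"
    using std_normal.prob_space by (simp add: ivl_disj_un Un_commute flip: UNIV_eq_I)
      (metis (no_types, lifting) UNIV_I UNIV_eq_I Un_iff atLeast_iff atMost_iff linear)
  also have "\<dots> \<le> measure std_normal {0..} + measure std_normal {..0}"
    by (intro measure_Un_le) auto
  finally show "measure std_normal {0..} \<ge> 1 / 2" "measure std_normal {..0} \<ge> 1 / 2"
    using eq by auto
qed

lemma std_normal_density_le_1: "std_normal_density x \<le> 1"
proof -
  have "exp (- (x\<^sup>2) / 2) \<le> 1" by simp
  moreover have "1 \<le> sqrt (2 * pi)" using pi_gt3 by simp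
  ultimately have "1 / sqrt (2 * pi) * exp (- (x\<^sup>2) / 2) \<le> 1 * 1"
    by (intro mult_mono) auto
  then show ?thesis by (simp add: std_normal_density_def)
qed

lemma std_normal_le_lborel:
  assumes [measurable]: "S \<in> sets borel"
  shows "emeasure std_normal S \<le> emeasure lborel S"
proof -
  have "emeasure std_normal S = (\<integral>\<^sup>+x. ennreal (std_normal_density x) * indicator S x \<partial>lborel)"
    by (subst emeasure_density) auto
  also have "\<dots> \<le> (\<integral>\<^sup>+x. indicator S x \<partial>lborel)"
    using std_normal_density_le_1
    by (intro nn_integral_mono) (auto simp: indicator_def ennreal_le_1)
  finally show ?thesis by simp
qed

lemma std_normal_interval_le:
  assumes "a \<le> b"
  shows "measure std_normal {a..b} \<le> b - a"
  using std_normal_le_lborel[of "{a..b}"] assms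
  by (simp add: std_normal.emeasure_eq_measure)

lemma std_normal_pos:
  assumes "a < b" "{a..b} \<subseteq> S" and S[measurable]: "S \<in> sets borel"
  shows "0 < measure std_normal S"
proof (rule ccontr)
  assume "\<not> ?thesis"
  then have "emeasure std_normal S = 0"
    by (simp add: std_normal.emeasure_eq_measure not_less measure_le_0_iff)
  then have "S \<in> null_sets std_normal" by auto
  then have "AE x in lborel. x \<in> S \<longrightarrow> ennreal (std_normal_density x) = 0"
    by (subst (asm) null_sets_density_iff) auto
  then have "AE x in lborel. x \<notin> S"
    by (rule AE_mp) (use normal_density_pos[of 1 0] in \<open>auto simp: ennreal_eq_0_iff not_le[symmetric]\<close>)
  then have "S \<in> null_sets lborel" by (subst AE_iff_null_sets) auto
  then have "{a..b} \<in> null_sets lborel" by (rule null_sets_subset) (use assms in auto)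
  then show False using assms(1) by auto
qed

definition ou_event :: "'a measure \<Rightarrow> (real \<Rightarrow> 'a \<Rightarrow> real) \<Rightarrow> real \<Rightarrow> real set \<Rightarrow> 'a set" where
  "ou_event M W T Good = {\<omega>\<in>space M. \<forall>t\<in>\<rat> \<inter> {0..T}. W (exp t) \<omega> / exp (t / 2) \<in> Good}"

lemma ou_event_sets:
  assumes "standard_brownian_motion M W" "Good \<in> sets borel"
  shows "ou_event M W T Good \<in> sets M"
proof -
  note [measurable] = sbm_measurable[OF assms(1)] assms(2)
  have [measurable]: "W (exp t) \<in> borel_measurable M" for t by (rule sbm_measurable[OF assms(1)]) simp
  have c: "countable (\<rat> \<inter> {0..T})" using countable_rat by (rule countable_Int1)
  show ?thesis
    unfolding ou_event_def by (measurable, rule c, measurable)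
qed

lemma continuous_grid_closed:
  fixes g :: "real \<Rightarrow> real"
  assumes g: "continuous_on {0..} g" and "closed S" "0 < \<delta>"
    and grid: "\<And>l j. j \<le> K * 2 ^ l \<Longrightarrow> g (real j * (\<delta> / 2 ^ l)) \<in> S"
    and t: "0 \<le> t" "t \<le> K * \<delta>"
  shows "g t \<in> S"
proof -
  define j where "j l = nat \<lfloor>t * 2 ^ l / \<delta>\<rfloor>" for l :: nat
  define s where "s l = real (j l) * (\<delta> / 2 ^ l)" for l
  have jr: "real (j l) \<le> t * 2 ^ l / \<delta>" "t * 2 ^ l / \<delta> - 1 \<le> real (j l)" for l
    using t assms(3) unfolding j_def by (auto simp: of_nat_nat)
  have j_le: "j l \<le> K * 2 ^ l" for l
  proof -
    have "t * 2 ^ l / \<delta> \<le> K * 2 ^ l" using t assms(3) by (simp add: field_simps)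
    then have "real (j l) \<le> real (K * 2 ^ l)" using jr(1)[of l] by simp
    then show ?thesis by linarith
  qed
  have s_le: "s l \<le> t" "t - \<delta> / 2 ^ l \<le> s l" for l
  proof -
    have d: "0 \<le> \<delta> / 2 ^ l" "\<delta> / 2 ^ l \<noteq> 0" using assms(3) by auto
    have c: "t * 2 ^ l / \<delta> * (\<delta> / 2 ^ l) = t" using assms(3) by simp
    show "s l \<le> t" using mult_right_mono[OF jr(1)[of l] d(1)] unfolding c s_def .
    have "(t * 2 ^ l / \<delta> - 1) * (\<delta> / 2 ^ l) = t - \<delta> / 2 ^ l" unfolding left_diff_distrib c by simp
    then show "t - \<delta> / 2 ^ l \<le> s l" using mult_right_mono[OF jr(2)[of l] d(1)] unfolding s_def by simp
  qed
  have "s \<longlonglongrightarrow> t"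
  proof (rule tendsto_sandwich)
    show "(\<lambda>l. t - \<delta> / 2 ^ l) \<longlonglongrightarrow> t"
      by real_asymp
  qed (use s_le in auto)
  moreover have "s l \<in> {0..}" for l using assms(3) by (simp add: s_def)
  ultimately have "(\<lambda>l. g (s l)) \<longlonglongrightarrow> g t"
    using g t by (auto simp: continuous_on_sequentially comp_def)
  moreover have "g (s l) \<in> S" for l using grid[OF j_le] unfolding s_def .
  ultimately show ?thesis
    using closed_sequentially[OF \<open>closed S\<close>, of "\<lambda>l. g (s l)" "g t"] by blast
qed

lemma ou_stay:
  fixes Good Core A J1 J2 :: "real set" and K :: nat and \<delta> l p T :: real
  assumes W: "standard_brownian_motion M W" and cl: "closed Good"
    and pos: "0 < \<delta>" "0 < l" "0 \<le> p" and T: "T \<le> K * \<delta>"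
    and m: "Core \<in> sets borel" "A \<in> sets borel" "J1 \<in> sets borel" "J2 \<in> sets borel"
    and good: "\<And>x v s. x \<in> Core \<Longrightarrow> \<bar>v\<bar> \<le> 2 * l \<Longrightarrow> 0 \<le> s \<Longrightarrow> s \<le> \<delta> \<Longrightarrow> (x + v) / exp (s / 2) \<in> Good"
    and core1: "\<And>x v. x \<in> Core \<Longrightarrow> x \<in> A \<Longrightarrow> \<bar>v\<bar> \<le> 2 * l \<Longrightarrow> v \<in> J1 \<Longrightarrow> (x + v) / exp (\<delta> / 2) \<in> Core"
    and core2: "\<And>x v. x \<in> Core \<Longrightarrow> x \<notin> A \<Longrightarrow> \<bar>v\<bar> \<le> 2 * l \<Longrightarrow> v \<in> J2 \<Longrightarrow> (x + v) / exp (\<delta> / 2) \<in> Core"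
    and h: "2 * (exp \<delta> - 1) \<le> l\<^sup>2"
    and p1: "p + 2 * (exp \<delta> - 1) / l\<^sup>2 \<le> measure std_normal {x. sqrt (exp \<delta> - 1) * x \<in> J1}"
    and p2: "p + 2 * (exp \<delta> - 1) / l\<^sup>2 \<le> measure std_normal {x. sqrt (exp \<delta> - 1) * x \<in> J2}"
  shows "p ^ K * measure std_normal Core \<le> measure M (ou_event M W T Good)"
proof -
  interpret prob_space M using W by (rule sbm_prob_space)
  have Good[measurable]: "Good \<in> sets borel" using cl by simp
  have [measurable]: "W (exp t) \<in> borel_measurable M" "W 0 \<in> borel_measurable M" for t
    by (auto intro: sbm_measurable[OF W])
  define D where "D n = {\<omega>\<in>space M. \<forall>j\<le>K * 2 ^ n. (W (exp (j * (\<delta> / 2 ^ n))) \<omega> - W 0 \<omega>) / exp (j * (\<delta> / 2 ^ n) / 2) \<in> Good}" for n :: nat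
  have D_ge: "p ^ K * measure std_normal Core \<le> prob (D n)" for n
    using ou_stay_grid[OF W pos(1) _ pos(2,3) Good m good core1 core2 h p1 p2, of "2 ^ n" K]
    by (simp add: D_def)
  have [measurable]: "D n \<in> events" for n unfolding D_def by measurable
  have dec: "decseq D"
  proof (rule decseq_SucI, rule subsetI)
    fix n \<omega> assume w: "\<omega> \<in> D (Suc n)"
    show "\<omega> \<in> D n"
      unfolding D_def
    proof (intro CollectI conjI allI impI)
      fix j assume "j \<le> K * 2 ^ n"
      then have "2 * j \<le> K * 2 ^ Suc n" by simp
      moreover have "real (2 * j) * (\<delta> / 2 ^ Suc n) = j * (\<delta> / 2 ^ n)" by simp
      ultimately show "(W (exp (j * (\<delta> / 2 ^ n))) \<omega> - W 0 \<omega>) / exp (j * (\<delta> / 2 ^ n) / 2) \<in> Good"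
        using w unfolding D_def by (metis (mono_tags, lifting) mem_Collect_eq)
    qed (use w in \<open>auto simp: D_def\<close>)
  qed
  have "(\<lambda>n. prob (D n)) \<longlonglongrightarrow> prob (\<Inter>n. D n)"
    by (intro finite_Lim_measure_decseq dec) auto
  then have "p ^ K * measure std_normal Core \<le> prob (\<Inter>n. D n)"
    using D_ge by (intro LIMSEQ_le_const) auto
  also have "\<dots> \<le> prob (ou_event M W T Good)"
  proof (rule finite_measure_mono_AE)
    have "AE \<omega> in M. W 0 \<omega> = 0" "AE \<omega> in M. continuous_on {0..} (\<lambda>t. W t \<omega>)"
      using W by (auto simp: standard_brownian_motion_def)
    then show "AE \<omega> in M. \<omega> \<in> (\<Inter>n. D n) \<longrightarrow> \<omega> \<in> ou_event M W T Good"
      using AE_space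
    proof eventually_elim
      case (elim \<omega>)
      show ?case
      proof
        assume w: "\<omega> \<in> (\<Inter>n. D n)"
        define g where "g t = W (exp t) \<omega> / exp (t / 2)" for t
        have "continuous_on {0..} g"
          unfolding g_def
          by (intro continuous_intros continuous_on_compose2[OF elim(2)]) auto
        then have "g t \<in> Good" if "0 \<le> t" "t \<le> T" for t
        proof (rule continuous_grid_closed[OF _ cl pos(1), where K=K])
          fix n j :: nat assume "j \<le> K * 2 ^ n"
          then show "g (real j * (\<delta> / 2 ^ n)) \<in> Good"
            using w elim(1) by (simp add: D_def g_def)
        qed (use that T in auto)
        then show "\<omega> \<in> ou_event M W T Good"
          using elim(3) by (simp add: ou_event_def g_def)
      qed
    qed
  qed (rule ou_event_sets[OF W Good])
  finally show ?thesis .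
qed

lemma ln_add_one_ge_half: "0 \<le> x \<Longrightarrow> x \<le> 1 \<Longrightarrow> x / 2 \<le> ln (1 + x)" for x :: real
proof -
  assume x: "0 \<le> x" "x \<le> 1"
  have "ln (1 / (1 + x)) \<le> 1 / (1 + x) - 1" using x by (intro ln_le_minus_one) auto
  then have "x / (1 + x) \<le> ln (1 + x)" using x by (simp add: ln_div divide_simps)
  moreover have "x / 2 \<le> x / (1 + x)" using x by (intro divide_left_mono) auto
  ultimately show ?thesis by linarith
qed

lemma one_minus_ge_exp: "0 \<le> x \<Longrightarrow> x \<le> 1 / 2 \<Longrightarrow> exp (- 2 * x) \<le> 1 - x" for x :: real
proof -
  assume x: "0 \<le> x" "x \<le> 1 / 2"
  have "- x - 2 * x\<^sup>2 \<le> ln (1 - x)" using x by (rule ln_one_minus_pos_lower_bound)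
  moreover have "x * x \<le> x * (1 / 2)" using x by (intro mult_left_mono) auto
  ultimately have "- 2 * x \<le> ln (1 - x)" by (simp add: power2_eq_square)
  then have "exp (- 2 * x) \<le> exp (ln (1 - x))" by (subst exp_le_cancel_iff)
  then show ?thesis using x by simp
qed

lemma ou_stay_large:
  assumes W: "standard_brownian_motion M W" and b: "16 \<le> b" and T: "0 \<le> T"
  shows "exp (- (192 / b\<^sup>2) * (T + 2)) \<le> measure M (ou_event M W T {- b..b})"
proof -
  define K where "K = nat \<lceil>T / ln 4\<rceil>"
  have l4: "1 \<le> ln (4::real)" using ln_ge_iff[of 4 1] exp_le by simp
  have K: "T / ln 4 \<le> K" "K \<le> T / ln 4 + 1" unfolding K_def using T l4 by auto
  have "T / ln 4 \<le> T / 1" using T l4 by (intro divide_left_mono) auto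
  then have K1: "K + 1 \<le> T + 2" using K by simp
  have b2: "256 \<le> b\<^sup>2" using power_mono[OF b, of 2] by simp
  define p where "p = 1 - 96 / b\<^sup>2"
  have "96 / b\<^sup>2 \<le> 1 / 2" using frac_le[of 96 96 256 "b\<^sup>2"] b2 by simp
  then have p: "0 \<le> p" "exp (- 2 * (96 / b\<^sup>2)) \<le> p"
    unfolding p_def using one_minus_ge_exp[of "96 / b\<^sup>2"] by simp_all
  have "p \<le> 1 - 1 / (b / 2)\<^sup>2" using b2 by (simp add: p_def power_divide divide_right_mono)
  also have "\<dots> \<le> 1 - measure std_normal {x. b / 2 < \<bar>x\<bar>}"
    using std_normal_tail[of "b / 2"] b by simp
  also have "\<dots> = measure std_normal (space std_normal - {x. b / 2 < \<bar>x\<bar>})"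
    by (subst std_normal.prob_compl) auto
  also have "space std_normal - {x. b / 2 < \<bar>x\<bar>} = {- (b / 2)..b / 2}" by auto
  finally have core: "p \<le> measure std_normal {- (b / 2)..b / 2}" .
  have "p ^ K * measure std_normal {- (b / 2)..b / 2} \<le> measure M (ou_event M W T {- b..b})"
  proof (rule ou_stay[OF W, where \<delta> = "ln 4" and l = "b / 4" and A = UNIV and ?J1.0 = UNIV and ?J2.0 = UNIV])
    show "T \<le> real K * ln 4" using K(1) l4 by (simp add: divide_simps)
    show "(x + v) / exp (s / 2) \<in> {- b..b}"
      if "x \<in> {- (b / 2)..b / 2}" "\<bar>v\<bar> \<le> 2 * (b / 4)" "0 \<le> s" "s \<le> ln 4" for x v s
    proof -
      have "\<bar>(x + v) / exp (s / 2)\<bar> \<le> \<bar>x + v\<bar> / 1" unfolding abs_divide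
        using that by (intro divide_mono) auto
      also have "\<dots> \<le> b" using that by auto
      finally show ?thesis unfolding abs_le_iff atLeastAtMost_iff by linarith
    qed
    have e2: "exp (ln 4 / 2) = (2::real)"
    proof -
      have "ln (4::real) = 2 * ln 2" using ln_realpow[of 2 2] by simp
      then show ?thesis by simp
    qed
    show "(x + v) / exp (ln 4 / 2) \<in> {- (b / 2)..b / 2}"
      if "x \<in> {- (b / 2)..b / 2}" "\<bar>v\<bar> \<le> 2 * (b / 4)" for x v
      unfolding e2 using that by auto
    then show "(x + v) / exp (ln 4 / 2) \<in> {- (b / 2)..b / 2}"
      if "x \<in> {- (b / 2)..b / 2}" "\<bar>v\<bar> \<le> 2 * (b / 4)" for x v
      using that by auto
    show "p + 2 * (exp (ln 4) - 1) / (b / 4)\<^sup>2 \<le> measure std_normal {x. sqrt (exp (ln 4) - 1) * x \<in> UNIV}"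
      using std_normal.prob_space by (simp add: p_def power_divide)
    then show "p + 2 * (exp (ln 4) - 1) / (b / 4)\<^sup>2 \<le> measure std_normal {x. sqrt (exp (ln 4) - 1) * x \<in> UNIV}" .
  qed (use b b2 p in \<open>auto simp: power_divide\<close>)
  moreover have "p ^ K * p \<le> p ^ K * measure std_normal {- (b / 2)..b / 2}"
    using core p by (intro mult_left_mono) auto
  moreover have "exp (- (192 / b\<^sup>2) * (T + 2)) \<le> p ^ K * p"
  proof -
    have "exp (- (192 / b\<^sup>2) * (T + 2)) \<le> exp (- (192 / b\<^sup>2) * real (K + 1))"
      using K1 by (subst exp_le_cancel_iff) (intro mult_left_mono_neg, auto)
    also have "\<dots> = exp (- 2 * (96 / b\<^sup>2)) ^ (K + 1)"
      by (subst exp_of_nat_mult[symmetric]) (simp add: mult.commute)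
    also have "\<dots> \<le> p ^ (K + 1)" using p by (intro power_mono) auto
    finally show ?thesis by (simp add: mult.commute)
  qed
  ultimately show ?thesis by linarith
qed

lemma quarter_power_ge:
  fixes T \<delta> \<eta> :: real
  assumes "0 < \<eta>" "\<eta> / 2 \<le> \<delta>" "0 \<le> T" "K = nat \<lceil>T / \<delta>\<rceil>"
  shows "exp (- (4 / \<eta>) * T) / 4 \<le> (1 / 4) ^ K" "T \<le> K * \<delta>"
proof -
  have d: "0 < \<delta>" using assms by simp
  have K: "T / \<delta> \<le> K" "K \<le> T / \<delta> + 1" unfolding assms(4) using assms(3) d by auto
  show "T \<le> K * \<delta>" using K(1) d by (simp add: divide_simps)
  have "T / \<delta> \<le> T / (\<eta> / 2)" using assms d by (intro divide_left_mono) auto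
  then have "real K \<le> 2 * T / \<eta> + 1" using K by (simp add: mult.commute)
  have "ln (4::real) = 2 * ln 2" using ln_realpow[of 2 2] by simp
  then have l4: "ln (4::real) \<le> 2" using ln_le_minus_one[of "2::real"] by simp
  have "exp (- (4 / \<eta>) * T) / 4 = exp (- (4 / \<eta>) * T - ln 4)" by (simp add: exp_diff)
  also have "\<dots> \<le> exp (- ln 4 * real K)"
  proof (subst exp_le_cancel_iff)
    have "ln 4 * real K \<le> ln 4 * (2 * T / \<eta> + 1)" using \<open>real K \<le> 2 * T / \<eta> + 1\<close> by (intro mult_left_mono) auto
    also have "\<dots> = ln 4 * (2 * T / \<eta>) + ln 4" by (simp add: algebra_simps)
    also have "ln 4 * (2 * T / \<eta>) \<le> 2 * (2 * T / \<eta>)" using l4 assms by (intro mult_right_mono) auto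
    finally show "- (4 / \<eta>) * T - ln 4 \<le> - ln 4 * real K" by (simp add: field_simps)
  qed
  also have "\<dots> = (1 / 4) ^ K"
    using exp_of_nat_mult[of K "- ln (4::real)"] by (simp add: exp_minus mult.commute power_one_over inverse_eq_divide)
  finally show "exp (- (4 / \<eta>) * T) / 4 \<le> (1 / 4) ^ K" .
qed

lemma ou_stay_small:
  assumes W: "standard_brownian_motion M W" and b: "0 < b" "b \<le> 16" and T: "0 \<le> T"
  shows "exp (- (1024 / b\<^sup>2) * T) / 4 * measure std_normal {- (b / 2)..b / 2} \<le> measure M (ou_event M W T {- b..b})"
proof -
  define \<eta> where "\<eta> = b\<^sup>2 / 256"
  define \<delta> where "\<delta> = ln (1 + \<eta>)"
  define K where "K = nat \<lceil>T / \<delta>\<rceil>"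
  have \<eta>: "0 < \<eta>" "\<eta> \<le> 1" using b power_mono[OF b(2), of 2] by (auto simp: \<eta>_def)
  have \<delta>: "\<eta> / 2 \<le> \<delta>" "exp \<delta> = 1 + \<eta>" "0 < \<delta>" using \<eta> ln_add_one_ge_half[of \<eta>] unfolding \<delta>_def by auto
  note K = quarter_power_ge[OF \<eta>(1) \<delta>(1) T K_def]
  have "exp (- (1024 / b\<^sup>2) * T) / 4 \<le> (1 / 4) ^ K" using K(1) by (simp add: \<eta>_def)
  then have "exp (- (1024 / b\<^sup>2) * T) / 4 * measure std_normal {- (b / 2)..b / 2} \<le> (1 / 4) ^ K * measure std_normal {- (b / 2)..b / 2}"
    by (intro mult_right_mono) auto
  also have "\<dots> \<le> measure M (ou_event M W T {- b..b})"
  proof (rule ou_stay[OF W, where \<delta> = \<delta> and l = "b / 4" and A = "{0..}" and ?J1.0 = "{..0}" and ?J2.0 = "{0..}"])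
    show "(x + v) / exp (s / 2) \<in> {- b..b}"
      if "x \<in> {- (b / 2)..b / 2}" "\<bar>v\<bar> \<le> 2 * (b / 4)" "0 \<le> s" "s \<le> \<delta>" for x v s
    proof -
      have "\<bar>(x + v) / exp (s / 2)\<bar> \<le> \<bar>x + v\<bar> / 1" unfolding abs_divide
        using that by (intro divide_mono) auto
      also have "\<dots> \<le> b" using that by auto
      finally show ?thesis unfolding abs_le_iff atLeastAtMost_iff by linarith
    qed
    have sub: "y / exp (\<delta> / 2) \<in> {- (b / 2)..b / 2}" if "\<bar>y\<bar> \<le> b / 2" for y
    proof -
      have "\<bar>y / exp (\<delta> / 2)\<bar> \<le> \<bar>y\<bar> / 1" unfolding abs_divide
        using that \<delta> by (intro divide_mono) auto
      then have "\<bar>y / exp (\<delta> / 2)\<bar> \<le> b / 2" using that by linarith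
      then show ?thesis unfolding abs_le_iff atLeastAtMost_iff by linarith
    qed
    show "(x + v) / exp (\<delta> / 2) \<in> {- (b / 2)..b / 2}"
      if "x \<in> {- (b / 2)..b / 2}" "x \<in> {0..}" "\<bar>v\<bar> \<le> 2 * (b / 4)" "v \<in> {..0}" for x v
      using that by (intro sub) (simp only: abs_le_iff atLeastAtMost_iff atLeast_iff atMost_iff, linarith)
    show "(x + v) / exp (\<delta> / 2) \<in> {- (b / 2)..b / 2}"
      if "x \<in> {- (b / 2)..b / 2}" "x \<notin> {0..}" "\<bar>v\<bar> \<le> 2 * (b / 4)" "v \<in> {0..}" for x v
      using that by (intro sub) (simp only: abs_le_iff atLeastAtMost_iff atLeast_iff atMost_iff, linarith)
    have c: "2 * (exp \<delta> - 1) / (b / 4)\<^sup>2 = 1 / 8" using b unfolding \<delta>(2) by (simp add: \<eta>_def power_divide)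
    have j: "{x. sqrt (exp \<delta> - 1) * x \<in> {..0}} = {..0}" "{x. sqrt (exp \<delta> - 1) * x \<in> {0..}} = {0..}"
      using \<eta> unfolding \<delta>(2) by (auto simp: mult_le_0_iff zero_le_mult_iff)
    show "1 / 4 + 2 * (exp \<delta> - 1) / (b / 4)\<^sup>2 \<le> measure std_normal {x. sqrt (exp \<delta> - 1) * x \<in> {..0}}"
      "1 / 4 + 2 * (exp \<delta> - 1) / (b / 4)\<^sup>2 \<le> measure std_normal {x. sqrt (exp \<delta> - 1) * x \<in> {0..}}"
      unfolding c j using std_normal_half by simp_all
    show "2 * (exp \<delta> - 1) \<le> (b / 4)\<^sup>2" using b unfolding \<delta>(2) by (simp add: \<eta>_def power_divide)
  qed (use b K \<delta> in auto)
  finally show ?thesis .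
qed

lemma ou_stay_above:
  assumes W: "standard_brownian_motion M W" and a: "1 \<le> a" and T: "0 \<le> T"
  shows "exp (- (1024 * a\<^sup>2) * T) / 4 * measure std_normal {2 * a..} \<le> measure M (ou_event M W T {a..})"
proof -
  define \<eta> where "\<eta> = 1 / (256 * a\<^sup>2)"
  define \<delta> where "\<delta> = ln (1 + \<eta>)"
  define K where "K = nat \<lceil>T / \<delta>\<rceil>"
  have a2: "1 \<le> a\<^sup>2" using a by simp
  have \<eta>: "0 < \<eta>" "\<eta> \<le> 1" using a2 by (auto simp: \<eta>_def divide_simps)
  have \<delta>: "\<eta> / 2 \<le> \<delta>" "exp \<delta> = 1 + \<eta>" "0 < \<delta>" using \<eta> ln_add_one_ge_half[of \<eta>] unfolding \<delta>_def by auto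
  have ed: "exp (\<delta> / 2) \<le> 1 + \<eta> / 2"
  proof (rule power2_le_imp_le)
    have "(exp (\<delta> / 2))\<^sup>2 = 1 + \<eta>" using \<delta>(2) by (simp add: exp_double[symmetric])
    then show "(exp (\<delta> / 2))\<^sup>2 \<le> (1 + \<eta> / 2)\<^sup>2" by (simp add: power2_sum)
  qed (use \<eta> in auto)
  note K = quarter_power_ge[OF \<eta>(1) \<delta>(1) T K_def]
  have "exp (- (1024 * a\<^sup>2) * T) / 4 \<le> (1 / 4) ^ K" using K(1) by (simp add: \<eta>_def)
  then have "exp (- (1024 * a\<^sup>2) * T) / 4 * measure std_normal {2 * a..} \<le> (1 / 4) ^ K * measure std_normal {2 * a..}"
    by (intro mult_right_mono) auto
  also have "\<dots> \<le> measure M (ou_event M W T {a..})"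
  proof (rule ou_stay[OF W, where \<delta> = \<delta> and l = "a / 4" and A = UNIV and ?J1.0 = "{a * \<eta>..}" and ?J2.0 = "{a * \<eta>..}"])
    show "(x + v) / exp (s / 2) \<in> {a..}"
      if "x \<in> {2 * a..}" "\<bar>v\<bar> \<le> 2 * (a / 4)" "0 \<le> s" "s \<le> \<delta>" for x v s
    proof -
      have "exp (s / 2) \<le> exp (\<delta> / 2)" using that by simp
      then have "a * exp (s / 2) \<le> a * (3 / 2)" using ed \<eta> a by (intro mult_left_mono) linarith+
      also have "\<dots> \<le> x + v" using that by auto
      finally show ?thesis by (simp add: divide_simps)
    qed
    show core: "(x + v) / exp (\<delta> / 2) \<in> {2 * a..}"
      if "x \<in> {2 * a..}" "v \<in> {a * \<eta>..}" for x v
    proof -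
      have "2 * a * exp (\<delta> / 2) \<le> 2 * a * (1 + \<eta> / 2)" using ed a by (intro mult_left_mono) auto
      also have "\<dots> \<le> x + v" using that by (auto simp: algebra_simps)
      finally show ?thesis by (simp add: divide_simps)
    qed
    have e1: "2 * (exp \<delta> - 1) / (a / 4)\<^sup>2 = 1 / (8 * (a\<^sup>2 * a\<^sup>2))"
      using a unfolding \<delta>(2) by (simp add: \<eta>_def power_divide)
    have "1 \<le> a\<^sup>2 * a\<^sup>2" using mult_mono[OF a2 a2] by simp
    then have e2: "1 / (8 * (a\<^sup>2 * a\<^sup>2)) \<le> 1 / 8" by (intro frac_le) auto
    have sq: "sqrt \<eta> = 1 / (16 * a)" using a by (simp add: \<eta>_def real_sqrt_divide real_sqrt_mult)
    have e3: "{x. sqrt (exp \<delta> - 1) * x \<in> {a * \<eta>..}} = {1 / 16..}"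
    proof -
      have q: "a * \<eta> = 1 / 16 * sqrt \<eta>" using a unfolding sq by (simp add: \<eta>_def power2_eq_square)
      have "0 < sqrt \<eta>" using \<eta> by simp
      then have "a * \<eta> \<le> sqrt \<eta> * x \<longleftrightarrow> 1 / 16 \<le> x" for x
        unfolding q mult.commute[of "1 / 16"] by (rule mult_le_cancel_left_pos)
      then show ?thesis unfolding \<delta>(2) atLeast_def mem_Collect_eq add_diff_cancel_left' by presburger
    qed
    have "measure std_normal {0..} \<le> measure std_normal ({0..1/16} \<union> {1/16..})"
      by (intro std_normal.finite_measure_mono) auto
    also have "\<dots> \<le> measure std_normal {0..1/16} + measure std_normal {1/16..}"
      by (intro measure_Un_le) auto
    finally have "7 / 16 \<le> measure std_normal {1/16..}"
      using std_normal_half(1) std_normal_interval_le[of 0 "1/16"] by simp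
    then show p1: "1 / 4 + 2 * (exp \<delta> - 1) / (a / 4)\<^sup>2 \<le> measure std_normal {x. sqrt (exp \<delta> - 1) * x \<in> {a * \<eta>..}}"
      using e2 unfolding e1 e3 by linarith
    then show "1 / 4 + 2 * (exp \<delta> - 1) / (a / 4)\<^sup>2 \<le> measure std_normal {x. sqrt (exp \<delta> - 1) * x \<in> {a * \<eta>..}}" .
    show "2 * (exp \<delta> - 1) \<le> (a / 4)\<^sup>2"
    proof -
      have "2 * \<eta> \<le> a\<^sup>2 / 16" using \<eta>(1) a2 unfolding \<eta>_def using mult_mono[OF a2 a2] by (simp add: field_simps)
      then show ?thesis unfolding \<delta>(2) by (simp add: power_divide)
    qed
  qed (use a K \<delta> in auto)
  finally show ?thesis .
qed

definition stay_const :: "real \<Rightarrow> real" where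
  "stay_const b = (if b \<le> 16 then measure std_normal {- (b / 2)..b / 2} / 4 else exp (- 384 / b\<^sup>2))"

lemma stay_const_pos: "0 < b \<Longrightarrow> 0 < stay_const b"
  using std_normal_pos[of "- b / 2" "b / 2" "{- (b / 2)..b / 2}"] by (auto simp: stay_const_def)

lemma ou_stay_ball:
  assumes W: "standard_brownian_motion M W" and b: "0 < b" and T: "0 \<le> T"
  shows "stay_const b * exp (- (1024 / b\<^sup>2) * T) \<le> measure M (ou_event M W T {- b..b})"
proof (cases "b \<le> 16")
  case True
  then show ?thesis using ou_stay_small[OF W b _ T] by (simp add: stay_const_def field_simps)
next
  case False
  have "stay_const b * exp (- (1024 / b\<^sup>2) * T) = exp (- 384 / b\<^sup>2 - (1024 / b\<^sup>2) * T)"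
    using False by (simp add: stay_const_def exp_add[symmetric])
  also have "\<dots> \<le> exp (- (192 / b\<^sup>2) * (T + 2))"
    using False T by (simp add: field_simps)
  finally show ?thesis using ou_stay_large[OF W _ T, of b] False by simp
qed

section \<open>The hole event\<close>

lemma ibm_prob_space: "independent_brownian_motions M B \<Longrightarrow> prob_space M"
  by (auto simp: independent_brownian_motions_def standard_brownian_motion_def)

lemma ibm_sbm: "independent_brownian_motions M B \<Longrightarrow> j \<in> {1, 2} \<Longrightarrow> standard_brownian_motion M (B n j)"
  unfolding independent_brownian_motions_def by blast

lemma ibm_ou_event_prod:
  fixes Good :: "nat \<times> nat \<Rightarrow> real set"
  assumes B: "independent_brownian_motions M B" and J: "finite J" "J \<noteq> {}" "J \<subseteq> UNIV \<times> {1, 2}"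
    and Good: "\<And>i. Good i \<in> sets borel"
  shows "measure M (\<Inter>(n, j)\<in>J. ou_event M (B n j) T (Good (n, j))) =
    (\<Prod>(n, j)\<in>J. measure M (ou_event M (B n j) T (Good (n, j))))"
proof -
  interpret prob_space M using B by (rule ibm_prob_space)
  note [measurable] = Good
  let ?S = "PiM {0..} (\<lambda>_. borel) :: (real \<Rightarrow> real) measure"
  let ?X = "\<lambda>(n, j) \<omega>. \<lambda>t\<in>{0..}. B n j t \<omega>"
  define A where "A i = {p \<in> space ?S. \<forall>t\<in>\<rat> \<inter> {0..T}. p (exp t) / exp (t / 2) \<in> Good i}" for i
  have c: "countable (\<rat> \<inter> {0..T})" using countable_rat by (rule countable_Int1)
  have [measurable]: "(\<lambda>p. p (exp t)) \<in> borel_measurable ?S" for t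
    by (intro measurable_component_singleton) auto
  have A: "A i \<in> sets ?S" for i unfolding A_def by (measurable, rule c, measurable)
  have e: "?X i -` A i \<inter> space M = ou_event M (B (fst i) (snd i)) T (Good i)" for i
    by (auto simp: A_def ou_event_def space_PiM split: prod.splits)
  have "indep_vars (\<lambda>_. ?S) ?X (UNIV \<times> {1, 2})"
    using B by (simp add: independent_brownian_motions_def)
  then have "prob (\<Inter>i\<in>J. ?X i -` A i \<inter> space M) = (\<Prod>i\<in>J. prob (?X i -` A i \<inter> space M))"
    using J A by (intro indep_varsD) auto
  then show ?thesis
    unfolding e by (simp add: case_prod_beta')
qed


lemma dense_rat_Icc:
  assumes "0 < T"
  shows "closure (\<rat> \<inter> {0..T}) = {0..T::real}"
proof
  show "closure (\<rat> \<inter> {0..T}) \<subseteq> {0..T}" by (rule closure_minimal) auto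
  have "closure ({0<..<T} \<inter> \<rat>) = closure {0<..<T}"
    by (rule closure_open_Int_superset) (auto simp: Rats_closure_real)
  then have "{0..T} \<subseteq> closure ({0<..<T} \<inter> \<rat>)" using assms by simp
  also have "\<dots> \<subseteq> closure (\<rat> \<inter> {0..T})" by (rule closure_mono) auto
  finally show "{0..T} \<subseteq> closure (\<rat> \<inter> {0..T})" .
qed

lemma ou_event_continuous:
  assumes "\<omega> \<in> ou_event M W T S" "closed S" "continuous_on {0..} (\<lambda>t. W t \<omega>)" "0 < T" "t \<in> {0..T}"
  shows "W (exp t) \<omega> / exp (t / 2) \<in> S"
proof -
  have "continuous_on {0..T} (\<lambda>t. W (exp t) \<omega> / exp (t / 2))"
    by (intro continuous_intros continuous_on_compose2[OF assms(3)]) auto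
  then have "(\<lambda>t. W (exp t) \<omega> / exp (t / 2)) ` closure (\<rat> \<inter> {0..T}) \<subseteq> S"
    using assms by (intro image_closure_subset) (auto simp: dense_rat_Icc ou_event_def)
  then show ?thesis using assms by (auto simp: dense_rat_Icc)
qed

lemma summable_pow_sqrt_fact: 
  fixes x a :: real
  assumes "1 < a" "0 \<le> x"
  defines "L \<equiv> (a * x)\<^sup>2 / 2"
  shows "summable (\<lambda>n. x ^ n / sqrt (fact n))"
    "(\<Sum>n. x ^ n / sqrt (fact n)) \<le> exp L * (1 + 1 / (1 - 1 / a\<^sup>2)) / 2"
proof -
  have a: "norm (1 / a\<^sup>2) < 1" using assms(1) by (simp add: power_less_one_iff)
  define g where "g n = (exp (- L) * ((2 * L) ^ n / fact n) + exp L * (1 / a\<^sup>2) ^ n) / 2" for n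
  have bd: "x ^ n / sqrt (fact n) \<le> g n" for n
  proof -
    define u where "u = exp (- L / 2) * ((a * x) ^ n / sqrt (fact n))"
    define v where "v = exp (L / 2) * (1 / a) ^ n"
    have "exp (- L / 2) * exp (L / 2) = (1::real)" by (simp add: exp_add[symmetric])
    then have "x ^ n / sqrt (fact n) = u * v"
      using assms(1) unfolding u_def v_def by (simp add: power_mult_distrib power_one_over field_simps)
    also have "\<dots> \<le> (u\<^sup>2 + v\<^sup>2) / 2" using sum_squares_bound[of u v] by simp
    also have "u\<^sup>2 = exp (- L) * ((2 * L) ^ n / fact n)"
      by (simp add: u_def L_def power_mult_distrib power_divide exp_double[symmetric] power_mult[symmetric] mult.commute)
    also have "v\<^sup>2 = exp L * (1 / a\<^sup>2) ^ n"
      by (simp add: v_def power_mult_distrib power_divide exp_double[symmetric] power_mult[symmetric] mult.commute)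
    finally show ?thesis by (simp add: g_def)
  qed
  have "(\<lambda>n. (2 * L) ^ n / fact n) sums exp (2 * L)"
    using exp_converges[of "2 * L"] by (simp add: divide_inverse mult.commute)
  moreover have "(\<lambda>n. (1 / a\<^sup>2) ^ n) sums (1 / (1 - 1 / a\<^sup>2))"
    using geometric_sums[OF a] by simp
  ultimately have g: "g sums ((exp (- L) * exp (2 * L) + exp L * (1 / (1 - 1 / a\<^sup>2))) / 2)"
    unfolding g_def by (intro sums_divide sums_add sums_mult)
  show s: "summable (\<lambda>n. x ^ n / sqrt (fact n))"
    using assms bd by (intro summable_comparison_test'[OF sums_summable[OF g]]) auto
  have "(\<Sum>n. x ^ n / sqrt (fact n)) \<le> suminf g"
    by (intro suminf_le bd s sums_summable[OF g])
  also have "\<dots> = exp L * (1 + 1 / (1 - 1 / a\<^sup>2)) / 2"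
    unfolding sums_unique[OF g, symmetric] by (simp add: exp_add[symmetric] algebra_simps)
  finally show "(\<Sum>n. x ^ n / sqrt (fact n)) \<le> exp L * (1 + 1 / (1 - 1 / a\<^sup>2)) / 2" .
qed

lemma OU_coeff_norm_le:
  assumes "\<bar>B n 1 (exp t) \<omega> / exp (t / 2)\<bar> \<le> b" "\<bar>B n 2 (exp t) \<omega> / exp (t / 2)\<bar> \<le> b"
  shows "cmod (OU_coeff B n t \<omega>) \<le> b"
proof -
  define x y where "x = B n 1 (exp t) \<omega> / exp (t / 2)" and "y = B n 2 (exp t) \<omega> / exp (t / 2)"
  have b: "0 \<le> b" using assms by linarith
  have "OU_coeff B n t \<omega> = Complex (x / sqrt 2) (y / sqrt 2)"
    unfolding OU_coeff_def x_def y_def by (simp add: complex_eq_iff exp_minus field_simps)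
  then have "(cmod (OU_coeff B n t \<omega>))\<^sup>2 = (x\<^sup>2 + y\<^sup>2) / 2"
    by (simp add: cmod_power2 power_divide add_divide_distrib)
  also have "\<dots> \<le> b\<^sup>2"
  proof -
    have "x\<^sup>2 \<le> b\<^sup>2" "y\<^sup>2 \<le> b\<^sup>2"
      using assms unfolding x_def[symmetric] y_def[symmetric]
      by (metis abs_ge_zero power2_abs power_mono)+
    then show ?thesis by simp
  qed
  finally show ?thesis using b by (rule power2_le_imp_le)
qed

lemma OU_coeff_norm_ge:
  "B n 1 (exp t) \<omega> / exp (t / 2) \<le> sqrt 2 * cmod (OU_coeff B n t \<omega>)"
proof -
  have "B n 1 (exp t) \<omega> / exp (t / 2) = sqrt 2 * Re (OU_coeff B n t \<omega>)"
    unfolding OU_coeff_def by (simp add: exp_minus field_simps)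
  also have "\<dots> \<le> sqrt 2 * cmod (OU_coeff B n t \<omega>)" by (intro mult_left_mono complex_Re_le_cmod) auto
  finally show ?thesis .
qed

definition good_path :: "(nat \<Rightarrow> nat \<Rightarrow> real \<Rightarrow> 'a \<Rightarrow> real) \<Rightarrow> 'a \<Rightarrow> bool" where
  "good_path B \<omega> \<longleftrightarrow> (\<forall>n. \<forall>j\<in>{1, 2}. continuous_on {0..} (\<lambda>t. B n j t \<omega>)) \<and>
    (\<forall>T. \<forall>\<^sub>F n in sequentially. \<forall>j\<in>{1, 2}. \<forall>t\<in>{0..T}. \<bar>B n j (exp t) \<omega> / exp (t / 2)\<bar> \<le> 2 ^ n)"

lemma AE_good_path:
  assumes B: "independent_brownian_motions M B"
  shows "AE \<omega> in M. good_path B \<omega>"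
proof -
  interpret prob_space M using B by (rule ibm_prob_space)
  have cont: "AE \<omega> in M. \<forall>n. \<forall>j\<in>{1, 2}. continuous_on {0..} (\<lambda>t. B n j t \<omega>)"
    using B by (auto simp: AE_all_countable independent_brownian_motions_def standard_brownian_motion_def)
  have bc: "AE \<omega> in M. \<forall>\<^sub>F n in sequentially. \<omega> \<in> space M - (space M - ou_event M (B n j) (Suc T) {- (2 ^ n)..2 ^ n})"
    if j: "j \<in> {1, 2}" for j and T :: nat
  proof (rule borel_cantelli_AE1)
    note W = ibm_sbm[OF B j]
    have ev: "ou_event M (B n j) (Suc T) {- (2 ^ n)..2 ^ n} \<in> events" for n
      by (rule ou_event_sets[OF W]) simp
    then show "space M - ou_event M (B n j) (Suc T) {- (2 ^ n)..2 ^ n} \<in> events" for n by auto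
    show "emeasure M (space M - ou_event M (B n j) (Suc T) {- (2 ^ n)..2 ^ n}) < \<infinity>" for n
      by (simp add: emeasure_eq_measure)
    have bd: "prob (space M - ou_event M (B n j) (Suc T) {- (2 ^ n)..2 ^ n}) \<le> (192 * (T + 3)) * (1 / 4) ^ n"
      if "4 \<le> n" for n
    proof -
      have "(2::real) ^ 4 \<le> 2 ^ n" using that by (intro power_increasing) auto
      then have "exp (- (192 / (2 ^ n)\<^sup>2) * (real (Suc T) + 2)) \<le> prob (ou_event M (B n j) (Suc T) {- (2 ^ n)..2 ^ n})"
        by (intro ou_stay_large[OF W]) (simp_all only: of_nat_0_le_iff, simp)
      with exp_ge_add_one_self
      have "1 + - (192 / (2 ^ n)\<^sup>2) * (real (Suc T) + 2) \<le> prob (ou_event M (B n j) (Suc T) {- (2 ^ n)..2 ^ n})"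
        by (rule order_trans)
      moreover have "(192 / (2 ^ n)\<^sup>2) * (real (Suc T) + 2) = (192 * (T + 3)) * (1 / 4) ^ n"
        by (simp add: power_divide power_mult[symmetric] mult.commute[of n] power_mult)
      ultimately show ?thesis unfolding prob_compl[OF ev] by linarith
    qed
    show "summable (\<lambda>n. prob (space M - ou_event M (B n j) (Suc T) {- (2 ^ n)..2 ^ n}))"
      by (rule summable_comparison_test'[where N=4 and g="\<lambda>n. (192 * (real T + 3)) * (1 / 4) ^ n"])
         (use bd in \<open>auto intro!: summable_mult summable_geometric\<close>)
  qed
  have "AE \<omega> in M. \<forall>j\<in>{1, 2}. \<forall>T::nat. \<forall>\<^sub>F n in sequentially. \<omega> \<in> ou_event M (B n j) (Suc T) {- (2 ^ n)..2 ^ n}"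
  proof -
    have "AE \<omega> in M. \<forall>T::nat. \<forall>\<^sub>F n in sequentially. \<omega> \<in> ou_event M (B n j) (Suc T) {- (2 ^ n)..2 ^ n}"
      if j: "j \<in> {1, 2}" for j
      unfolding AE_all_countable
    proof
      fix T :: nat
      show "AE \<omega> in M. \<forall>\<^sub>F n in sequentially. \<omega> \<in> ou_event M (B n j) (Suc T) {- (2 ^ n)..2 ^ n}"
        using bc[OF j, of T]
      proof eventually_elim
        case (elim \<omega>)
        show ?case using elim by (rule eventually_mono) blast
      qed
    qed
    then show ?thesis by (intro AE_finite_allI) auto
  qed
  with cont show ?thesis
  proof eventually_elim
    case (elim \<omega>)
    show ?case
      unfolding good_path_def
    proof (intro conjI allI)
      fix T :: real
      obtain T' :: nat where T': "T \<le> T'" using real_arch_simple by blast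
      have "\<forall>\<^sub>F n in sequentially. \<forall>j\<in>{1, 2}. \<omega> \<in> ou_event M (B n j) (Suc T') {- (2 ^ n)..2 ^ n}"
        using elim(2) by (subst eventually_ball_finite_distrib) auto
      then show "\<forall>\<^sub>F n in sequentially. \<forall>j\<in>{1, 2}. \<forall>t\<in>{0..T}. \<bar>B n j (exp t) \<omega> / exp (t / 2)\<bar> \<le> 2 ^ n"
      proof eventually_elim
        case (elim n)
        show ?case
        proof (intro ballI)
          fix j :: nat and t assume j: "j \<in> {1, 2}" and t: "t \<in> {0..T}"
          have "B n j (exp t) \<omega> / exp (t / 2) \<in> {- (2 ^ n)..2 ^ n}"
            using elim j t T' \<open>\<forall>n. \<forall>j\<in>{1, 2}. continuous_on {0..} (\<lambda>t. B n j t \<omega>)\<close>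
            by (intro ou_event_continuous[where T="Suc T'" and M=M]) auto
          then show "\<bar>B n j (exp t) \<omega> / exp (t / 2)\<bar> \<le> 2 ^ n" unfolding abs_le_iff atLeastAtMost_iff by linarith
        qed
      qed
    qed (use elim in auto)
  qed
qed

lemma good_path_bound:
  assumes "good_path B \<omega>"
  shows "\<forall>\<^sub>F n in sequentially. \<forall>p\<in>{0..T} \<times> cball 0 R.
    cmod (OU_coeff B n (fst p) \<omega> * (snd p ^ n / complex_of_real (sqrt (fact n)))) \<le> (2 * \<bar>R\<bar>) ^ n / sqrt (fact n)"
proof -
  have "\<forall>\<^sub>F n in sequentially. \<forall>j\<in>{1, 2}. \<forall>t\<in>{0..T}. \<bar>B n j (exp t) \<omega> / exp (t / 2)\<bar> \<le> 2 ^ n"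
    using assms by (simp add: good_path_def)
  then show ?thesis
  proof eventually_elim
    case (elim n)
    show ?case
    proof
      fix p :: "real \<times> complex" assume "p \<in> {0..T} \<times> cball 0 R"
      then have "cmod (OU_coeff B n (fst p) \<omega>) \<le> 2 ^ n" "cmod (snd p) \<le> \<bar>R\<bar>"
        using elim by (auto intro!: OU_coeff_norm_le)
      then have "cmod (OU_coeff B n (fst p) \<omega>) * (cmod (snd p) ^ n / sqrt (fact n)) \<le> 2 ^ n * (\<bar>R\<bar> ^ n / sqrt (fact n))"
        by (intro mult_mono divide_right_mono power_mono) auto
      then show "cmod (OU_coeff B n (fst p) \<omega> * (snd p ^ n / complex_of_real (sqrt (fact n)))) \<le> (2 * \<bar>R\<bar>) ^ n / sqrt (fact n)"
        by (simp add: norm_mult norm_divide norm_power power_mult_distrib)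
    qed
  qed
qed

lemma good_path_uniform_limit:
  assumes "good_path B \<omega>"
  shows "uniform_limit ({0..T} \<times> cball 0 R)
    (\<lambda>N p. \<Sum>n<N. OU_coeff B n (fst p) \<omega> * (snd p ^ n / complex_of_real (sqrt (fact n))))
    (\<lambda>p. planar_GAF B (snd p) (fst p) \<omega>) sequentially"
  unfolding planar_GAF_def
  using good_path_bound[OF assms] summable_pow_sqrt_fact(1)[of 2 "2 * \<bar>R\<bar>"]
  by (intro Weierstrass_m_test_ev[where M="\<lambda>n. (2 * \<bar>R\<bar>) ^ n / sqrt (fact n)"]) auto

lemma good_path_continuous_GAF:
  assumes "good_path B \<omega>"
  shows "continuous_on ({0..T} \<times> cball 0 R) (\<lambda>p. planar_GAF B (snd p) (fst p) \<omega>)"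
proof (rule uniform_limit_theorem[OF _ good_path_uniform_limit[OF assms]])
  have c: "continuous_on ({0..T} \<times> cball 0 R) (\<lambda>p. B n j (exp (fst p)) \<omega>)" if "j \<in> {1, 2}" for n j
  proof (rule continuous_on_compose2[where g="\<lambda>t. B n j t \<omega>" and t="{0..}"])
    show "continuous_on {0..} (\<lambda>t. B n j t \<omega>)" using assms that unfolding good_path_def by blast
    show "continuous_on ({0..T} \<times> cball 0 R) (\<lambda>p. exp (fst p))"
      by (intro continuous_on_exp continuous_on_fst continuous_on_id)
  qed (simp add: image_subset_iff)
  show "\<forall>\<^sub>F N in sequentially. continuous_on ({0..T} \<times> cball 0 R) (\<lambda>p. \<Sum>n<N. OU_coeff B n (fst p) \<omega> * (snd p ^ n / complex_of_real (sqrt (fact n))))"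
  proof (intro always_eventually allI continuous_on_sum continuous_on_mult)
    fix n
    show "continuous_on ({0..T} \<times> cball 0 R) (\<lambda>p. OU_coeff B n (fst p) \<omega>)"
      unfolding OU_coeff_def
      by (intro continuous_on_mult continuous_on_add continuous_on_of_real c continuous_on_const
          continuous_on_exp continuous_on_divide continuous_on_minus continuous_on_fst continuous_on_id) simp_all
    show "continuous_on ({0..T} \<times> cball 0 R) (\<lambda>p. snd p ^ n / complex_of_real (sqrt (fact n)))"
      by (intro continuous_on_divide continuous_on_power continuous_on_snd continuous_on_id continuous_on_const) simp_all
  qed
qed simp

lemma OU_coeff_measurable:
  assumes B: "independent_brownian_motions M B"
  shows "OU_coeff B n t \<in> borel_measurable M"
proof -
  have [measurable]: "B n 1 (exp t) \<in> borel_measurable M" "B n 2 (exp t) \<in> borel_measurable M"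
    by (auto intro!: sbm_measurable[OF ibm_sbm[OF B]])
  show ?thesis unfolding OU_coeff_def by measurable
qed

lemma planar_GAF_measurable:
  assumes B: "independent_brownian_motions M B"
  shows "planar_GAF B z t \<in> borel_measurable M"
proof -
  note [measurable] = OU_coeff_measurable[OF B]
  show ?thesis unfolding planar_GAF_def by measurable
qed

lemma hole_event_AE_eq:
  assumes B: "independent_brownian_motions M B"
  obtains E where "E \<in> sets M" "\<And>\<omega>. good_path B \<omega> \<Longrightarrow> \<omega> \<in> E \<longleftrightarrow> \<omega> \<in> hole_event M B T R"
proof -
  let ?K = "{0..T} \<times> cball 0 R :: (real \<times> complex) set"
  note [measurable] = planar_GAF_measurable[OF B]
  obtain D where D: "countable D" "D \<subseteq> ?K" "?K \<subseteq> closure D" using separable[of ?K] by blast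
  have cK: "compact ?K" by (intro compact_Times) auto
  then have clD: "closure D = ?K" using D closure_minimal[of D ?K] compact_imp_closed by blast
  define E where "E = {\<omega>\<in>space M. \<exists>m::nat. \<forall>p\<in>D. 1 / (real m + 1) \<le> cmod (planar_GAF B (snd p) (fst p) \<omega>)}"
  have "E \<in> sets M" unfolding E_def using D(1) by measurable
  moreover have "\<omega> \<in> E \<longleftrightarrow> \<omega> \<in> hole_event M B T R" if g: "good_path B \<omega>" for \<omega>
  proof
    have cont: "continuous_on ?K (\<lambda>p. cmod (planar_GAF B (snd p) (fst p) \<omega>))"
      by (intro continuous_intros good_path_continuous_GAF[OF g])
    show "\<omega> \<in> hole_event M B T R" if "\<omega> \<in> E"
    proof -
      obtain m :: nat where m: "\<forall>p\<in>D. 1 / (real m + 1) \<le> cmod (planar_GAF B (snd p) (fst p) \<omega>)"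
        using \<open>\<omega> \<in> E\<close> by (auto simp: E_def)
      have "(\<lambda>p. cmod (planar_GAF B (snd p) (fst p) \<omega>)) ` closure D \<subseteq> {1 / (real m + 1)..}"
        using cont m by (intro image_closure_subset) (auto simp: clD add.commute)
      then have "\<forall>p\<in>?K. 1 / (real m + 1) \<le> cmod (planar_GAF B (snd p) (fst p) \<omega>)"
        unfolding clD by blast
      moreover have "0 < 1 / (real m + 1)" by simp
      ultimately show ?thesis using \<open>\<omega> \<in> E\<close> unfolding hole_event_def E_def by (force simp: not_le[symmetric])
    qed
    show "\<omega> \<in> E" if h: "\<omega> \<in> hole_event M B T R"
    proof (cases "?K = {}")
      case True then show ?thesis using h D by (auto simp: E_def hole_event_def)
    next
      case False
      then obtain q where q: "q \<in> ?K" "\<forall>p\<in>?K. cmod (planar_GAF B (snd q) (fst q) \<omega>) \<le> cmod (planar_GAF B (snd p) (fst p) \<omega>)"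
        using continuous_attains_inf[OF cK _ cont] by blast
      then have "0 < cmod (planar_GAF B (snd q) (fst q) \<omega>)"
        using h unfolding hole_event_def by auto
      then obtain m :: nat where "inverse (real (Suc m)) < cmod (planar_GAF B (snd q) (fst q) \<omega>)"
        using reals_Archimedean by blast
      then have "\<forall>p\<in>D. 1 / (real m + 1) \<le> cmod (planar_GAF B (snd p) (fst p) \<omega>)"
        using q D(2) by (fastforce simp: inverse_eq_divide add.commute)
      then show ?thesis using h by (auto simp: E_def hole_event_def)
    qed
  qed
  ultimately show ?thesis using that by blast
qed

lemma hole_prob_compare:
  assumes B: "independent_brownian_motions M B" and S: "S \<in> sets M"
  shows "(AE \<omega> in M. \<omega> \<in> S \<longrightarrow> \<omega> \<in> hole_event M B T R) \<Longrightarrow> measure M S \<le> hole_prob M B T R"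
    and "(AE \<omega> in M. \<omega> \<in> hole_event M B T R \<longrightarrow> \<omega> \<in> S) \<Longrightarrow> hole_prob M B T R \<le> measure M S"
proof -
  interpret prob_space M using B by (rule ibm_prob_space)
  interpret C: complete_measure "completion M" by standard (auto intro: completion.complete)
  obtain E where E: "E \<in> sets M" "\<And>\<omega>. good_path B \<omega> \<Longrightarrow> \<omega> \<in> E \<longleftrightarrow> \<omega> \<in> hole_event M B T R"
    using hole_event_AE_eq[OF B, of T R] by blast
  let ?H = "hole_event M B T R"
  have AE: "AE \<omega> in M. \<omega> \<in> E \<longleftrightarrow> \<omega> \<in> ?H"
    using AE_good_path[OF B] E(2) by (auto elim: AE_mp)
  then have AEc: "AE \<omega> in completion M. \<omega> \<in> E \<longleftrightarrow> \<omega> \<in> ?H" by (rule AE_completion)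
  have "?H \<subseteq> space M" by (auto simp: hole_event_def)
  moreover have "Measurable.pred (completion M) (\<lambda>\<omega>. \<not> (\<omega> \<in> E \<longleftrightarrow> \<omega> \<in> ?H))"
    using AE by (intro sets_completion_AE) auto
  then have "{\<omega>\<in>space M. \<not> (\<omega> \<in> E \<longleftrightarrow> \<omega> \<in> ?H)} \<in> sets (completion M)"
    by (simp add: pred_def)
  then have "(E - {\<omega>\<in>space M. \<not> (\<omega> \<in> E \<longleftrightarrow> \<omega> \<in> ?H)}) \<union> ({\<omega>\<in>space M. \<not> (\<omega> \<in> E \<longleftrightarrow> \<omega> \<in> ?H)} - E) \<in> sets (completion M)"
    using E(1) by auto
  moreover have "(E - {\<omega>\<in>space M. \<not> (\<omega> \<in> E \<longleftrightarrow> \<omega> \<in> ?H)}) \<union> ({\<omega>\<in>space M. \<not> (\<omega> \<in> E \<longleftrightarrow> \<omega> \<in> ?H)} - E) = ?H"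
    using sets.sets_into_space[OF E(1)] \<open>?H \<subseteq> space M\<close> by auto
  ultimately have H: "?H \<in> sets (completion M)" by simp
  have "hole_prob M B T R = measure (completion M) E"
    unfolding hole_prob_def using AEc H E(1) by (intro measure_eq_AE) auto
  then have eq: "hole_prob M B T R = prob E" using E(1) by simp
  show "prob S \<le> hole_prob M B T R" if "AE \<omega> in M. \<omega> \<in> S \<longrightarrow> \<omega> \<in> ?H"
    unfolding eq using AE that E(1) by (intro finite_measure_mono_AE) auto
  show "hole_prob M B T R \<le> prob S" if "AE \<omega> in M. \<omega> \<in> ?H \<longrightarrow> \<omega> \<in> S"
    unfolding eq using AE that S by (intro finite_measure_mono_AE) auto
qed

section \<open>The lower bound\<close>

lemma suminf_OU_bound:
  fixes c :: "nat \<Rightarrow> complex"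
  assumes b: "\<And>n. 0 < n \<Longrightarrow> cmod (c n) \<le> b n" "0 \<le> b 0" and z: "cmod z \<le> R"
    and s: "summable (\<lambda>n. b n * (R ^ n / sqrt (fact n)))"
    and big: "(\<Sum>n. b n * (R ^ n / sqrt (fact n))) < cmod (c 0)"
  shows "(\<Sum>n. c n * (z ^ n / complex_of_real (sqrt (fact n)))) \<noteq> 0"
proof
  let ?f = "\<lambda>n. c n * (z ^ n / complex_of_real (sqrt (fact n)))" and ?g = "\<lambda>n. b n * (R ^ n / sqrt (fact n))"
  have R: "0 \<le> R" using z norm_ge_zero[of z] by linarith
  have le: "cmod (?f n) \<le> ?g n" if "0 < n" for n
  proof -
    have "cmod (?f n) = cmod (c n) * (cmod z ^ n / sqrt (fact n))"
      by (simp add: norm_mult norm_divide norm_power)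
    also have "\<dots> \<le> ?g n"
      using b(1)[OF that] z by (intro mult_mono divide_right_mono power_mono) (auto intro: order_trans[OF norm_ge_zero])
    finally show ?thesis .
  qed
  have sn: "summable (\<lambda>n. cmod (?f n))"
    using s by (rule summable_comparison_test'[where N=1]) (use le in auto)
  assume "suminf ?f = 0"
  then have "c 0 = - (\<Sum>n. ?f (Suc n))"
    using suminf_split_head[OF summable_norm_cancel[OF sn]] by (simp add: algebra_simps)
  then have "cmod (c 0) = cmod (\<Sum>n. ?f (Suc n))" by simp
  also have "\<dots> \<le> (\<Sum>n. cmod (?f (Suc n)))" by (rule summable_norm[OF summable_Suc_iff[THEN iffD2, OF sn]])
  also have "\<dots> \<le> (\<Sum>n. ?g (Suc n))"
    by (intro suminf_le le summable_Suc_iff[THEN iffD2, OF sn] summable_Suc_iff[THEN iffD2, OF s] zero_less_Suc)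
  also have "\<dots> = suminf ?g - ?g 0" by (rule suminf_split_head[OF s])
  also have "\<dots> \<le> suminf ?g" using b(2) by simp
  finally show False using big by simp
qed

text \<open>The constant coefficient is kept above a level \<open>a\<close> and the others in small intervals
  \<open>[- b n, b n]\<close>; balancing \<open>a\<^sup>2\<close> against the sum of \<open>1 / (b n)\<^sup>2\<close> gives the rate below.\<close>

definition hole_rate :: "real \<Rightarrow> real" where
  "hole_rate R = 8192 * (2 + R)\<^sup>2 * exp ((R + 1)\<^sup>2 / 2)"

lemma hole_prob_lower:
  assumes R: "0 < R"
  obtains c where "0 < c"
    "\<And>M (B :: nat \<Rightarrow> nat \<Rightarrow> real \<Rightarrow> 'a \<Rightarrow> real) T. independent_brownian_motions M B \<Longrightarrow> 0 < T \<Longrightarrow>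
      c * exp (- hole_rate R * T) \<le> hole_prob M B T R"
proof -
  define \<alpha> where "\<alpha> = sqrt (1 + 1 / R)"
  define L where "L = (R + 1)\<^sup>2 / 2"
  define b where "b n = exp (- L / 2) * \<alpha> ^ n" for n :: nat
  define a where "a = 2 * exp (L / 2) * (2 + R)"
  have \<alpha>2: "\<alpha>\<^sup>2 = 1 + 1 / R" using R by (simp add: \<alpha>_def)
  have \<alpha>: "1 < \<alpha>" using R by (simp add: \<alpha>_def)
  have b_pos: "0 < b n" for n using \<alpha> by (simp add: b_def)
  have L0: "0 \<le> L" by (simp add: L_def)
  have "1 \<le> 2 * exp (L / 2)" using L0 one_le_exp_iff[of "L / 2"] by linarith
  then have a1: "1 \<le> a" unfolding a_def using R mult_mono[of 1 "2 * exp (L / 2)" 1 "2 + R"] by simp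
  have q: "1 / (1 - 1 / \<alpha>\<^sup>2) = 1 + R" using R unfolding \<alpha>2 by (simp add: field_simps)
  have geo: "(\<lambda>n. 1 / (b n)\<^sup>2) sums (exp L * (1 + R))"
  proof -
    have "(\<lambda>n. (1 / \<alpha>\<^sup>2) ^ n) sums (1 / (1 - 1 / \<alpha>\<^sup>2))"
      using \<alpha> by (intro geometric_sums) (simp add: power_less_one_iff)
    then have "(\<lambda>n. exp L * (1 / \<alpha>\<^sup>2) ^ n) sums (exp L * (1 + R))" unfolding q by (rule sums_mult)
    moreover have "exp L * (1 / \<alpha>\<^sup>2) ^ n = 1 / (b n)\<^sup>2" for n
      by (simp add: b_def power_mult_distrib power_one_over exp_double[symmetric] exp_minus power_mult[symmetric] mult.commute field_simps)
    ultimately show ?thesis by simp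
  qed
  have g_eq: "b n * (R ^ n / sqrt (fact n)) = exp (- L / 2) * ((\<alpha> * R) ^ n / sqrt (fact n))" for n
    by (simp add: b_def power_mult_distrib)
  have aR: "(\<alpha> * (\<alpha> * R))\<^sup>2 / 2 = L"
  proof -
    have "\<alpha> * (\<alpha> * R) = \<alpha>\<^sup>2 * R" by (simp add: power2_eq_square)
    also have "\<dots> = R + 1" using R unfolding \<alpha>2 by (simp add: field_simps)
    finally show ?thesis by (simp add: L_def)
  qed
  have \<alpha>R: "0 \<le> \<alpha> * R" using \<alpha> R by simp
  note S = summable_pow_sqrt_fact[OF \<alpha> \<alpha>R, unfolded aR q]
  have gs: "summable (\<lambda>n. b n * (R ^ n / sqrt (fact n)))" unfolding g_eq using S(1) by (rule summable_mult)
  have "(\<Sum>n. b n * (R ^ n / sqrt (fact n))) \<le> exp (- L / 2) * (exp L * (1 + (1 + R)) / 2)"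
    unfolding g_eq suminf_mult[OF S(1)] using S(2) by (intro mult_left_mono) auto
  also have "\<dots> = a / 4"
  proof -
    have "exp (- L / 2) * exp L = exp (L / 2)" by (simp add: exp_add[symmetric])
    then show ?thesis by (simp add: a_def field_simps)
  qed
  finally have g_le: "(\<Sum>n. b n * (R ^ n / sqrt (fact n))) \<le> a / 4" .
  define \<kappa> where "\<kappa> n = (if n = 0 then measure std_normal {2 * a..} / 4 else (stay_const (b n))\<^sup>2)" for n
  define \<rho> where "\<rho> n = (if n = 0 then 1024 * a\<^sup>2 else 2048 / (b n)\<^sup>2)" for n
  have \<kappa>_pos: "0 < \<kappa> n" for n
    using std_normal_pos[of "2 * a" "2 * a + 1" "{2 * a..}"] stay_const_pos[OF b_pos[of n]] by (auto simp: \<kappa>_def)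
  have "stay_const (b n) \<le> 1" for n
    using order_trans[OF std_normal.prob_le_1[of "{- (b n / 2)..b n / 2}"], of 4] by (auto simp: stay_const_def)
  then have \<kappa>_le: "\<kappa> n \<le> 1" for n
    using order_trans[OF std_normal.prob_le_1[of "{2 * a..}"], of 4] stay_const_pos[OF b_pos[of n]] by (auto simp: \<kappa>_def power_le_one)
  have \<theta>: "summable (\<lambda>n. - ln (\<kappa> n))"
  proof (rule summable_comparison_test_ev)
    have "filterlim b at_top sequentially" unfolding b_def using \<alpha> by real_asymp
    then have "\<forall>\<^sub>F n in sequentially. 16 < b n" by (simp add: filterlim_at_top_dense)
    then show "\<forall>\<^sub>F n in sequentially. norm (- ln (\<kappa> n)) \<le> 768 * (1 / (b n)\<^sup>2)"
      using eventually_gt_at_top[of 0]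
    proof eventually_elim
      case (elim n)
      then have "\<kappa> n = exp (- 768 / (b n)\<^sup>2)"
        by (simp add: \<kappa>_def stay_const_def exp_double[symmetric])
      then show ?case by simp
    qed
    show "summable (\<lambda>n. 768 * (1 / (b n)\<^sup>2))" using sums_summable[OF geo] by (rule summable_mult)
  qed
  have \<rho>: "(\<Sum>n<N. \<rho> n) \<le> hole_rate R" for N
  proof -
    have "(\<Sum>n<N. \<rho> n) \<le> (\<Sum>n<N. (if n = 0 then 1024 * a\<^sup>2 else 0) + 2048 * (1 / (b n)\<^sup>2))"
      by (intro sum_mono) (auto simp: \<rho>_def)
    also have "\<dots> = (\<Sum>n<N. (if n = 0 then 1024 * a\<^sup>2 else 0)) + 2048 * (\<Sum>n<N. 1 / (b n)\<^sup>2)"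
      by (simp only: sum.distrib sum_distrib_left)
    also have "(\<Sum>n<N. (if n = 0 then 1024 * a\<^sup>2 else 0)) \<le> 1024 * a\<^sup>2"
      by (simp add: sum.delta)
    also have "(\<Sum>n<N. 1 / (b n)\<^sup>2) \<le> exp L * (1 + R)"
      unfolding sums_unique[OF geo] by (intro sum_le_suminf sums_summable[OF geo]) auto
    finally have "(\<Sum>n<N. \<rho> n) \<le> 1024 * a\<^sup>2 + 2048 * (exp L * (1 + R))" by simp
    also have "a\<^sup>2 = 4 * (exp L * (2 + R)\<^sup>2)"
      by (simp add: a_def power_mult_distrib exp_double[symmetric])
    also have "exp L * (1 + R) \<le> exp L * (2 + R)\<^sup>2"
      using R by (intro mult_left_mono) (auto simp: power2_eq_square algebra_simps)
    finally have "(\<Sum>n<N. \<rho> n) \<le> 6144 * (exp L * (2 + R)\<^sup>2)" by simp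
    also have "\<dots> \<le> 8192 * (exp L * (2 + R)\<^sup>2)" by (intro mult_right_mono) auto
    finally show ?thesis by (simp add: hole_rate_def L_def mult_ac)
  qed
  define c where "c = exp (- (\<Sum>n. - ln (\<kappa> n)))"
  show ?thesis
  proof (rule that)
    show "0 < c" by (simp add: c_def)
    fix M and B :: "nat \<Rightarrow> nat \<Rightarrow> real \<Rightarrow> 'a \<Rightarrow> real" and T :: real
    assume B: "independent_brownian_motions M B" and T: "0 < T"
    interpret prob_space M using B by (rule ibm_prob_space)
    note W1 = ibm_sbm[OF B, of 1, simplified] and W2 = ibm_sbm[OF B, of 2, simplified]
    define G where "G i = (if i = (0, 1) then {a..} else if i = (0, 2) then UNIV else {- b (fst i)..b (fst i)})" for i :: "nat \<times> nat"
    have G_sets: "G i \<in> sets borel" for i by (simp add: G_def)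
    define E where "E n j = ou_event M (B n j) T (G (n, j))" for n j
    have E_sets: "E n j \<in> events" if "j \<in> {1, 2}" for n j
      unfolding E_def using that by (intro ou_event_sets[OF ibm_sbm[OF B]] G_sets)
    define F where "F N = (\<Inter>(n, j)\<in>{..N} \<times> {1, 2}. E n j)" for N :: nat
    have F_sets: "F N \<in> events" for N
      unfolding F_def using E_sets by (intro sets.finite_INT) auto
    have pair: "\<kappa> n * exp (- \<rho> n * T) \<le> prob (E n 1) * prob (E n 2)" for n
    proof (cases "n = 0")
      case True
      have "E n 2 = space M" using True by (simp add: E_def G_def ou_event_def)
      then have "prob (E n 2) = 1" by (simp add: prob_space)
      moreover have "E n 1 = ou_event M (B n 1) T {a..}" using True by (simp add: E_def G_def)
      ultimately show ?thesis using ou_stay_above[OF W1[of n] a1, of T] T True by (simp add: \<kappa>_def \<rho>_def mult_ac)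
    next
      case False
      have "E n j = ou_event M (B n j) T {- b n..b n}" if "j \<in> {1, 2}" for j using False that by (auto simp: E_def G_def)
      then have e: "stay_const (b n) * exp (- (1024 / (b n)\<^sup>2) * T) \<le> prob (E n j)" if "j \<in> {1, 2}" for j
        using ou_stay_ball[OF ibm_sbm[OF B that] b_pos] T that by simp
      have "\<kappa> n * exp (- \<rho> n * T) = (stay_const (b n) * exp (- (1024 / (b n)\<^sup>2) * T)) * (stay_const (b n) * exp (- (1024 / (b n)\<^sup>2) * T))"
        using False by (simp add: \<kappa>_def \<rho>_def power2_eq_square exp_add[symmetric])
      also have "\<dots> \<le> prob (E n 1) * prob (E n 2)"
        using stay_const_pos[OF b_pos[of n]] by (intro mult_mono e) auto
      finally show ?thesis .
    qed
    have F_ge: "c * exp (- hole_rate R * T) \<le> prob (F N)" for N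
    proof -
      have "c * exp (- hole_rate R * T) \<le> exp (- (\<Sum>n<Suc N. - ln (\<kappa> n))) * exp (- (\<Sum>n<Suc N. \<rho> n) * T)"
      proof (intro mult_mono)
        show "c \<le> exp (- (\<Sum>n<Suc N. - ln (\<kappa> n)))"
          unfolding c_def exp_le_cancel_iff neg_le_iff_le
          using \<kappa>_pos \<kappa>_le by (intro sum_le_suminf \<theta>) auto
        show "exp (- hole_rate R * T) \<le> exp (- (\<Sum>n<Suc N. \<rho> n) * T)"
          unfolding exp_le_cancel_iff using \<rho>[of "Suc N"] T by (intro mult_right_mono) auto
      qed auto
      also have "exp (- (\<Sum>n<Suc N. - ln (\<kappa> n))) = (\<Prod>n<Suc N. \<kappa> n)"
        unfolding sum_negf minus_minus exp_sum[OF finite_lessThan] using \<kappa>_pos by (intro prod.cong) auto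
      also have "exp (- (\<Sum>n<Suc N. \<rho> n) * T) = (\<Prod>n<Suc N. exp (- \<rho> n * T))"
        unfolding exp_sum[OF finite_lessThan, symmetric] by (simp only: sum_negf[symmetric] sum_distrib_right)
      also have "(\<Prod>n<Suc N. \<kappa> n) * (\<Prod>n<Suc N. exp (- \<rho> n * T)) = (\<Prod>n<Suc N. \<kappa> n * exp (- \<rho> n * T))"
        by (rule prod.distrib[symmetric])
      also have "\<dots> \<le> (\<Prod>n<Suc N. prob (E n 1) * prob (E n 2))"
        using pair \<kappa>_pos by (intro prod_mono) (simp add: less_imp_le)
      also have "\<dots> = (\<Prod>n\<in>{..N}. \<Prod>j\<in>{1,2}. prob (E n j))"
        by (simp add: lessThan_Suc_atMost)
      also have "\<dots> = (\<Prod>(n, j)\<in>{..N} \<times> {1, 2}. prob (E n j))"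
        by (rule prod.cartesian_product)
      also have "\<dots> = prob (F N)"
        unfolding F_def E_def by (rule ibm_ou_event_prod[OF B, symmetric]) (use G_sets in auto)
      finally show ?thesis .
    qed
    have "decseq F" unfolding F_def by (intro decseq_SucI INT_anti_mono) auto
    then have "(\<lambda>N. prob (F N)) \<longlonglongrightarrow> prob (\<Inter>N. F N)"
      using F_sets by (intro finite_Lim_measure_decseq) auto
    then have "c * exp (- hole_rate R * T) \<le> prob (\<Inter>N. F N)"
      using F_ge by (intro LIMSEQ_le_const) auto
    also have "\<dots> \<le> hole_prob M B T R"
    proof (rule hole_prob_compare(1)[OF B])
      show "(\<Inter>N. F N) \<in> events" using F_sets by auto
      show "AE \<omega> in M. \<omega> \<in> (\<Inter>N. F N) \<longrightarrow> \<omega> \<in> hole_event M B T R"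
        using AE_good_path[OF B] AE_space
      proof eventually_elim
        case (elim \<omega>)
        show ?case
        proof
          assume w: "\<omega> \<in> (\<Inter>N. F N)"
          have wE: "\<omega> \<in> ou_event M (B n j) T (G (n, j))" if "j \<in> {1, 2}" for n j
            using w that by (auto simp: F_def E_def)
          have X: "B n j (exp t) \<omega> / exp (t / 2) \<in> G (n, j)" if "j \<in> {1, 2}" "t \<in> {0..T}" for n j t
            using elim(1) that T by (intro ou_event_continuous[OF wE[OF that(1)]])
              (auto simp: G_def good_path_def)
          have "planar_GAF B z t \<omega> \<noteq> 0" if t: "t \<in> {0..T}" and z: "z \<in> cball 0 R" for t z
            unfolding planar_GAF_def
          proof (rule suminf_OU_bound[OF _ _ _ gs])
            fix n :: nat assume n: "0 < n"
            then have "B n j (exp t) \<omega> / exp (t / 2) \<in> {- b n..b n}" if "j \<in> {1, 2}" for j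
              using X[OF that t, of n] by (simp add: G_def)
            then show "cmod (OU_coeff B n t \<omega>) \<le> b n"
              by (intro OU_coeff_norm_le) (simp_all only: abs_le_iff atLeastAtMost_iff insert_iff, (metis insertI1 insert_commute minus_le_iff)+)
          next
            have "a \<le> B 0 1 (exp t) \<omega> / exp (t / 2)"
              using X[of 1 t 0] t by (simp add: G_def)
            also have "\<dots> \<le> sqrt 2 * cmod (OU_coeff B 0 t \<omega>)" by (rule OU_coeff_norm_ge)
            also have "\<dots> \<le> 2 * cmod (OU_coeff B 0 t \<omega>)"
              by (intro mult_right_mono) (auto intro: real_le_lsqrt)
            finally have "a / 4 < cmod (OU_coeff B 0 t \<omega>)" using a1 by simp
            then show "(\<Sum>n. b n * (R ^ n / sqrt (fact n))) < cmod (OU_coeff B 0 t \<omega>)" using g_le by linarith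
          qed (use z b_pos[of 0] in \<open>auto simp: less_imp_le\<close>)
          then show "\<omega> \<in> hole_event M B T R" using elim(2) by (auto simp: hole_event_def)
        qed
      qed
    qed
    finally show "c * exp (- hole_rate R * T) \<le> hole_prob M B T R" .
  qed
qed

lemma hole_Liminf:
  fixes B :: "nat \<Rightarrow> nat \<Rightarrow> real \<Rightarrow> 'a \<Rightarrow> real"
  assumes B: "independent_brownian_motions M B" and R: "0 < R"
  shows "- ereal (hole_rate R) \<le> Liminf at_top (\<lambda>T::real. ereal (1 / T) * log_prob (hole_prob M B T R))"
proof -
  obtain c where c: "0 < c" "\<And>T. 0 < T \<Longrightarrow> c * exp (- hole_rate R * T) \<le> hole_prob M B T R"
    using hole_prob_lower[OF R] B by metis
  have ev: "\<forall>\<^sub>F T in at_top. ereal (ln c / T - hole_rate R) \<le> ereal (1 / T) * log_prob (hole_prob M B T R)"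
    using eventually_gt_at_top[of 0]
  proof eventually_elim
    case (elim T)
    let ?p = "hole_prob M B T R"
    have p: "0 < ?p" by (rule less_le_trans[OF _ c(2)[OF elim]]) (use c(1) in simp)
    have "ln c - hole_rate R * T = ln (c * exp (- hole_rate R * T))" using c(1) by (simp add: ln_mult)
    also have "\<dots> \<le> ln ?p" using c elim p by (subst ln_le_cancel_iff) auto
    finally have "(ln c - hole_rate R * T) / T \<le> ln ?p / T" using elim by (intro divide_right_mono) auto
    then show ?case using p elim by (simp add: log_prob_def diff_divide_distrib)
  qed
  have "((\<lambda>T. ln c / T - hole_rate R) \<longlongrightarrow> - hole_rate R) at_top" by real_asymp
  then have "((\<lambda>T. ereal (ln c / T - hole_rate R)) \<longlongrightarrow> ereal (- hole_rate R)) at_top" by simp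
  then have "Liminf at_top (\<lambda>T. ereal (ln c / T - hole_rate R)) = ereal (- hole_rate R)"
    by (intro lim_imp_Liminf) auto
  then show ?thesis using Liminf_mono[OF ev] by simp
qed

lemma hole_rate_exponent:
  obtains \<epsilon> :: "real \<Rightarrow> real" where "(\<epsilon> \<longlongrightarrow> 0) at_top" "\<And>R. 0 < R \<Longrightarrow> hole_rate R = exp ((1 / 2 + \<epsilon> R) * R\<^sup>2)"
proof
  let ?e = "\<lambda>R::real. (ln 8192 + 2 * ln (2 + R) + (R + 1)\<^sup>2 / 2) / R\<^sup>2 - 1 / 2"
  show "(?e \<longlongrightarrow> 0) at_top" by real_asymp
  fix R :: real assume R: "0 < R"
  then have "(1 / 2 + ?e R) * R\<^sup>2 = ln 8192 + 2 * ln (2 + R) + (R + 1)\<^sup>2 / 2" by simp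
  moreover have "exp (2 * ln (2 + R)) = (2 + R)\<^sup>2" using R by (simp add: exp_double)
  ultimately show "hole_rate R = exp ((1 / 2 + ?e R) * R\<^sup>2)" by (simp add: hole_rate_def exp_add)
qed

section \<open>Autoregressive chains\<close>

lemma ibm_increments_indep:
  fixes \<tau> s :: "nat \<Rightarrow> real"
  assumes B: "independent_brownian_motions M B" and \<tau>: "0 \<le> \<tau> 0" "mono \<tau>"
  shows "prob_space.indep_vars M (\<lambda>_. borel)
    (\<lambda>(k, n, j) \<omega>. (B n j (\<tau> (Suc k)) \<omega> - B n j (\<tau> k) \<omega>) / s k) (UNIV \<times> (UNIV \<times> {1, 2}))"
proof -
  interpret prob_space M using B by (rule ibm_prob_space)
  let ?I = "UNIV \<times> {1, 2} :: (nat \<times> nat) set"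
  let ?S = "PiM {0..} (\<lambda>_. borel) :: (real \<Rightarrow> real) measure"
  define X where "X k p \<omega> = (B (fst p) (snd p) (\<tau> (Suc k)) \<omega> - B (fst p) (snd p) (\<tau> k) \<omega>) / s k" for k p \<omega>
  have \<tau>0: "0 \<le> \<tau> i" for i using \<tau> by (meson le0 monoD order_trans)
  have X_meas: "X k p \<in> borel_measurable M" if "p \<in> ?I" for k p
  proof -
    have [measurable]: "B (fst p) (snd p) (\<tau> i) \<in> borel_measurable M" for i
      using that \<tau>0 by (intro sbm_measurable[OF ibm_sbm[OF B]]) auto
    show ?thesis unfolding X_def by measurable
  qed
  have rows: "prob (\<Inter>k\<in>{..<m}. X k p -` A k \<inter> space M) = (\<Prod>k<m. prob (X k p -` A k \<inter> space M))"
    if p: "p \<in> ?I" and m: "0 < m" and A: "\<And>k. A k \<in> sets borel" for p m A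
  proof -
    have "standard_brownian_motion M (B (fst p) (snd p))" using p by (intro ibm_sbm[OF B]) auto
    then have "indep_vars (\<lambda>_. borel) (\<lambda>i \<omega>. B (fst p) (snd p) (\<tau> (Suc i)) \<omega> - B (fst p) (snd p) (\<tau> i) \<omega>) {..<m}"
      using \<tau> by (simp add: standard_brownian_motion_def mono_def)
    then have "indep_vars (\<lambda>_. borel) (\<lambda>k. X k p) {..<m}"
      unfolding X_def by (rule indep_vars_compose2) simp
    then show ?thesis by (rule indep_varsD) (use m A in auto)
  qed
  have "indep_vars (\<lambda>_. borel) (\<lambda>(k, p). X k p) (UNIV \<times> ?I)"
    unfolding indep_vars_def2
  proof (intro conjI ballI indep_setsI)
    fix i :: "nat \<times> nat \<times> nat" assume i: "i \<in> UNIV \<times> ?I"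
    then show m: "(case i of (k, p) \<Rightarrow> X k p) \<in> borel_measurable M" using X_meas by auto
    then show "{(case i of (k, p) \<Rightarrow> X k p) -` A \<inter> space M |A. A \<in> sets borel} \<subseteq> events" by auto
  next
    fix A and J :: "(nat \<times> nat \<times> nat) set"
    assume J: "J \<noteq> {}" "J \<subseteq> UNIV \<times> ?I" "finite J"
      and "\<forall>j\<in>J. A j \<in> {(case j of (k, p) \<Rightarrow> X k p) -` A \<inter> space M |A. A \<in> sets borel}"
    then have "\<forall>j\<in>J. \<exists>S. A j = X (fst j) (snd j) -` S \<inter> space M \<and> S \<in> sets borel"
      by (auto simp: case_prod_beta')
    then obtain S0 where S0: "\<And>j. j \<in> J \<Longrightarrow> A j = X (fst j) (snd j) -` S0 j \<inter> space M \<and> S0 j \<in> sets borel"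
      by metis
    define S where "S j = (if j \<in> J then S0 j else UNIV)" for j
    have S_sets: "S j \<in> sets borel" for j using S0 by (simp add: S_def)
    have fin: "finite (fst ` J)" "finite (snd ` J)" using J by auto
    obtain m where m: "\<And>j. j \<in> J \<Longrightarrow> fst j < m"
      using finite_nat_set_iff_bounded[THEN iffD1, OF fin(1)] by auto
    have m0: "0 < m" using J(1) m by fastforce
    define P where "P = snd ` J"
    have P: "finite P" "P \<noteq> {}" "P \<subseteq> ?I" using J by (auto simp: P_def)
    have JP: "J \<subseteq> {..<m} \<times> P" unfolding P_def using m by (auto simp: mem_Times_iff intro: rev_image_eqI)
    define C where "C p = {q \<in> space ?S. \<forall>k\<in>{..<m}. (q (\<tau> (Suc k)) - q (\<tau> k)) / s k \<in> S (k, p)}" for p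
    have C_sets: "C p \<in> sets ?S" for p
    proof -
      have [measurable]: "(\<lambda>q. q (\<tau> k)) \<in> borel_measurable ?S" for k
        using \<tau>0 by (intro measurable_component_singleton) auto
      note [measurable] = S_sets
      show ?thesis unfolding C_def by measurable
    qed
    have Y: "indep_vars (\<lambda>_. ?S) (\<lambda>(n, j) \<omega>. \<lambda>t\<in>{0..}. B n j t \<omega>) ?I"
      using B by (simp add: independent_brownian_motions_def)
    have Ceq: "(\<lambda>(n, j) \<omega>. \<lambda>t\<in>{0..}. B n j t \<omega>) p -` C p \<inter> space M = (\<Inter>k\<in>{..<m}. X k p -` S (k, p) \<inter> space M)" for p
      using m0 \<tau>0 by (auto simp: C_def X_def space_PiM split: prod.splits)
    have "(\<Inter>j\<in>J. A j) = (\<Inter>p\<in>P. \<Inter>k\<in>{..<m}. X k p -` S (k, p) \<inter> space M)"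
    proof (intro equalityI subsetI)
      fix \<omega> assume w: "\<omega> \<in> (\<Inter>j\<in>J. A j)"
      then have "\<omega> \<in> space M" using J(1) S0 by blast
      then show "\<omega> \<in> (\<Inter>p\<in>P. \<Inter>k\<in>{..<m}. X k p -` S (k, p) \<inter> space M)"
      proof (intro INT_I)
        fix p k assume "p \<in> P" "k \<in> {..<m}"
        show "\<omega> \<in> X k p -` S (k, p) \<inter> space M"
        proof (cases "(k, p) \<in> J")
          case True
          then have "\<omega> \<in> A (k, p)" using w by blast
          then show ?thesis using S0[OF True] True by (simp add: S_def)
        qed (simp add: S_def \<open>\<omega> \<in> space M\<close>)
      qed
    next
      fix \<omega> assume w: "\<omega> \<in> (\<Inter>p\<in>P. \<Inter>k\<in>{..<m}. X k p -` S (k, p) \<inter> space M)"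
      show "\<omega> \<in> (\<Inter>j\<in>J. A j)"
      proof
        fix j assume j: "j \<in> J"
        then have "snd j \<in> P" "fst j \<in> {..<m}" using JP by auto
        then have "\<omega> \<in> X (fst j) (snd j) -` S (fst j, snd j) \<inter> space M" using w by blast
        then show "\<omega> \<in> A j" using S0[OF j] j by (simp add: S_def)
      qed
    qed
    then have "prob (\<Inter>j\<in>J. A j) = prob (\<Inter>p\<in>P. (\<lambda>(n, j) \<omega>. \<lambda>t\<in>{0..}. B n j t \<omega>) p -` C p \<inter> space M)"
      unfolding Ceq by simp
    also have "\<dots> = (\<Prod>p\<in>P. prob ((\<lambda>(n, j) \<omega>. \<lambda>t\<in>{0..}. B n j t \<omega>) p -` C p \<inter> space M))"
      using P C_sets by (intro indep_varsD[OF Y]) auto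
    also have "\<dots> = (\<Prod>p\<in>P. \<Prod>k<m. prob (X k p -` S (k, p) \<inter> space M))"
      unfolding Ceq using P m0 S_sets by (intro prod.cong rows) auto
    also have "\<dots> = (\<Prod>k<m. \<Prod>p\<in>P. prob (X k p -` S (k, p) \<inter> space M))"
      by (rule prod.swap)
    also have "\<dots> = (\<Prod>j\<in>{..<m} \<times> P. prob (X (fst j) (snd j) -` S j \<inter> space M))"
      by (simp add: prod.cartesian_product case_prod_beta')
    also have "\<dots> = (\<Prod>j\<in>J. prob (X (fst j) (snd j) -` S j \<inter> space M))"
      using P JP by (intro prod.mono_neutral_right) (auto simp: S_def prob_space)
    also have "\<dots> = (\<Prod>j\<in>J. prob (A j))"
      using S0 by (intro prod.cong) (auto simp: S_def)
    finally show "prob (\<Inter>j\<in>J. A j) = (\<Prod>j\<in>J. prob (A j))" .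
  qed
  then show ?thesis by (simp add: X_def[abs_def] case_prod_beta')
qed

lemma nn_integral_indep_var:
  assumes "prob_space M" "prob_space.indep_var M S X T Y" and f[measurable]: "f \<in> borel_measurable (S \<Otimes>\<^sub>M T)"
  shows "(\<integral>\<^sup>+\<omega>. f (X \<omega>, Y \<omega>) \<partial>M) = (\<integral>\<^sup>+x. \<integral>\<^sup>+y. f (x, y) \<partial>distr M T Y \<partial>distr M S X)"
proof -
  interpret prob_space M by fact
  have X[measurable]: "X \<in> measurable M S" and Y[measurable]: "Y \<in> measurable M T"
    using assms(2) by (auto dest: indep_var_rv1 indep_var_rv2)
  interpret Y: prob_space "distr M T Y" by (rule prob_space_distr) fact
  have "(\<integral>\<^sup>+\<omega>. f (X \<omega>, Y \<omega>) \<partial>M) = (\<integral>\<^sup>+p. f p \<partial>distr M (S \<Otimes>\<^sub>M T) (\<lambda>\<omega>. (X \<omega>, Y \<omega>)))"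
    by (subst nn_integral_distr) auto
  also have "\<dots> = (\<integral>\<^sup>+p. f p \<partial>(distr M S X \<Otimes>\<^sub>M distr M T Y))"
    using assms(2) by (simp add: indep_var_distribution_eq)
  also have "\<dots> = (\<integral>\<^sup>+x. \<integral>\<^sup>+y. f (x, y) \<partial>distr M T Y \<partial>distr M S X)"
    by (subst Y.nn_integral_fst[symmetric]) auto
  finally show ?thesis .
qed

definition ar_step :: "real \<Rightarrow> real \<Rightarrow> 'i set \<Rightarrow> ('i \<Rightarrow> real) \<Rightarrow> ('i \<Rightarrow> real) \<Rightarrow> 'i \<Rightarrow> real" where
  "ar_step \<rho> \<sigma> I y g = (\<lambda>i\<in>I. \<rho> * y i + \<sigma> * g i)"

fun ar_path :: "real \<Rightarrow> real \<Rightarrow> 'i set \<Rightarrow> (nat \<times> 'i \<Rightarrow> real) \<Rightarrow> nat \<Rightarrow> 'i \<Rightarrow> real" where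
  "ar_path \<rho> \<sigma> I x 0 = (\<lambda>i\<in>I. x (0, i))"
| "ar_path \<rho> \<sigma> I x (Suc k) = ar_step \<rho> \<sigma> I (ar_path \<rho> \<sigma> I x k) (\<lambda>i\<in>I. x (Suc k, i))"

lemma ar_step_measurable:
  "(\<lambda>(y, g). ar_step \<rho> \<sigma> I y g) \<in> PiM I (\<lambda>_. borel) \<Otimes>\<^sub>M PiM I (\<lambda>_. borel) \<rightarrow>\<^sub>M PiM I (\<lambda>_. borel)"
  unfolding ar_step_def case_prod_beta'
  by (intro measurable_restrict borel_measurable_add borel_measurable_times borel_measurable_const
      measurable_compose[OF measurable_fst measurable_component_singleton]
      measurable_compose[OF measurable_snd measurable_component_singleton])

lemma ar_path_measurable:
  "j \<le> k \<Longrightarrow> (\<lambda>x. ar_path \<rho> \<sigma> I x j) \<in> PiM ({..k} \<times> I) (\<lambda>_. borel) \<rightarrow>\<^sub>M PiM I (\<lambda>_. borel)"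
proof (induction j)
  case 0
  then show ?case unfolding ar_path.simps by (intro measurable_restrict measurable_component_singleton) auto
next
  case (Suc j)
  have "(\<lambda>x. \<lambda>i\<in>I. x (Suc j, i)) \<in> PiM ({..k} \<times> I) (\<lambda>_. borel) \<rightarrow>\<^sub>M PiM I (\<lambda>_. borel::real measure)"
    using Suc.prems by (intro measurable_restrict measurable_component_singleton) auto
  moreover have "(\<lambda>x. ar_path \<rho> \<sigma> I x j) \<in> PiM ({..k} \<times> I) (\<lambda>_. borel) \<rightarrow>\<^sub>M PiM I (\<lambda>_. borel)"
    using Suc by auto
  ultimately have "(\<lambda>x. (ar_path \<rho> \<sigma> I x j, \<lambda>i\<in>I. x (Suc j, i))) \<in>
      PiM ({..k} \<times> I) (\<lambda>_. borel) \<rightarrow>\<^sub>M PiM I (\<lambda>_. borel) \<Otimes>\<^sub>M PiM I (\<lambda>_. borel)"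
    by (rule measurable_Pair[rotated])
  from measurable_compose[OF this ar_step_measurable[of \<rho> \<sigma> I]] show ?case by simp
qed

lemma ar_path_cong:
  "(\<And>l i. l \<le> k \<Longrightarrow> i \<in> I \<Longrightarrow> x (l, i) = x' (l, i)) \<Longrightarrow> ar_path \<rho> \<sigma> I x k = ar_path \<rho> \<sigma> I x' k"
proof (induction k)
  case 0 then show ?case by (auto simp: fun_eq_iff restrict_def)
next
  case (Suc k)
  have "(\<lambda>i\<in>I. x (Suc k, i)) = (\<lambda>i\<in>I. x' (Suc k, i))" using Suc.prems by (auto simp: fun_eq_iff restrict_def)
  moreover have "ar_path \<rho> \<sigma> I x k = ar_path \<rho> \<sigma> I x' k" using Suc by auto
  ultimately show ?case by simp
qed

lemma ar_killed_supermartingale: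
  fixes G :: "nat \<times> 'i \<Rightarrow> 'a \<Rightarrow> real" and \<kappa> :: ennreal
  assumes M: "prob_space M" and I: "I \<noteq> {}"
    and G: "prob_space.indep_vars M (\<lambda>_. borel) G (UNIV \<times> I)"
    and G_distr: "\<And>k i. i \<in> I \<Longrightarrow> distr M borel (G (k, i)) = std_normal"
    and \<Phi>[measurable]: "\<Phi> \<in> borel_measurable (PiM I (\<lambda>_. borel))"
    and H[measurable]: "H \<in> sets (PiM I (\<lambda>_. borel))"
    and drift: "\<And>y. y \<in> space (PiM I (\<lambda>_. borel)) \<Longrightarrow>
      (\<integral>\<^sup>+g. \<Phi> (ar_step \<rho> \<sigma> I y g) * indicator H (ar_step \<rho> \<sigma> I y g) \<partial>PiM I (\<lambda>_. std_normal)) \<le> \<kappa> * \<Phi> y"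
  defines "Y \<equiv> \<lambda>k \<omega>. ar_path \<rho> \<sigma> I (\<lambda>p. G p \<omega>) k"
  shows "(\<integral>\<^sup>+\<omega>. \<Phi> (Y n \<omega>) * (\<Prod>k\<in>{1..n}. indicator H (Y k \<omega>)) \<partial>M) \<le> \<kappa> ^ n * (\<integral>\<^sup>+g. \<Phi> g \<partial>PiM I (\<lambda>_. std_normal))"
proof (induction n)
  let ?S = "PiM I (\<lambda>_. borel) :: ('i \<Rightarrow> real) measure" and ?\<nu> = "PiM I (\<lambda>_. std_normal)"
  interpret prob_space M by (rule M)
  have G_meas: "G (k, i) \<in> borel_measurable M" if "i \<in> I" for k i
    using G that by (auto simp: indep_vars_def)
  have law: "distr M ?S (\<lambda>\<omega>. \<lambda>i\<in>I. G (k, i) \<omega>) = ?\<nu>" for k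
  proof -
    have ind: "indep_sets (\<lambda>p. {G p -` A \<inter> space M |A. A \<in> sets borel}) (UNIV \<times> I)"
      using G unfolding indep_vars_def2 by blast
    have "indep_vars (\<lambda>_. borel) (\<lambda>i. G (k, i)) I"
      unfolding indep_vars_def2
    proof (intro conjI ballI indep_setsI)
      fix i assume i: "i \<in> I"
      then show m: "G (k, i) \<in> borel_measurable M" by (rule G_meas)
      then show "{G (k, i) -` A \<inter> space M |A. A \<in> sets borel} \<subseteq> events" by auto
    next
      fix A J assume J: "J \<noteq> {}" "J \<subseteq> I" "finite J" and A: "\<forall>i\<in>J. A i \<in> {G (k, i) -` A \<inter> space M |A. A \<in> sets borel}"
      have "prob (\<Inter>p\<in>Pair k ` J. (A \<circ> snd) p) = (\<Prod>p\<in>Pair k ` J. prob ((A \<circ> snd) p))"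
        using J A by (intro indep_setsD[OF ind]) auto
      then show "prob (\<Inter>i\<in>J. A i) = (\<Prod>i\<in>J. prob (A i))"
        by (simp add: image_image prod.reindex inj_on_def)
    qed
    then have "distr M ?S (\<lambda>\<omega>. \<lambda>i\<in>I. G (k, i) \<omega>) = PiM I (\<lambda>i. distr M borel (G (k, i)))"
      using G_meas by (subst (asm) indep_vars_iff_distr_eq_PiM'[OF I]) auto
    also have "\<dots> = ?\<nu>" using G_distr by (intro PiM_cong) auto
    finally show ?thesis .
  qed
  {
    case 0
    have "(\<lambda>\<omega>. \<lambda>i\<in>I. G (0, i) \<omega>) \<in> M \<rightarrow>\<^sub>M ?S" by (intro measurable_restrict G_meas)
    then have "(\<integral>\<^sup>+\<omega>. \<Phi> (Y 0 \<omega>) \<partial>M) = (\<integral>\<^sup>+g. \<Phi> g \<partial>?\<nu>)"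
      unfolding law[of 0, symmetric] by (subst nn_integral_distr) (auto simp: Y_def)
    then show ?case by simp
  next
    case (Suc n)
    let ?P = "PiM ({..n} \<times> I) (\<lambda>_. borel) :: (nat \<times> 'i \<Rightarrow> real) measure"
    define past where "past \<omega> = restrict (\<lambda>p. G p \<omega>) ({..n} \<times> I)" for \<omega>
    let ?P' = "PiM ({Suc n} \<times> I) (\<lambda>_. borel) :: (nat \<times> 'i \<Rightarrow> real) measure"
    define new' where "new' \<omega> = restrict (\<lambda>p. G p \<omega>) ({Suc n} \<times> I)" for \<omega>
    define pr where "pr = (\<lambda>x :: nat \<times> 'i \<Rightarrow> real. \<lambda>i\<in>I. x (Suc n, i))"
    define new where "new \<omega> = (\<lambda>i\<in>I. G (Suc n, i) \<omega>)" for \<omega>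
    have "indep_var ?P (\<lambda>\<omega>. restrict (\<lambda>p. G p \<omega>) ({..n} \<times> I)) (PiM ({Suc n} \<times> I) (\<lambda>_. borel)) (\<lambda>\<omega>. restrict (\<lambda>p. G p \<omega>) ({Suc n} \<times> I))"
      by (rule indep_var_restrict[OF G]) auto
    then have ind: "indep_var ?P past ?P' new'" by (simp add: past_def[abs_def] new'_def[abs_def])
    have pr[measurable]: "pr \<in> ?P' \<rightarrow>\<^sub>M ?S"
      unfolding pr_def by (intro measurable_restrict measurable_component_singleton) auto
    have pr_new: "pr (new' \<omega>) = new \<omega>" for \<omega> by (auto simp: pr_def new'_def new_def)
    have new'_meas: "new' \<in> M \<rightarrow>\<^sub>M ?P'" using ind by (rule indep_var_rv2)
    have law': "distr (distr M ?P' new') ?S pr = ?\<nu>"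
      unfolding law[of "Suc n", symmetric] using new'_meas
      by (subst distr_distr) (auto simp: comp_def pr_new new_def)
    have past_meas: "past \<in> M \<rightarrow>\<^sub>M ?P" using ind by (rule indep_var_rv1)
    have Yp: "Y k \<omega> = ar_path \<rho> \<sigma> I (past \<omega>) k" if "k \<le> n" for k \<omega>
      unfolding Y_def past_def using that by (intro ar_path_cong) auto
    have Yn: "Y (Suc n) \<omega> = ar_step \<rho> \<sigma> I (ar_path \<rho> \<sigma> I (past \<omega>) n) (new \<omega>)" for \<omega>
      using Yp[of n \<omega>] by (simp add: Y_def new_def)
    have [measurable]: "(\<lambda>x. ar_path \<rho> \<sigma> I x k) \<in> ?P \<rightarrow>\<^sub>M ?S" if "k \<le> n" for k
      using that by (rule ar_path_measurable)
    note [measurable] = ar_step_measurable[of \<rho> \<sigma> I]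
    define q :: "(nat \<times> 'i \<Rightarrow> real) \<Rightarrow> ennreal" where "q x = (\<Prod>k\<in>{1..n}. indicator H (ar_path \<rho> \<sigma> I x k))" for x
    have q[measurable]: "q \<in> borel_measurable ?P"
      unfolding q_def by (intro borel_measurable_prod_ennreal) measurable
    define f where "f = (\<lambda>(x, g). q x * (\<Phi> (ar_step \<rho> \<sigma> I (ar_path \<rho> \<sigma> I x n) g) * indicator H (ar_step \<rho> \<sigma> I (ar_path \<rho> \<sigma> I x n) g)))"
    have step2: "(\<lambda>p. ar_step \<rho> \<sigma> I (ar_path \<rho> \<sigma> I (fst p) n) (snd p)) \<in> ?P \<Otimes>\<^sub>M ?S \<rightarrow>\<^sub>M ?S"
    proof -
      have "(\<lambda>p. (ar_path \<rho> \<sigma> I (fst p) n, snd p)) \<in> ?P \<Otimes>\<^sub>M ?S \<rightarrow>\<^sub>M ?S \<Otimes>\<^sub>M ?S" by measurable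
      from measurable_compose[OF this ar_step_measurable] show ?thesis by simp
    qed
    have f[measurable]: "(\<lambda>(x, x'). f (x, pr x')) \<in> borel_measurable (?P \<Otimes>\<^sub>M ?P')"
    proof -
      have "(\<lambda>p. (fst p, pr (snd p))) \<in> ?P \<Otimes>\<^sub>M ?P' \<rightarrow>\<^sub>M ?P \<Otimes>\<^sub>M ?S" by measurable
      note step3 = measurable_compose[OF this step2, unfolded fst_conv snd_conv]
      show ?thesis
        unfolding f_def case_prod_beta' fst_conv snd_conv
        by (intro borel_measurable_times_ennreal measurable_compose[OF measurable_fst q]
            measurable_compose[OF step3 \<Phi>] measurable_compose[OF step3 borel_measurable_indicator[OF H]])
    qed
    have prod_Suc: "(\<Prod>k\<in>{1..Suc n}. indicator H (Y k \<omega>)) = q (past \<omega>) * (indicator H (Y (Suc n) \<omega>) :: ennreal)" for \<omega>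
      using Yp by (simp add: q_def)
    have "(\<integral>\<^sup>+\<omega>. \<Phi> (Y (Suc n) \<omega>) * (\<Prod>k\<in>{1..Suc n}. indicator H (Y k \<omega>)) \<partial>M) = (\<integral>\<^sup>+\<omega>. f (past \<omega>, pr (new' \<omega>)) \<partial>M)"
      unfolding prod_Suc pr_new by (simp add: f_def Yn mult_ac)
    also have "\<dots> = (\<integral>\<^sup>+x. \<integral>\<^sup>+x'. f (x, pr x') \<partial>distr M ?P' new' \<partial>distr M ?P past)"
      using nn_integral_indep_var[OF M ind f] by simp
    also have "\<dots> \<le> (\<integral>\<^sup>+x. q x * (\<kappa> * \<Phi> (ar_path \<rho> \<sigma> I x n)) \<partial>distr M ?P past)"
    proof (rule nn_integral_mono)
      fix x assume "x \<in> space (distr M ?P past)"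
      then have x: "x \<in> space ?P" by simp
      then have y: "ar_path \<rho> \<sigma> I x n \<in> space ?S" using measurable_space[OF ar_path_measurable[OF order_refl]] by blast
      have sets_eq: "sets ?\<nu> = sets ?S" by (intro sets_PiM_cong) auto
      have m0: "(\<lambda>g. ar_step \<rho> \<sigma> I (ar_path \<rho> \<sigma> I x n) g) \<in> ?S \<rightarrow>\<^sub>M ?S"
        using measurable_compose[OF measurable_Pair1'[OF x, of ?S] step2] by simp
      then have m: "(\<lambda>g. ar_step \<rho> \<sigma> I (ar_path \<rho> \<sigma> I x n) g) \<in> ?\<nu> \<rightarrow>\<^sub>M ?S"
        unfolding measurable_cong_sets[OF sets_eq refl] .
      have fx: "(\<lambda>g. f (x, g)) \<in> borel_measurable ?S"
        unfolding f_def case_prod_conv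
        by (intro borel_measurable_times_ennreal borel_measurable_const measurable_compose[OF m0 \<Phi>]
            measurable_compose[OF m0 borel_measurable_indicator[OF H]])
      have "(\<integral>\<^sup>+x'. f (x, pr x') \<partial>distr M ?P' new') = (\<integral>\<^sup>+g. f (x, g) \<partial>distr (distr M ?P' new') ?S pr)"
        using fx pr by (subst nn_integral_distr) auto
      also have "\<dots> = (\<integral>\<^sup>+g. f (x, g) \<partial>?\<nu>)" unfolding law' ..
      also have "\<dots> = q x * (\<integral>\<^sup>+g. \<Phi> (ar_step \<rho> \<sigma> I (ar_path \<rho> \<sigma> I x n) g) * indicator H (ar_step \<rho> \<sigma> I (ar_path \<rho> \<sigma> I x n) g) \<partial>?\<nu>)"
        unfolding f_def case_prod_conv
        by (intro nn_integral_cmult borel_measurable_times_ennreal measurable_compose[OF m \<Phi>]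
            measurable_compose[OF m borel_measurable_indicator[OF H]])
      also have "\<dots> \<le> q x * (\<kappa> * \<Phi> (ar_path \<rho> \<sigma> I x n))"
        by (intro mult_left_mono drift y) simp
      finally show "(\<integral>\<^sup>+x'. f (x, pr x') \<partial>distr M ?P' new') \<le> q x * (\<kappa> * \<Phi> (ar_path \<rho> \<sigma> I x n))" .
    qed
    also have "\<dots> = (\<integral>\<^sup>+\<omega>. q (past \<omega>) * (\<kappa> * \<Phi> (ar_path \<rho> \<sigma> I (past \<omega>) n)) \<partial>M)"
      using past_meas by (subst nn_integral_distr) auto
    also have "\<dots> = (\<integral>\<^sup>+\<omega>. \<kappa> * (\<Phi> (Y n \<omega>) * (\<Prod>k\<in>{1..n}. indicator H (Y k \<omega>))) \<partial>M)"
      using Yp by (intro nn_integral_cong) (simp add: q_def mult_ac)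
    also have "\<dots> = \<kappa> * (\<integral>\<^sup>+\<omega>. \<Phi> (Y n \<omega>) * (\<Prod>k\<in>{1..n}. indicator H (Y k \<omega>)) \<partial>M)"
    proof (rule nn_integral_cmult)
      have "(\<lambda>\<omega>. \<Phi> (ar_path \<rho> \<sigma> I (past \<omega>) n) * q (past \<omega>)) \<in> borel_measurable M" using past_meas by measurable
      then show "(\<lambda>\<omega>. \<Phi> (Y n \<omega>) * (\<Prod>k\<in>{1..n}. indicator H (Y k \<omega>))) \<in> borel_measurable M"
        using Yp by (simp add: q_def)
    qed
    also have "\<dots> \<le> \<kappa> * (\<kappa> ^ n * (\<integral>\<^sup>+g. \<Phi> g \<partial>?\<nu>))" by (intro mult_left_mono Suc) simp
    finally show ?case by (simp add: mult.assoc)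
  }
qed

abbreviation gaf_index :: "(nat \<times> nat) set" where
  "gaf_index \<equiv> UNIV \<times> {1, 2}"

abbreviation gaf_space :: "(nat \<times> nat \<Rightarrow> real) measure" where
  "gaf_space \<equiv> PiM gaf_index (\<lambda>_. borel)"

abbreviation gaf_law :: "(nat \<times> nat \<Rightarrow> real) measure" where
  "gaf_law \<equiv> PiM gaf_index (\<lambda>_. std_normal)"

definition gaf_coeff :: "(nat \<times> nat \<Rightarrow> real) \<Rightarrow> nat \<Rightarrow> complex" where
  "gaf_coeff y n = Complex (y (n, 1) / sqrt 2) (y (n, 2) / sqrt 2)"

lemma prob_space_gaf_law: "prob_space gaf_law"
  by (intro prob_space_PiM prob_space_std_normal)

lemma sets_gaf_law: "sets gaf_law = sets gaf_space"
  by (intro sets_PiM_cong) auto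

lemma ar_path_OU:
  fixes B :: "nat \<Rightarrow> nat \<Rightarrow> real \<Rightarrow> 'a \<Rightarrow> real" and \<delta> :: real
  assumes \<delta>: "0 < \<delta>" and p: "p \<in> gaf_index" and B0: "\<And>n j. j \<in> {1, 2} \<Longrightarrow> B n j 0 \<omega> = 0"
  defines "\<tau> \<equiv> \<lambda>i. case i of 0 \<Rightarrow> 0 | Suc k \<Rightarrow> exp (real k * \<delta>)"
  shows "ar_path (exp (- \<delta> / 2)) (sqrt (1 - exp (- \<delta>))) gaf_index
      (\<lambda>(k, n, j). (B n j (\<tau> (Suc k)) \<omega> - B n j (\<tau> k) \<omega>) / sqrt (\<tau> (Suc k) - \<tau> k)) k p =
    B (fst p) (snd p) (exp (k * \<delta>)) \<omega> / exp (k * \<delta> / 2)"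
proof (induction k)
  case 0
  have "B (fst p) (snd p) 0 \<omega> = 0" using p B0 by auto
  then show ?case using p by (auto simp: \<tau>_def split: prod.splits)
next
  case (Suc k)
  let ?u = "exp (k * \<delta>)" and ?v = "exp (real (Suc k) * \<delta>)" and ?s = "sqrt (1 - exp (- \<delta>))"
  let ?b = "\<lambda>t. B (fst p) (snd p) t \<omega>"
  have s: "0 < ?s" using \<delta> by simp
  have "?v - ?u = (exp (real (Suc k) * \<delta> / 2))\<^sup>2 * (1 - exp (- \<delta>))"
  proof -
    have "(exp (real (Suc k) * \<delta> / 2))\<^sup>2 = ?v" by (subst exp_double[symmetric]) simp
    moreover have "?v * exp (- \<delta>) = ?u" by (subst exp_add[symmetric]) (simp add: algebra_simps)
    ultimately show ?thesis by (simp add: right_diff_distrib)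
  qed
  then have sq: "sqrt (?v - ?u) = exp (real (Suc k) * \<delta> / 2) * ?s"
    by (simp add: real_sqrt_mult)
  have e: "exp (- \<delta> / 2) * (b / exp (k * \<delta> / 2)) = b / exp (real (Suc k) * \<delta> / 2)" for b
    by (simp add: exp_minus field_simps exp_add[symmetric])
  have "ar_path (exp (- \<delta> / 2)) ?s gaf_index
      (\<lambda>(k, n, j). (B n j (\<tau> (Suc k)) \<omega> - B n j (\<tau> k) \<omega>) / sqrt (\<tau> (Suc k) - \<tau> k)) (Suc k) p =
    exp (- \<delta> / 2) * (?b ?u / exp (k * \<delta> / 2)) + ?s * ((?b ?v - ?b ?u) / sqrt (?v - ?u))"
    using p Suc by (auto simp: ar_step_def \<tau>_def split: prod.splits)
  also have "\<dots> = ?b ?u / exp (real (Suc k) * \<delta> / 2) + (?b ?v - ?b ?u) / exp (real (Suc k) * \<delta> / 2)"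
    unfolding e sq using s by simp
  also have "\<dots> = ?b ?v / exp (real (Suc k) * \<delta> / 2)"
    by (simp add: add_divide_distrib[symmetric])
  finally show ?case .
qed

lemma OU_coeff_eq:
  "OU_coeff B n t \<omega> = Complex (B n 1 (exp t) \<omega> / exp (t / 2) / sqrt 2) (B n 2 (exp t) \<omega> / exp (t / 2) / sqrt 2)"
  unfolding OU_coeff_def by (simp add: complex_eq_iff exp_minus field_simps)

lemma hole_Limsup_drift:
  fixes B :: "nat \<Rightarrow> nat \<Rightarrow> real \<Rightarrow> 'a \<Rightarrow> real" and \<kappa> \<delta> R :: real
  assumes B: "independent_brownian_motions M B" and \<delta>: "0 < \<delta>" and \<kappa>: "0 < \<kappa>" "\<kappa> < 1" and R: "0 < R"
    and \<Phi>: "\<Phi> \<in> borel_measurable gaf_space" and H: "H \<in> sets gaf_space"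
    and \<Phi>1: "\<And>y. 1 \<le> \<Phi> y" and \<Phi>_fin: "(\<integral>\<^sup>+g. \<Phi> g \<partial>gaf_law) < \<infinity>"
    and drift: "\<And>y. y \<in> space gaf_space \<Longrightarrow>
      (\<integral>\<^sup>+g. \<Phi> (ar_step (exp (- \<delta> / 2)) (sqrt (1 - exp (- \<delta>))) gaf_index y g) *
         indicator H (ar_step (exp (- \<delta> / 2)) (sqrt (1 - exp (- \<delta>))) gaf_index y g) \<partial>gaf_law) \<le> ennreal \<kappa> * \<Phi> y"
    and hole: "\<And>y. y \<in> space gaf_space \<Longrightarrow> summable (\<lambda>n. cmod (gaf_coeff y n) * (R ^ n / sqrt (fact n))) \<Longrightarrow>
      (\<And>z. z \<in> cball 0 R \<Longrightarrow> (\<Sum>n. gaf_coeff y n * (z ^ n / complex_of_real (sqrt (fact n)))) \<noteq> 0) \<Longrightarrow> y \<in> H"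
  shows "Limsup at_top (\<lambda>T::real. ereal (1 / T) * log_prob (hole_prob M B T R)) \<le> ereal (ln \<kappa> / \<delta>)"
proof -
  interpret prob_space M using B by (rule ibm_prob_space)
  define \<tau> where "\<tau> = (\<lambda>i. case i of 0 \<Rightarrow> 0 | Suc k \<Rightarrow> exp (real k * \<delta>))"
  have \<tau>_mono: "mono \<tau>" using \<delta> by (intro monoI) (auto simp: \<tau>_def split: nat.splits)
  have \<tau>_less: "\<tau> k < \<tau> (Suc k)" for k using \<delta> by (auto simp: \<tau>_def split: nat.splits)
  have \<tau>_nn: "0 \<le> \<tau> k" for k by (auto simp: \<tau>_def split: nat.splits)
  define G where "G = (\<lambda>(k, n, j) \<omega>. (B n j (\<tau> (Suc k)) \<omega> - B n j (\<tau> k) \<omega>) / sqrt (\<tau> (Suc k) - \<tau> k))"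
  have G: "indep_vars (\<lambda>_. borel) G (UNIV \<times> gaf_index)"
    unfolding G_def by (rule ibm_increments_indep[OF B _ \<tau>_mono]) (rule \<tau>_nn)
  have G_distr: "distr M borel (G (k, p)) = std_normal" if "p \<in> gaf_index" for k p
  proof -
    have "standard_brownian_motion M (B (fst p) (snd p))" using that by (intro ibm_sbm[OF B]) auto
    from sbm_incr_distr[OF this \<tau>_nn \<tau>_less] show ?thesis by (simp add: G_def case_prod_beta')
  qed
  let ?\<rho> = "exp (- \<delta> / 2)" and ?\<sigma> = "sqrt (1 - exp (- \<delta>))"
  define Y where "Y k \<omega> = ar_path ?\<rho> ?\<sigma> gaf_index (\<lambda>p. G p \<omega>) k" for k \<omega>
  define C where "C = enn2real (\<integral>\<^sup>+g. \<Phi> g \<partial>gaf_law)"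
  interpret g: prob_space gaf_law by (rule prob_space_gaf_law)
  have C: "(\<integral>\<^sup>+g. \<Phi> g \<partial>gaf_law) = ennreal C" using \<Phi>_fin by (simp add: C_def)
  have "1 \<le> (\<integral>\<^sup>+g. \<Phi> g \<partial>gaf_law)"
    using nn_integral_mono[of gaf_law "\<lambda>_. 1" \<Phi>] \<Phi>1 g.emeasure_space_1 by simp
  then have C1: "1 \<le> C" unfolding C by simp
  have Y_meas: "Y k \<in> M \<rightarrow>\<^sub>M gaf_space" for k
  proof -
    have "(\<lambda>\<omega>. restrict (\<lambda>p. G p \<omega>) ({..k} \<times> gaf_index)) \<in> M \<rightarrow>\<^sub>M PiM ({..k} \<times> gaf_index) (\<lambda>_. borel)"
      using G by (intro measurable_restrict) (auto simp: indep_vars_def)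
    from measurable_compose[OF this ar_path_measurable[of k k ?\<rho> ?\<sigma> gaf_index]]
    have "(\<lambda>\<omega>. ar_path ?\<rho> ?\<sigma> gaf_index (restrict (\<lambda>p. G p \<omega>) ({..k} \<times> gaf_index)) k) \<in> M \<rightarrow>\<^sub>M gaf_space" by simp
    moreover have "(\<lambda>\<omega>. ar_path ?\<rho> ?\<sigma> gaf_index (restrict (\<lambda>p. G p \<omega>) ({..k} \<times> gaf_index)) k) = Y k"
      unfolding Y_def by (intro ext ar_path_cong) auto
    ultimately show ?thesis by simp
  qed
  have Y_space: "Y k \<omega> \<in> space gaf_space" if "\<omega> \<in> space M" for k \<omega>
    using measurable_space[OF Y_meas that] .
  define S where "S N = {\<omega>\<in>space M. \<forall>k\<in>{1..N}. Y k \<omega> \<in> H}" for N :: nat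
  have S_sets: "S N \<in> events" for N
  proof -
    note [measurable] = Y_meas H
    show ?thesis unfolding S_def by measurable
  qed
  have S_le: "prob (S N) \<le> C * \<kappa> ^ N" for N
  proof -
    have "ennreal (prob (S N)) = (\<integral>\<^sup>+\<omega>. indicator (S N) \<omega> \<partial>M)"
      using S_sets by (simp add: emeasure_eq_measure)
    also have "\<dots> \<le> (\<integral>\<^sup>+\<omega>. \<Phi> (Y N \<omega>) * (\<Prod>k\<in>{1..N}. indicator H (Y k \<omega>)) \<partial>M)"
    proof (rule nn_integral_mono)
      fix \<omega>
      show "indicator (S N) \<omega> \<le> \<Phi> (Y N \<omega>) * (\<Prod>k\<in>{1..N}. indicator H (Y k \<omega>))"
      proof (cases "\<omega> \<in> S N")
        case True
        then have "(\<Prod>k\<in>{1..N}. indicator H (Y k \<omega>)) = (1 :: ennreal)" by (intro prod.neutral) (auto simp: S_def)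
        then show ?thesis using \<Phi>1 True by simp
      qed simp
    qed
    also have "\<dots> \<le> ennreal \<kappa> ^ N * ennreal C"
      unfolding Y_def C[symmetric]
      by (rule ar_killed_supermartingale[OF prob_space_axioms _ G G_distr \<Phi> H drift]) auto
    also have "\<dots> = ennreal (C * \<kappa> ^ N)"
      using \<kappa> C1 by (simp add: ennreal_power ennreal_mult'[symmetric] mult.commute)
    finally show ?thesis using \<kappa> C1 by (simp add: ennreal_le_iff)
  qed
  have AE_B0: "AE \<omega> in M. \<forall>n. \<forall>j\<in>{1, 2}. B n j 0 \<omega> = 0"
    using B by (auto simp: AE_all_countable independent_brownian_motions_def standard_brownian_motion_def)
  have hole_S: "hole_prob M B T R \<le> prob (S N)" if N: "N * \<delta> \<le> T" for N :: nat and T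
  proof (rule hole_prob_compare(2)[OF B S_sets])
    show "AE \<omega> in M. \<omega> \<in> hole_event M B T R \<longrightarrow> \<omega> \<in> S N"
      using AE_B0 AE_good_path[OF B]
    proof eventually_elim
      case (elim \<omega>)
      show ?case
      proof
        assume h: "\<omega> \<in> hole_event M B T R"
        then have w: "\<omega> \<in> space M" by (simp add: hole_event_def)
        have "Y k \<omega> \<in> H" if k: "k \<in> {1..N}" for k
        proof (rule hole)
          define t where "t = k * \<delta>"
          have "t \<le> N * \<delta>" unfolding t_def using k \<delta> by (intro mult_right_mono) auto
          then have "t \<le> T" using N by linarith
          moreover have "0 \<le> t" using \<delta> by (simp add: t_def)
          ultimately have t: "t \<in> {0..T}" by simp
          have Yeq: "Y k \<omega> p = B (fst p) (snd p) (exp t) \<omega> / exp (t / 2)" if "p \<in> gaf_index" for p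
            using ar_path_OU[OF \<delta> that, of B \<omega> k] elim(1)
            unfolding Y_def G_def \<tau>_def t_def by (simp add: case_prod_beta')
          have co: "gaf_coeff (Y k \<omega>) n = OU_coeff B n t \<omega>" for n
            by (simp add: gaf_coeff_def OU_coeff_eq Yeq)
          show "Y k \<omega> \<in> space gaf_space" by (rule Y_space[OF w])
          have "\<forall>\<^sub>F n in sequentially. norm (cmod (gaf_coeff (Y k \<omega>) n) * (R ^ n / sqrt (fact n))) \<le> (2 * \<bar>R\<bar>) ^ n / sqrt (fact n)"
            using good_path_bound[OF elim(2), of T R]
          proof eventually_elim
            case (elim n)
            from bspec[OF this, of "(t, complex_of_real R)"] t R
            show ?case by (simp add: co norm_mult norm_divide norm_power)
          qed
          then show "summable (\<lambda>n. cmod (gaf_coeff (Y k \<omega>) n) * (R ^ n / sqrt (fact n)))"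
            by (rule summable_comparison_test_ev) (rule summable_pow_sqrt_fact(1)[of 2], auto)
          fix z :: complex assume "z \<in> cball 0 R"
          then show "(\<Sum>n. gaf_coeff (Y k \<omega>) n * (z ^ n / complex_of_real (sqrt (fact n)))) \<noteq> 0"
            using h t unfolding co hole_event_def planar_GAF_def by blast
        qed
        then show "\<omega> \<in> S N" using w by (simp add: S_def)
      qed
    qed
  qed
  define K where "K = ln C - ln \<kappa>"
  have ev: "\<forall>\<^sub>F T in at_top. ereal (1 / T) * log_prob (hole_prob M B T R) \<le> ereal (K / T + ln \<kappa> / \<delta>)"
    using eventually_gt_at_top[of 0]
  proof eventually_elim
    case (elim T)
    define N where "N = nat \<lfloor>T / \<delta>\<rfloor>"
    have T\<delta>: "0 < T / \<delta>" using elim \<delta> by simp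
    have N: "N \<le> T / \<delta>" "T / \<delta> - 1 \<le> N" unfolding N_def using T\<delta> by (auto simp: of_nat_nat)
    then have "N * \<delta> \<le> T" using \<delta> by (simp add: field_simps)
    then have p: "hole_prob M B T R \<le> C * \<kappa> ^ N" using hole_S S_le order_trans by blast
    show ?case
    proof (cases "hole_prob M B T R = 0")
      case True
      then show ?thesis using elim by (simp add: log_prob_def)
    next
      case False
      moreover have "0 \<le> hole_prob M B T R" by (simp add: hole_prob_def)
      ultimately have pos: "0 < hole_prob M B T R" by simp
      have "ln (hole_prob M B T R) \<le> ln (C * \<kappa> ^ N)"
        using p pos C1 \<kappa> by (subst ln_le_cancel_iff) auto
      also have "\<dots> = ln C + N * ln \<kappa>" using C1 \<kappa> by (simp add: ln_mult ln_realpow)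
      also have "\<dots> \<le> ln C + (T / \<delta> - 1) * ln \<kappa>"
        using N(2) \<kappa> by (intro add_left_mono mult_right_mono_neg) auto
      also have "\<dots> = K + T * (ln \<kappa> / \<delta>)" by (simp add: K_def algebra_simps)
      finally have "ln (hole_prob M B T R) / T \<le> (K + T * (ln \<kappa> / \<delta>)) / T"
        using elim by (intro divide_right_mono) auto
      also have "\<dots> = K / T + ln \<kappa> / \<delta>" using elim by (simp add: add_divide_distrib)
      finally show ?thesis using False by (simp add: log_prob_def)
    qed
  qed
  have "((\<lambda>T. K / T + ln \<kappa> / \<delta>) \<longlongrightarrow> ln \<kappa> / \<delta>) at_top" by real_asymp
  then have "((\<lambda>T. ereal (K / T + ln \<kappa> / \<delta>)) \<longlongrightarrow> ereal (ln \<kappa> / \<delta>)) at_top" by simp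
  then have "Limsup at_top (\<lambda>T. ereal (K / T + ln \<kappa> / \<delta>)) = ereal (ln \<kappa> / \<delta>)"
    by (intro lim_imp_Limsup) auto
  then show ?thesis using Limsup_mono[OF ev] by simp
qed

section \<open>Inverse moments and means\<close>

lemma indep_vars_PiM_coordinates:
  assumes "I \<noteq> {}"
  shows "prob_space.indep_vars (PiM I (\<lambda>_. std_normal)) (\<lambda>_. borel) (\<lambda>i g. g i) I"
proof -
  let ?P = "PiM I (\<lambda>_. std_normal)"
  interpret prob_space ?P by (intro prob_space_PiM prob_space_std_normal)
  have rv: "(\<lambda>g. g i) \<in> borel_measurable ?P" if "i \<in> I" for i
  proof -
    have "(\<lambda>g. g i) \<in> ?P \<rightarrow>\<^sub>M std_normal" using that by (rule measurable_component_singleton)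
    then show ?thesis by (simp cong: measurable_cong_sets)
  qed
  have comp: "distr ?P borel (\<lambda>g. g i) = std_normal" if "i \<in> I" for i
    using distr_PiM_component[of I "\<lambda>_. std_normal" i, OF prob_space_std_normal that]
    by (simp cong: distr_cong)
  have "distr ?P (PiM I (\<lambda>_. borel)) (\<lambda>g. \<lambda>i\<in>I. g i) = distr ?P ?P (\<lambda>g. g)"
    by (intro distr_cong refl sets_PiM_cong) (auto simp: space_PiM restrict_def PiE_def extensional_def)
  also have "\<dots> = ?P" by (rule distr_id)
  also have "\<dots> = PiM I (\<lambda>i. distr ?P borel (\<lambda>g. g i))"
    using comp by (intro PiM_cong) auto
  finally show ?thesis
    by (subst indep_vars_iff_distr_eq_PiM'[OF assms rv]) auto
qed

lemma distr_std_component: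
  assumes "i \<in> I"
  shows "distr (PiM I (\<lambda>_. std_normal)) borel (\<lambda>g. g i) = std_normal"
    using distr_PiM_component[of I "\<lambda>_. std_normal" i, OF prob_space_std_normal assms]
    by (simp cong: distr_cong)

lemma inverse_dyadic_bound:
  fixes r :: real
  assumes "0 \<le> r"
  shows "ennreal (1 / r) \<le> 1 + (\<Sum>k. ennreal (2 * 2 ^ k) * (if r < (1 / 2) ^ k then 1 else 0))"
proof (cases "r = 0 \<or> 1 \<le> r")
  case True
  then have "1 / r \<le> 1" by (auto simp: divide_simps)
  then have "ennreal (1 / r) \<le> 1" by (simp add: ennreal_le_1)
  then show ?thesis by (rule order_trans) simp
next
  case False
  then have r: "0 < r" "r < 1" using assms by auto
  obtain m :: nat where m: "(1 / 2) ^ m < r" using real_arch_pow_inv[OF r(1), of "1 / 2"] by auto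
  define k where "k = (LEAST m :: nat. (1 / 2) ^ m \<le> r)"
  have k: "(1 / 2) ^ k \<le> r" unfolding k_def using less_imp_le[OF m] by (rule LeastI)
  have "k \<noteq> 0" using k r by (cases k) auto
  then obtain l where l: "k = Suc l" using not0_implies_Suc by blast
  have "\<not> (1 / 2) ^ l \<le> r" using not_less_Least[of l "\<lambda>m. (1 / 2) ^ m \<le> r"] l unfolding k_def by simp
  then have rl: "r < (1 / 2) ^ l" by simp
  have "1 / r \<le> 1 / (1 / 2) ^ k" using k r by (intro divide_left_mono) auto
  also have "\<dots> = 2 * 2 ^ l" by (simp add: l power_one_over)
  finally have "ennreal (1 / r) \<le> ennreal (2 * 2 ^ l) * (if r < (1 / 2) ^ l then 1 else 0)" using rl by (simp add: ennreal_leI)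
  also have "\<dots> \<le> (\<Sum>k. ennreal (2 * 2 ^ k) * (if r < (1 / 2) ^ k then 1 else 0))"
    using sum_le_suminf[of "\<lambda>k. ennreal (2 * 2 ^ k) * (if r < (1 / 2) ^ k then 1 else 0)" "{l}"] by simp
  finally show ?thesis by (rule order_trans) simp
qed

lemma (in prob_space) inverse_normal_moment:
  assumes ind: "indep_var borel X borel Y"
    and dX: "distr M borel X = std_normal" and dY: "distr M borel Y = std_normal" and w: "w \<noteq> 0"
  shows "(\<integral>\<^sup>+\<omega>. ennreal (1 / cmod (u + w * Complex (X \<omega>) (Y \<omega>))) \<partial>M) \<le> ennreal (17 / cmod w)"
proof -
  have [measurable]: "X \<in> borel_measurable M" "Y \<in> borel_measurable M"
    using ind by (auto dest: indep_var_rv1 indep_var_rv2)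
  define v where "v = u / w"
  define r where "r \<omega> = cmod (v + Complex (X \<omega>) (Y \<omega>))" for \<omega>
  have r_alt: "r \<omega> = sqrt ((Re v + X \<omega>)\<^sup>2 + (Im v + Y \<omega>)\<^sup>2)" for \<omega> by (simp add: r_def cmod_def)
  have [measurable]: "r \<in> borel_measurable M" unfolding r_alt[abs_def] by measurable
  have tail: "emeasure M {\<omega>\<in>space M. r \<omega> < s} \<le> ennreal (4 * s\<^sup>2)" if s: "0 < s" for s
  proof -
    let ?A = "{- Re v - s..- Re v + s}" and ?B = "{- Im v - s..- Im v + s}"
    have iv: "measure std_normal {a - s..a + s} \<le> 2 * s" for a using std_normal_interval_le[of "a - s" "a + s"] s by simp
    have "prob (X -` ?A \<inter> space M) \<le> 2 * s"
      using iv[of "- Re v"] unfolding dX[symmetric] by (simp add: measure_distr)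
    moreover have "prob (Y -` ?B \<inter> space M) \<le> 2 * s"
      using iv[of "- Im v"] unfolding dY[symmetric] by (simp add: measure_distr)
    ultimately have p: "prob (X -` ?A \<inter> space M) \<le> 2 * s" "prob (Y -` ?B \<inter> space M) \<le> 2 * s" .
    have "prob {\<omega>\<in>space M. r \<omega> < s} \<le> prob ((\<lambda>\<omega>. (X \<omega>, Y \<omega>)) -` (?A \<times> ?B) \<inter> space M)"
    proof (rule finite_measure_mono)
      show "{\<omega>\<in>space M. r \<omega> < s} \<subseteq> (\<lambda>\<omega>. (X \<omega>, Y \<omega>)) -` (?A \<times> ?B) \<inter> space M"
      proof
        fix \<omega> assume *: "\<omega> \<in> {\<omega>\<in>space M. r \<omega> < s}"
        then have "\<bar>Re v + X \<omega>\<bar> < s" "\<bar>Im v + Y \<omega>\<bar> < s"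
          using abs_Re_le_cmod[of "v + Complex (X \<omega>) (Y \<omega>)"] abs_Im_le_cmod[of "v + Complex (X \<omega>) (Y \<omega>)"] by (auto simp: r_def)
        then show "\<omega> \<in> (\<lambda>\<omega>. (X \<omega>, Y \<omega>)) -` (?A \<times> ?B) \<inter> space M" using * by auto
      qed
      have "(\<lambda>\<omega>. (X \<omega>, Y \<omega>)) -` (?A \<times> ?B) \<inter> space M = {\<omega>\<in>space M. X \<omega> \<in> ?A \<and> Y \<omega> \<in> ?B}" by auto
      then show "(\<lambda>\<omega>. (X \<omega>, Y \<omega>)) -` (?A \<times> ?B) \<inter> space M \<in> events" by simp
    qed
    also have "\<dots> = prob (X -` ?A \<inter> space M) * prob (Y -` ?B \<inter> space M)"
      by (rule indep_varD[OF ind]) auto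
    also have "\<dots> \<le> (2 * s) * (2 * s)" using p s by (intro mult_mono) auto
    finally show ?thesis by (simp add: emeasure_eq_measure power2_eq_square ennreal_leI)
  qed
  have "(\<integral>\<^sup>+\<omega>. ennreal (1 / r \<omega>) \<partial>M) \<le> (\<integral>\<^sup>+\<omega>. 1 + (\<Sum>k. ennreal (2 * 2 ^ k) * indicator {\<omega>\<in>space M. r \<omega> < (1 / 2) ^ k} \<omega>) \<partial>M)"
  proof (rule nn_integral_mono)
    fix \<omega> assume w: "\<omega> \<in> space M"
    have "0 \<le> r \<omega>" by (simp add: r_def)
    from inverse_dyadic_bound[OF this]
    show "ennreal (1 / r \<omega>) \<le> 1 + (\<Sum>k. ennreal (2 * 2 ^ k) * indicator {\<omega>\<in>space M. r \<omega> < (1 / 2) ^ k} \<omega>)"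
      using w by (simp add: indicator_def of_bool_def)
  qed
  also have "\<dots> = 1 + (\<Sum>k. ennreal (2 * 2 ^ k) * emeasure M {\<omega>\<in>space M. r \<omega> < (1 / 2) ^ k})"
    by (subst nn_integral_add) (auto simp: nn_integral_suminf nn_integral_cmult emeasure_space_1)
  also have "\<dots> \<le> 1 + (\<Sum>k. ennreal (8 * (1 / 2) ^ k))"
  proof (intro add_left_mono suminf_le allI)
    fix k
    have "ennreal (2 * 2 ^ k) * emeasure M {\<omega>\<in>space M. r \<omega> < (1 / 2) ^ k} \<le> ennreal (2 * 2 ^ k) * ennreal (4 * ((1 / 2) ^ k)\<^sup>2)"
      by (intro mult_left_mono tail) auto
    also have "\<dots> = ennreal (8 * (1 / 2) ^ k)"
      by (simp add: ennreal_mult'[symmetric] power_one_over power2_eq_square field_simps)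
    finally show "ennreal (2 * 2 ^ k) * emeasure M {\<omega>\<in>space M. r \<omega> < (1 / 2) ^ k} \<le> ennreal (8 * (1 / 2) ^ k)" .
  qed auto
  also have "(\<Sum>k. ennreal (8 * (1 / 2) ^ k)) = ennreal 16"
  proof (rule suminf_ennreal_eq)
    show "(\<lambda>k. 8 * (1 / 2) ^ k) sums (16::real)"
      using sums_mult[OF geometric_sums[of "1/2 :: real"], of 8] by simp
  qed auto
  also have "1 + ennreal 16 = ennreal 17" by (subst ennreal_1[symmetric], subst ennreal_plus[symmetric]) auto
  finally have main: "(\<integral>\<^sup>+\<omega>. ennreal (1 / r \<omega>) \<partial>M) \<le> ennreal 17" .
  have e: "1 / cmod (u + w * Complex (X \<omega>) (Y \<omega>)) = (1 / cmod w) * (1 / r \<omega>)" for \<omega>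
  proof -
    have "u + w * Complex (X \<omega>) (Y \<omega>) = w * (v + Complex (X \<omega>) (Y \<omega>))"
      using w by (simp add: v_def distrib_left)
    then show ?thesis unfolding r_def by (simp add: norm_mult)
  qed
  have "(\<integral>\<^sup>+\<omega>. ennreal (1 / cmod (u + w * Complex (X \<omega>) (Y \<omega>))) \<partial>M) = (\<integral>\<^sup>+\<omega>. ennreal (1 / cmod w) * ennreal (1 / r \<omega>) \<partial>M)"
    unfolding e by (intro nn_integral_cong ennreal_mult') simp
  also have "\<dots> = ennreal (1 / cmod w) * (\<integral>\<^sup>+\<omega>. ennreal (1 / r \<omega>) \<partial>M)"
    by (intro nn_integral_cmult) measurable
  also have "\<dots> \<le> ennreal (1 / cmod w) * ennreal 17" by (intro mult_left_mono main) auto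
  also have "\<dots> = ennreal (1 / cmod w * 17)" by (intro ennreal_mult'[symmetric]) simp
  finally show ?thesis by simp
qed

lemma gaf_law_indep_coordinates:
  assumes "i \<in> gaf_index" "j \<in> gaf_index" "i \<noteq> j"
  shows "prob_space.indep_var gaf_law borel (\<lambda>g. g i) borel (\<lambda>g. g j)"
proof -
  interpret prob_space gaf_law by (rule prob_space_gaf_law)
  have coords: "indep_vars (\<lambda>_. borel) (\<lambda>i g. g i) gaf_index" by (rule indep_vars_PiM_coordinates) auto
  have "indep_var (PiM {i} (\<lambda>_. borel)) (\<lambda>g. restrict (\<lambda>i. g i) {i}) (PiM {j} (\<lambda>_. borel)) (\<lambda>g. restrict (\<lambda>i. g i) {j})"
    by (rule indep_var_restrict[OF coords]) (use assms in auto)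
  from indep_var_compose[OF this, of "\<lambda>x. x i" borel "\<lambda>x. x j" borel]
  show ?thesis by (simp add: comp_def measurable_component_singleton)
qed

lemma gaf_law_resample:
  assumes k[measurable]: "k \<in> borel_measurable gaf_space" and U[measurable]: "U \<in> borel_measurable gaf_space" and w: "w \<noteq> 0"
    and k_cong: "\<And>g g'. (\<And>i. i \<in> gaf_index \<Longrightarrow> fst i \<noteq> N \<Longrightarrow> g i = g' i) \<Longrightarrow> k g = k g'"
    and U_cong: "\<And>g g'. (\<And>i. i \<in> gaf_index \<Longrightarrow> fst i \<noteq> N \<Longrightarrow> g i = g' i) \<Longrightarrow> U g = U g'"
  shows "(\<integral>\<^sup>+g. k g * ennreal (1 / cmod (U g + w * Complex (g (N, 1)) (g (N, 2)))) \<partial>gaf_law) \<le> ennreal (17 / cmod w) * (\<integral>\<^sup>+g. k g \<partial>gaf_law)"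
proof -
  interpret prob_space gaf_law by (rule prob_space_gaf_law)
  let ?A = "{N} \<times> {1, 2} :: (nat \<times> nat) set"
  let ?C = "gaf_index - ?A"
  let ?SA = "PiM ?A (\<lambda>_. borel) :: (nat \<times> nat \<Rightarrow> real) measure" and ?SC = "PiM ?C (\<lambda>_. borel) :: (nat \<times> nat \<Rightarrow> real) measure"
  have coords: "indep_vars (\<lambda>_. borel) (\<lambda>i g. g i) gaf_index" by (rule indep_vars_PiM_coordinates) auto
  have ind: "indep_var ?SC (\<lambda>g. restrict (\<lambda>i. g i) ?C) ?SA (\<lambda>g. restrict (\<lambda>i. g i) ?A)"
    by (rule indep_var_restrict[OF coords]) auto
  have rC: "(\<lambda>g. restrict (\<lambda>i. g i) ?C) \<in> gaf_law \<rightarrow>\<^sub>M ?SC" using ind by (rule indep_var_rv1)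
  have rA: "(\<lambda>g. restrict (\<lambda>i. g i) ?A) \<in> gaf_law \<rightarrow>\<^sub>M ?SA" using ind by (rule indep_var_rv2)
  define ext where "ext x = (\<lambda>i\<in>gaf_index. if i \<in> ?A then 0 else x i)" for x :: "nat \<times> nat \<Rightarrow> real"
  have ext[measurable]: "ext \<in> ?SC \<rightarrow>\<^sub>M gaf_space"
    unfolding ext_def
  proof (rule measurable_restrict)
    fix i assume i: "i \<in> gaf_index"
    show "(\<lambda>x. if i \<in> ?A then 0 else x i) \<in> borel_measurable ?SC"
      using i by (cases "i \<in> ?A") (simp_all add: measurable_component_singleton)
  qed
  have kx: "k (ext (restrict (\<lambda>i. g i) ?C)) = k g" for g by (rule k_cong) (auto simp: ext_def)
  have Ux: "U (ext (restrict (\<lambda>i. g i) ?C)) = U g" for g by (rule U_cong) (auto simp: ext_def)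
  define f where "f = (\<lambda>(x, a :: nat \<times> nat \<Rightarrow> real). k (ext x) * ennreal (1 / cmod (U (ext x) + w * Complex (a (N, 1)) (a (N, 2)))))"
  have [measurable]: "(\<lambda>a. a (N, 1)) \<in> borel_measurable ?SA" "(\<lambda>a. a (N, 2)) \<in> borel_measurable ?SA"
    by (auto intro!: measurable_component_singleton)
  have Cx: "Complex = (\<lambda>x y. complex_of_real x + \<i> * complex_of_real y)" by (auto simp: fun_eq_iff complex_eq_iff)
  have f_meas: "f \<in> borel_measurable (?SC \<Otimes>\<^sub>M ?SA)" unfolding f_def Cx by measurable
  have inner: "(\<integral>\<^sup>+a. f (x, a) \<partial>distr gaf_law ?SA (\<lambda>g. restrict (\<lambda>i. g i) ?A)) \<le> k (ext x) * ennreal (17 / cmod w)" if "x \<in> space ?SC" for x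
  proof -
    have fx: "(\<lambda>a. ennreal (1 / cmod (U (ext x) + w * Complex (a (N, 1)) (a (N, 2))))) \<in> borel_measurable ?SA"
      unfolding Cx by measurable
    have i2: "indep_var borel (\<lambda>g. g (N, 1)) borel (\<lambda>g. g (N, 2) :: real)"
      by (rule gaf_law_indep_coordinates) auto
    have e: "(\<integral>\<^sup>+a. f (x, a) \<partial>distr gaf_law ?SA (\<lambda>g. restrict (\<lambda>i. g i) ?A)) =
        k (ext x) * (\<integral>\<^sup>+a. ennreal (1 / cmod (U (ext x) + w * Complex (a (N, 1)) (a (N, 2)))) \<partial>distr gaf_law ?SA (\<lambda>g. restrict (\<lambda>i. g i) ?A))"
      unfolding f_def case_prod_conv using fx by (intro nn_integral_cmult) simp
    have "(\<integral>\<^sup>+a. ennreal (1 / cmod (U (ext x) + w * Complex (a (N, 1)) (a (N, 2)))) \<partial>distr gaf_law ?SA (\<lambda>g. restrict (\<lambda>i. g i) ?A)) =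
        (\<integral>\<^sup>+g. ennreal (1 / cmod (U (ext x) + w * Complex (g (N, 1)) (g (N, 2)))) \<partial>gaf_law)"
      by (subst nn_integral_distr[OF rA]) (use fx in auto)
    also have "\<dots> \<le> ennreal (17 / cmod w)"
      by (rule inverse_normal_moment[OF i2 _ _ w]) (auto intro: distr_std_component)
    finally show ?thesis unfolding e by (intro mult_left_mono) simp_all
  qed
  have kC: "(\<lambda>x. k (ext x)) \<in> borel_measurable ?SC" by measurable
  have "(\<integral>\<^sup>+g. k g * ennreal (1 / cmod (U g + w * Complex (g (N, 1)) (g (N, 2)))) \<partial>gaf_law) =
     (\<integral>\<^sup>+g. f (restrict (\<lambda>i. g i) ?C, restrict (\<lambda>i. g i) ?A) \<partial>gaf_law)"
    unfolding f_def case_prod_conv kx Ux by simp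
  also have "\<dots> = (\<integral>\<^sup>+x. \<integral>\<^sup>+a. f (x, a) \<partial>distr gaf_law ?SA (\<lambda>g. restrict (\<lambda>i. g i) ?A) \<partial>distr gaf_law ?SC (\<lambda>g. restrict (\<lambda>i. g i) ?C))"
    by (rule nn_integral_indep_var[OF prob_space_axioms ind f_meas])
  also have "\<dots> \<le> (\<integral>\<^sup>+x. k (ext x) * ennreal (17 / cmod w) \<partial>distr gaf_law ?SC (\<lambda>g. restrict (\<lambda>i. g i) ?C))"
    by (intro nn_integral_mono inner) simp
  also have "\<dots> = (\<integral>\<^sup>+g. k (ext (restrict (\<lambda>i. g i) ?C)) * ennreal (17 / cmod w) \<partial>gaf_law)"
    using kC by (subst nn_integral_distr[OF rC]) auto
  also have "\<dots> = ennreal (17 / cmod w) * (\<integral>\<^sup>+g. k g \<partial>gaf_law)"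
    unfolding kx using k by (subst nn_integral_multc) (auto simp: mult.commute measurable_cong_sets[OF sets_gaf_law refl])
  finally show ?thesis .
qed

lemma gaussian_exp_square:
  fixes \<rho> \<sigma> \<mu> x :: real
  assumes c: "0 < 1 - 2 * \<mu> * \<sigma>\<^sup>2"
  defines "c \<equiv> 1 - 2 * \<mu> * \<sigma>\<^sup>2"
  shows "(\<integral>\<^sup>+n. ennreal (exp (\<mu> * (\<rho> * x + \<sigma> * n)\<^sup>2)) \<partial>std_normal) = ennreal (1 / sqrt c * exp (\<mu> * \<rho>\<^sup>2 / c * x\<^sup>2))"
proof -
  define m where "m = 2 * \<mu> * \<rho> * \<sigma> * x / c"
  define K where "K = 1 / sqrt c * exp (\<mu> * \<rho>\<^sup>2 / c * x\<^sup>2)"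
  have c0: "0 < c" using c by (simp add: c_def)
  have pt: "std_normal_density n * exp (\<mu> * (\<rho> * x + \<sigma> * n)\<^sup>2) = K * normal_density m (1 / sqrt c) n" for n
  proof -
    have "c * (n - m)\<^sup>2 = c * n\<^sup>2 - 2 * (c * m) * n + (c * m)\<^sup>2 / c"
      using c0 by (simp add: power2_eq_square field_simps)
    also have "c * m = 2 * \<mu> * \<rho> * \<sigma> * x" using c0 by (simp add: m_def)
    finally have 1: "c * (n - m)\<^sup>2 = c * n\<^sup>2 - 4 * \<mu> * \<rho> * \<sigma> * x * n + 4 * \<mu>\<^sup>2 * \<rho>\<^sup>2 * \<sigma>\<^sup>2 * x\<^sup>2 / c"
      by (simp add: power_mult_distrib)
    have 2: "\<mu> * \<rho>\<^sup>2 / c * x\<^sup>2 = \<mu> * \<rho>\<^sup>2 * x\<^sup>2 + 2 * \<mu>\<^sup>2 * \<rho>\<^sup>2 * \<sigma>\<^sup>2 * x\<^sup>2 / c"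
    proof -
      have "\<mu> * \<rho>\<^sup>2 * x\<^sup>2 * (c + 2 * \<mu> * \<sigma>\<^sup>2) = \<mu> * \<rho>\<^sup>2 * x\<^sup>2" by (simp add: c_def)
      then show ?thesis using c0 by (simp add: field_simps power2_eq_square)
    qed
    have ex: "- n\<^sup>2 / 2 + \<mu> * (\<rho> * x + \<sigma> * n)\<^sup>2 = \<mu> * \<rho>\<^sup>2 / c * x\<^sup>2 - c * (n - m)\<^sup>2 / 2"
      unfolding 1 2 by (simp add: c_def power2_sum power_mult_distrib field_simps)
    have "std_normal_density n * exp (\<mu> * (\<rho> * x + \<sigma> * n)\<^sup>2) = 1 / sqrt (2 * pi) * exp (- n\<^sup>2 / 2 + \<mu> * (\<rho> * x + \<sigma> * n)\<^sup>2)"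
      by (simp add: std_normal_density_def mult_exp_exp)
    also have "\<dots> = K * normal_density m (1 / sqrt c) n"
      unfolding ex K_def normal_density_def exp_diff
      using c0 by (simp add: power_divide real_sqrt_divide real_sqrt_mult exp_minus field_simps)
    finally show ?thesis .
  qed
  have "(\<integral>\<^sup>+n. ennreal (exp (\<mu> * (\<rho> * x + \<sigma> * n)\<^sup>2)) \<partial>std_normal) = (\<integral>\<^sup>+n. ennreal (std_normal_density n) * ennreal (exp (\<mu> * (\<rho> * x + \<sigma> * n)\<^sup>2)) \<partial>lborel)"
    by (subst nn_integral_density) auto
  also have "\<dots> = (\<integral>\<^sup>+n. ennreal K * ennreal (normal_density m (1 / sqrt c) n) \<partial>lborel)"
    using c0 by (simp add: ennreal_mult'[symmetric] pt K_def)
  also have "\<dots> = ennreal K * (\<integral>\<^sup>+n. ennreal (normal_density m (1 / sqrt c) n) \<partial>lborel)"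
    by (rule nn_integral_cmult) auto
  also have "(\<integral>\<^sup>+n. ennreal (normal_density m (1 / sqrt c) n) \<partial>lborel) = 1"
    using c0 by (subst nn_integral_eq_integral) auto
  finally show ?thesis by (simp add: K_def)
qed

lemma gaf_law_exp_square:
  fixes \<rho> \<sigma> \<mu> :: real
  assumes c: "0 < 1 - 2 * \<mu> * \<sigma>\<^sup>2"
  defines "c \<equiv> 1 - 2 * \<mu> * \<sigma>\<^sup>2"
  shows "(\<integral>\<^sup>+g. ennreal (exp (\<mu> * ((\<rho> * y1 + \<sigma> * g (n, 1))\<^sup>2 + (\<rho> * y2 + \<sigma> * g (n, 2))\<^sup>2))) \<partial>gaf_law) =
    ennreal (1 / c * exp (\<mu> * \<rho>\<^sup>2 / c * (y1\<^sup>2 + y2\<^sup>2)))"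
proof -
  let ?e = "\<lambda>y x. ennreal (exp (\<mu> * (\<rho> * y + \<sigma> * x)\<^sup>2))"
  define f :: "real \<times> real \<Rightarrow> ennreal" where "f = (\<lambda>(a, b). ?e y1 a * ?e y2 b)"
  have c0: "0 < c" using c by (simp add: c_def)
  have ind: "prob_space.indep_var gaf_law borel (\<lambda>g. g (n, 1)) borel (\<lambda>g. g (n, 2))"
    by (rule gaf_law_indep_coordinates) auto
  have f: "f \<in> borel_measurable (borel \<Otimes>\<^sub>M borel)" unfolding f_def by measurable
  have "(\<integral>\<^sup>+g. ennreal (exp (\<mu> * ((\<rho> * y1 + \<sigma> * g (n, 1))\<^sup>2 + (\<rho> * y2 + \<sigma> * g (n, 2))\<^sup>2))) \<partial>gaf_law) = (\<integral>\<^sup>+g. f (g (n, 1), g (n, 2)) \<partial>gaf_law)"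
    by (simp add: f_def ennreal_mult'[symmetric] exp_add[symmetric] distrib_left)
  also have "\<dots> = (\<integral>\<^sup>+a. \<integral>\<^sup>+b. f (a, b) \<partial>std_normal \<partial>std_normal)"
    using nn_integral_indep_var[OF prob_space_gaf_law ind f]
    by (simp add: distr_std_component)
  also have "\<dots> = (\<integral>\<^sup>+a. ?e y1 a \<partial>std_normal) * (\<integral>\<^sup>+b. ?e y2 b \<partial>std_normal)"
    unfolding f_def case_prod_conv by (simp add: nn_integral_cmult nn_integral_multc)
  also have "\<dots> = ennreal (1 / sqrt c * exp (\<mu> * \<rho>\<^sup>2 / c * y1\<^sup>2)) * ennreal (1 / sqrt c * exp (\<mu> * \<rho>\<^sup>2 / c * y2\<^sup>2))"
    using c unfolding c_def by (simp only: gaussian_exp_square)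
  also have "\<dots> = ennreal ((1 / sqrt c * exp (\<mu> * \<rho>\<^sup>2 / c * y1\<^sup>2)) * (1 / sqrt c * exp (\<mu> * \<rho>\<^sup>2 / c * y2\<^sup>2)))"
    using c0 by (intro ennreal_mult'[symmetric]) simp
  also have "(1 / sqrt c * exp (\<mu> * \<rho>\<^sup>2 / c * y1\<^sup>2)) * (1 / sqrt c * exp (\<mu> * \<rho>\<^sup>2 / c * y2\<^sup>2)) =
      1 / (sqrt c * sqrt c) * (exp (\<mu> * \<rho>\<^sup>2 / c * y1\<^sup>2) * exp (\<mu> * \<rho>\<^sup>2 / c * y2\<^sup>2))" by simp
  also have "\<dots> = 1 / c * exp (\<mu> * \<rho>\<^sup>2 / c * (y1\<^sup>2 + y2\<^sup>2))"
    using c0 by (simp only: exp_add[symmetric] distrib_left real_sqrt_mult_self abs_of_pos)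
  finally show ?thesis .
qed

lemma inverse_holomorphic_mean:
  assumes f: "f holomorphic_on ball 0 r" "continuous_on (cball 0 r) f" and nz: "\<And>z. z \<in> cball 0 r \<Longrightarrow> f z \<noteq> 0" and r: "0 < r"
  shows "ennreal (1 / cmod (f 0)) \<le>
    (\<integral>\<^sup>+x. ennreal (1 / cmod (f (r * exp (2 * of_real pi * \<i> * of_real x)))) * indicator {0..1::real} x \<partial>lborel)"
proof -
  define h where "h z = 1 / f z" for z
  define \<gamma> where "\<gamma> x = complex_of_real r * exp (2 * of_real pi * \<i> * of_real x)" for x :: real
  have \<gamma>: "\<gamma> x \<in> cball 0 r" for x
    using r by (simp add: \<gamma>_def norm_mult)
  have \<gamma>0: "\<gamma> x \<noteq> 0" for x using r by (simp add: \<gamma>_def)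
  have "h holomorphic_on ball 0 r" unfolding h_def using f(1) nz by (intro holomorphic_intros) auto
  moreover have hc: "continuous_on (cball 0 r) h" unfolding h_def using f(2) nz by (intro continuous_intros) auto
  ultimately have "((\<lambda>u. h u / (u - 0)) has_contour_integral (2 * of_real pi * \<i> * h 0)) (circlepath 0 r)"
    using r by (intro Cauchy_integral_circlepath) auto
  then have "((\<lambda>x. h (\<gamma> x) / \<gamma> x * (2 * of_real pi * \<i> * r * exp (2 * of_real pi * \<i> * x))) has_integral 2 * of_real pi * \<i> * h 0) {0..1}"
    unfolding has_contour_integral_def
    by (rule has_integral_eq[rotated]) (simp add: vector_derivative_circlepath01, simp add: circlepath \<gamma>_def)
  then have "((\<lambda>x. 2 * of_real pi * \<i> * h (\<gamma> x)) has_integral 2 * of_real pi * \<i> * h 0) {0..1}"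
    by (rule has_integral_eq[rotated]) (use \<gamma>0 in \<open>simp add: \<gamma>_def field_simps\<close>)
  from has_integral_mult_right[OF this, of "1 / (2 * of_real pi * \<i>)"]
  have int: "((\<lambda>x. h (\<gamma> x)) has_integral h 0) {0..1}" by simp
  have cont: "continuous_on {0..1} (\<lambda>x. cmod (h (\<gamma> x)))"
    by (intro continuous_intros continuous_on_compose2[OF hc]) (use \<gamma> in \<open>auto simp: \<gamma>_def intro!: continuous_intros\<close>)
  have "cmod (h 0) = cmod (integral {0..1} (\<lambda>x. h (\<gamma> x)))" using int by (simp add: integral_unique)
  also have "\<dots> \<le> integral {0..1} (\<lambda>x. cmod (h (\<gamma> x)))"
    by (intro integral_norm_bound_integral integrable_continuous_real cont has_integral_integrable[OF int]) auto
  finally have le: "cmod (h 0) \<le> integral {0..1} (\<lambda>x. cmod (h (\<gamma> x)))" .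
  have si: "set_integrable lborel {0..1} (\<lambda>x. cmod (h (\<gamma> x)))"
    using cont by (rule borel_integrable_atLeastAtMost')
  have "ennreal (integral {0..1} (\<lambda>x. cmod (h (\<gamma> x)))) = ennreal (set_lebesgue_integral lborel {0..1} (\<lambda>x. cmod (h (\<gamma> x))))"
    using set_borel_integral_eq_integral(2)[OF si] by simp
  also have "\<dots> = (\<integral>\<^sup>+x. ennreal (indicator {0..1} x *\<^sub>R cmod (h (\<gamma> x))) \<partial>lborel)"
    unfolding set_lebesgue_integral_def using si unfolding set_integrable_def
    by (intro nn_integral_eq_integral[symmetric]) auto
  also have "\<dots> = (\<integral>\<^sup>+x. ennreal (1 / cmod (f (\<gamma> x))) * indicator {0..1::real} x \<partial>lborel)"
    by (intro nn_integral_cong) (simp add: h_def norm_divide indicator_def)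
  finally show ?thesis
    using ennreal_leI[OF le] by (simp add: h_def norm_divide \<gamma>_def)
qed

lemma gaf_series_uniform:
  assumes "summable (\<lambda>n. cmod (c n) * (R ^ n / sqrt (fact n)))"
  shows "uniform_limit (cball 0 R) (\<lambda>N z. \<Sum>n<N. c n * (z ^ n / complex_of_real (sqrt (fact n))))
    (\<lambda>z. \<Sum>n. c n * (z ^ n / complex_of_real (sqrt (fact n)))) sequentially"
proof (rule Weierstrass_m_test[OF _ assms])
  fix n and z :: complex assume "z \<in> cball 0 R"
  then have "cmod (c n) * (cmod z ^ n / sqrt (fact n)) \<le> cmod (c n) * (R ^ n / sqrt (fact n))"
    by (intro mult_left_mono divide_right_mono power_mono) auto
  then show "cmod (c n * (z ^ n / complex_of_real (sqrt (fact n)))) \<le> cmod (c n) * (R ^ n / sqrt (fact n))"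
    by (simp add: norm_mult norm_divide norm_power)
qed

lemma gaf_series:
  assumes "summable (\<lambda>n. cmod (c n) * (R ^ n / sqrt (fact n)))"
  defines "F \<equiv> \<lambda>z. \<Sum>n. c n * (z ^ n / complex_of_real (sqrt (fact n)))"
  shows "z \<in> cball 0 R \<Longrightarrow> (\<lambda>n. c n * (z ^ n / complex_of_real (sqrt (fact n)))) sums F z"
    and "continuous_on (cball 0 R) F" and "F holomorphic_on ball 0 R"
proof -
  note u = gaf_series_uniform[OF assms(1)]
  show sums: "z \<in> cball 0 R \<Longrightarrow> (\<lambda>n. c n * (z ^ n / complex_of_real (sqrt (fact n)))) sums F z" for z
    using tendsto_uniform_limitI[OF u] unfolding sums_def F_def by simp
  show "continuous_on (cball 0 R) F"
    unfolding F_def by (rule uniform_limit_theorem[OF _ u]) (auto intro!: always_eventually continuous_intros)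
  show "F holomorphic_on ball 0 R"
  proof (rule power_series_holomorphic[where a="\<lambda>n. c n / complex_of_real (sqrt (fact n))"])
    fix w :: complex assume "w \<in> ball 0 R"
    then show "(\<lambda>n. c n / complex_of_real (sqrt (fact n)) * (w - 0) ^ n) sums F w"
      using sums[of w] by simp
  qed
qed

lemma le_exp_half_square: "t \<le> exp (t\<^sup>2 / 2)" for t :: real
proof -
  have "0 \<le> (t - 1)\<^sup>2" by simp
  then have "t \<le> 1 + t\<^sup>2 / 2" by (simp add: power2_diff)
  also have "\<dots> \<le> exp (t\<^sup>2 / 2)" by (rule exp_ge_add_one_self)
  finally show ?thesis .
qed

lemma gaf_coeff_measurable_PiM:
  assumes "(n, 1) \<in> J" "(n, 2) \<in> J"
  shows "(\<lambda>y. gaf_coeff y n) \<in> borel_measurable (PiM J (\<lambda>_. borel))"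
proof -
  have [measurable]: "(\<lambda>y. y (n, 1)) \<in> borel_measurable (PiM J (\<lambda>_. borel :: real measure))"
    "(\<lambda>y. y (n, 2)) \<in> borel_measurable (PiM J (\<lambda>_. borel :: real measure))"
    using assms by (auto intro!: measurable_component_singleton)
  have e: "gaf_coeff y n = complex_of_real (y (n, 1) / sqrt 2) + \<i> * complex_of_real (y (n, 2) / sqrt 2)" for y
    by (simp add: gaf_coeff_def complex_eq_iff)
  show ?thesis unfolding e by measurable
qed

lemma gaf_coeff_measurable[measurable]: "(\<lambda>y. gaf_coeff y n) \<in> borel_measurable gaf_space"
  by (rule gaf_coeff_measurable_PiM) auto

lemma gaf_coeff_step:
  "gaf_coeff (ar_step \<rho> \<sigma> gaf_index y g) n = \<rho> * gaf_coeff y n + \<sigma> * gaf_coeff g n"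
  by (simp add: gaf_coeff_def ar_step_def complex_eq_iff add_divide_distrib)

lemma gaf_coeff_norm: "(cmod (gaf_coeff y n))\<^sup>2 = ((y (n, 1))\<^sup>2 + (y (n, 2))\<^sup>2) / 2"
  by (simp add: gaf_coeff_def cmod_power2 power_divide add_divide_distrib)

definition gaf_skip :: "nat \<Rightarrow> (nat \<times> nat \<Rightarrow> real) \<Rightarrow> complex \<Rightarrow> complex" where
  "gaf_skip N y z = (\<Sum>n. if n = N then 0 else gaf_coeff y n * (z ^ n / complex_of_real (sqrt (fact n))))"

definition circ :: "real \<Rightarrow> real \<Rightarrow> complex" where
  "circ r x = r * exp (2 * of_real pi * \<i> * of_real x)"

definition gaf_inverse_mean :: "nat \<Rightarrow> real \<Rightarrow> (nat \<times> nat \<Rightarrow> real) \<Rightarrow> ennreal" where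
  "gaf_inverse_mean N r y = (\<integral>\<^sup>+x. ennreal (1 / cmod (gaf_skip N y (circ r x) +
     gaf_coeff y N * (circ r x ^ N / complex_of_real (sqrt (fact N))))) * indicator {0..1} x \<partial>lborel)"

lemma circ_measurable[measurable]: "circ r \<in> borel_measurable borel"
  unfolding circ_def by measurable

lemma norm_circ: "0 \<le> r \<Longrightarrow> cmod (circ r x) = r"
  by (simp add: circ_def norm_mult)

lemma gaf_skip_measurable: "(\<lambda>p. gaf_skip N (fst p) (circ r (snd p))) \<in> borel_measurable (gaf_space \<Otimes>\<^sub>M lborel)"
  unfolding gaf_skip_def by measurable

lemma gaf_inverse_mean_measurable: "gaf_inverse_mean N r \<in> borel_measurable gaf_space"
proof -
  note [measurable] = gaf_skip_measurable[of N r]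
  have "(\<lambda>(y, x). ennreal (1 / cmod (gaf_skip N y (circ r x) +
     gaf_coeff y N * (circ r x ^ N / complex_of_real (sqrt (fact N))))) * indicator {0..1} x) \<in> borel_measurable (gaf_space \<Otimes>\<^sub>M lborel)"
    unfolding case_prod_beta' by measurable
  then show ?thesis unfolding gaf_inverse_mean_def by (rule lborel.borel_measurable_nn_integral)
qed

text \<open>For a nonvanishing series the reciprocal is holomorphic, so its value at the origin is at
  most the mean of its absolute value over the circle.\<close>

lemma gaf_hole_inverse_mean:
  assumes s: "summable (\<lambda>n. cmod (gaf_coeff y n) * (R ^ n / sqrt (fact n)))"
    and nz: "\<And>z. z \<in> cball 0 R \<Longrightarrow> (\<Sum>n. gaf_coeff y n * (z ^ n / complex_of_real (sqrt (fact n)))) \<noteq> 0"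
    and r: "0 < r" "r \<le> R"
  shows "1 \<le> ennreal (cmod (gaf_coeff y 0)) * gaf_inverse_mean N r y"
proof -
  define F where "F z = (\<Sum>n. gaf_coeff y n * (z ^ n / complex_of_real (sqrt (fact n))))" for z
  note F = gaf_series[OF s, folded F_def]
  have F0: "F 0 = gaf_coeff y 0" unfolding F_def by (subst suminf_finite[of "{0}"]) auto
  have skip: "gaf_skip N y z + gaf_coeff y N * (z ^ N / complex_of_real (sqrt (fact N))) = F z" if "z \<in> cball 0 R" for z
  proof -
    have "(\<lambda>n. gaf_coeff y n * (z ^ n / complex_of_real (sqrt (fact n))) -
        (if n = N then gaf_coeff y n * (z ^ n / complex_of_real (sqrt (fact n))) else 0)) sums
        (F z - gaf_coeff y N * (z ^ N / complex_of_real (sqrt (fact N))))"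
      by (intro sums_diff F(1)[OF that] sums_single)
    then have "(\<lambda>n. if n = N then 0 else gaf_coeff y n * (z ^ n / complex_of_real (sqrt (fact n)))) sums
        (F z - gaf_coeff y N * (z ^ N / complex_of_real (sqrt (fact N))))"
      by (rule sums_cong[THEN iffD1, rotated]) auto
    then show ?thesis unfolding gaf_skip_def by (simp add: sums_iff)
  qed
  have "ennreal (1 / cmod (F 0)) \<le> (\<integral>\<^sup>+x. ennreal (1 / cmod (F (circ r x))) * indicator {0..1::real} x \<partial>lborel)"
    unfolding circ_def
    by (rule inverse_holomorphic_mean) (use F(2,3) nz r in \<open>auto simp: F_def intro: continuous_on_subset holomorphic_on_subset\<close>)
  also have "\<dots> = gaf_inverse_mean N r y"
    unfolding gaf_inverse_mean_def
  proof (rule nn_integral_cong)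
    fix x
    have "circ r x \<in> cball 0 R" using r by (simp add: norm_circ)
    from skip[OF this]
    show "ennreal (1 / cmod (F (circ r x))) * indicator {0..1} x =
      ennreal (1 / cmod (gaf_skip N y (circ r x) + gaf_coeff y N * (circ r x ^ N / complex_of_real (sqrt (fact N))))) * indicator {0..1} x"
      by (simp only:)
  qed
  finally have "ennreal (cmod (F 0)) * ennreal (1 / cmod (F 0)) \<le> ennreal (cmod (F 0)) * gaf_inverse_mean N r y"
    by (intro mult_left_mono) auto
  moreover have "F 0 \<noteq> 0" unfolding F_def by (rule nz) (use r in auto)
  ultimately show ?thesis unfolding F0 by (simp add: ennreal_mult'[symmetric])
qed

lemma gaf_drift_large:
  fixes s :: real and y :: "nat \<times> nat \<Rightarrow> real"
  assumes s: "0 < s" "s \<le> 1 / 2" and N: "0 < N" and r: "0 < r"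
    and big: "1632 \<le> s * (r ^ N / sqrt (fact N))"
  defines "\<Phi> \<equiv> \<lambda>y :: nat \<times> nat \<Rightarrow> real. ennreal (exp (((y (0, 1))\<^sup>2 + (y (0, 2))\<^sup>2) / 8))"
    and "H \<equiv> {y \<in> space gaf_space. 1 \<le> ennreal (cmod (gaf_coeff y 0)) * gaf_inverse_mean N r y}"
    and "st \<equiv> ar_step (sqrt (1 - s)) (sqrt s) gaf_index y"
  assumes y: "y \<in> space gaf_space"
  shows "(\<integral>\<^sup>+g. \<Phi> (st g) * indicator H (st g) \<partial>gaf_law) \<le> ennreal (1 / 2) * \<Phi> y"
proof -
  let ?\<rho> = "sqrt (1 - s)" and ?\<sigma> = "sqrt s"
  define q where "q y = (y (0, 1))\<^sup>2 + (y (0, 2))\<^sup>2" for y :: "nat \<times> nat \<Rightarrow> real"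
  have q_nn: "0 \<le> q y" for y by (simp add: q_def)
  have q_st: "q (st g) = (?\<rho> * y (0, 1) + ?\<sigma> * g (0, 1))\<^sup>2 + (?\<rho> * y (0, 2) + ?\<sigma> * g (0, 2))\<^sup>2" for g
    by (simp add: q_def st_def ar_step_def)
  have sq: "?\<rho>\<^sup>2 = 1 - s" "?\<sigma>\<^sup>2 = s" using s by simp_all
  have moment: "(\<integral>\<^sup>+g. ennreal (exp (\<mu> * q (st g))) \<partial>gaf_law) = ennreal (1 / (1 - 2 * \<mu> * s) * exp (\<mu> * (1 - s) / (1 - 2 * \<mu> * s) * q y))"
    if "0 < 1 - 2 * \<mu> * s" for \<mu>
    using gaf_law_exp_square[of \<mu> ?\<sigma> ?\<rho> "y (0, 1)" 0 "y (0, 2)"] that unfolding q_st sq by (simp add: q_def)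
  have \<Phi>q: "\<Phi> y = ennreal (exp (1 / 8 * q y))" for y by (simp add: \<Phi>_def q_def)
  show ?thesis
  proof (cases "32 / s \<le> q y")
    case True
    have c: "0 < 1 - 2 * (1 / 8) * s" using s by simp
    have "(\<integral>\<^sup>+g. \<Phi> (st g) * indicator H (st g) \<partial>gaf_law) \<le> (\<integral>\<^sup>+g. ennreal (exp (1 / 8 * q (st g))) \<partial>gaf_law)"
      unfolding \<Phi>q by (intro nn_integral_mono) (simp add: indicator_def)
    also have "\<dots> = ennreal (1 / (1 - 2 * (1 / 8) * s) * exp (1 / 8 * (1 - s) / (1 - 2 * (1 / 8) * s) * q y))"
      by (rule moment[OF c])
    also have "\<dots> \<le> ennreal (1 / 2 * exp (1 / 8 * q y))"
    proof (rule ennreal_leI)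
      have "(1 - s) \<le> (1 - s / 2) * (1 - 2 * (1 / 8) * s)" using s by (simp add: algebra_simps)
      then have "(1 - s) / (1 - 2 * (1 / 8) * s) \<le> 1 - s / 2" using c by (simp add: pos_divide_le_eq)
      then have "(1 - s) / (1 - 2 * (1 / 8) * s) * (1 / 8 * q y) \<le> (1 - s / 2) * (1 / 8 * q y)"
        using q_nn by (intro mult_right_mono) auto
      moreover have "32 \<le> s * q y" using True s by (simp add: field_simps)
      ultimately have "1 / 8 * (1 - s) / (1 - 2 * (1 / 8) * s) * q y \<le> 1 / 8 * q y - 2" by (simp add: algebra_simps)
      then have a: "exp (1 / 8 * (1 - s) / (1 - 2 * (1 / 8) * s) * q y) \<le> exp (1 / 8 * q y - 2)"
        by (subst exp_le_cancel_iff)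
      have b: "exp (1 / 8 * q y - 2) \<le> exp (1 / 8 * q y) / 4"
      proof -
        have "2 * 2 \<le> exp (1::real) * exp 1" using exp_ge_add_one_self[of 1] by (intro mult_mono) auto
        then have "4 \<le> exp (2::real)" by (simp add: exp_add[symmetric])
        then show ?thesis unfolding exp_diff by (intro divide_left_mono) auto
      qed
      have "1 / (1 - 2 * (1 / 8) * s) \<le> 2" using s by (simp add: field_simps)
      then have "1 / (1 - 2 * (1 / 8) * s) * exp (1 / 8 * (1 - s) / (1 - 2 * (1 / 8) * s) * q y) \<le> 2 * (exp (1 / 8 * q y) / 4)"
        by (intro mult_mono order_trans[OF a b]) auto
      then show "1 / (1 - 2 * (1 / 8) * s) * exp (1 / 8 * (1 - s) / (1 - 2 * (1 / 8) * s) * q y) \<le> 1 / 2 * exp (1 / 8 * q y)" by simp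
    qed
    also have "\<dots> = ennreal (1 / 2) * \<Phi> y" unfolding \<Phi>q by (rule ennreal_mult') simp
    finally show ?thesis .
  next
    case False
    define D where "D = sqrt (32 / s)"
    define \<mu> where "\<mu> = 1 / 8 + s / 32"
    have D: "0 < D" "D\<^sup>2 = 32 / s" using s by (auto simp: D_def)
    define h where "h g = ennreal (D * exp (\<mu> * q (st g)))" for g
    interpret g: prob_space gaf_law by (rule prob_space_gaf_law)
    interpret P: pair_sigma_finite gaf_law lborel ..
    let ?c = "r ^ N / sqrt (fact N)"
    have c0: "0 < ?c" using r by simp
    have st_meas: "st \<in> gaf_space \<rightarrow>\<^sub>M gaf_space"
      using measurable_compose[OF measurable_Pair1'[OF y, of gaf_space] ar_step_measurable] by (simp add: st_def)
    have st_meas': "st \<in> gaf_law \<rightarrow>\<^sub>M gaf_space"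
      using st_meas unfolding measurable_cong_sets[OF sets_gaf_law refl] .
    have q_meas: "q \<in> borel_measurable gaf_space"
    proof -
      have [measurable]: "(\<lambda>y. y (0, 1)) \<in> borel_measurable gaf_space" "(\<lambda>y. y (0, 2)) \<in> borel_measurable gaf_space"
        by (auto intro!: measurable_component_singleton)
      show ?thesis unfolding q_def[abs_def] by measurable
    qed
    have h_meas: "h \<in> borel_measurable gaf_space"
      unfolding h_def using measurable_compose[OF st_meas q_meas] by measurable
    have h_int: "(\<integral>\<^sup>+g. h g \<partial>gaf_law) \<le> ennreal (6 * D * exp (1 / 8 * q y))"
    proof -
      have "\<mu> \<le> 1 / 4" "0 \<le> \<mu>" using s by (simp_all add: \<mu>_def)
      then have "\<mu> * s \<le> 1 / 4 * 1" using s by (intro mult_mono) auto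
      then have c: "1 / 2 \<le> 1 - 2 * \<mu> * s" "0 < 1 - 2 * \<mu> * s" by (simp_all add: mult.assoc)
      have "(\<integral>\<^sup>+g. h g \<partial>gaf_law) = ennreal D * (\<integral>\<^sup>+g. ennreal (exp (\<mu> * q (st g))) \<partial>gaf_law)"
        unfolding h_def using D measurable_compose[OF st_meas' q_meas]
        by (subst nn_integral_cmult[symmetric]) (auto simp: ennreal_mult')
      also have "\<dots> = ennreal D * ennreal (1 / (1 - 2 * \<mu> * s) * exp (\<mu> * (1 - s) / (1 - 2 * \<mu> * s) * q y))"
        by (simp only: moment[OF c(2)])
      also have "\<dots> = ennreal (D * (1 / (1 - 2 * \<mu> * s) * exp (\<mu> * (1 - s) / (1 - 2 * \<mu> * s) * q y)))"
        using D by (intro ennreal_mult'[symmetric]) auto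
      also have "\<dots> \<le> ennreal (D * (2 * (3 * exp (1 / 8 * q y))))"
      proof (intro ennreal_leI mult_left_mono mult_mono)
        show "1 / (1 - 2 * \<mu> * s) \<le> 2" using c by (simp add: field_simps)
        have "\<mu> * (1 - s) \<le> \<mu> * (1 - 2 * \<mu> * s)"
          using s by (intro mult_left_mono) (auto simp: \<mu>_def)
        then have "\<mu> * (1 - s) / (1 - 2 * \<mu> * s) \<le> \<mu>" using c by (simp add: pos_divide_le_eq)
        then have "\<mu> * (1 - s) / (1 - 2 * \<mu> * s) * q y \<le> \<mu> * q y" using q_nn by (intro mult_right_mono)
        also have "\<mu> * q y \<le> 1 / 8 * q y + 1"
          using False s by (simp add: \<mu>_def algebra_simps field_simps)
        finally have "exp (\<mu> * (1 - s) / (1 - 2 * \<mu> * s) * q y) \<le> exp (1 / 8 * q y + 1)" by (subst exp_le_cancel_iff)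
        also have "\<dots> = exp 1 * exp (1 / 8 * q y)" by (simp add: exp_add)
        also have "\<dots> \<le> 3 * exp (1 / 8 * q y)" using exp_le by (intro mult_right_mono) auto
        finally show "exp (\<mu> * (1 - s) / (1 - 2 * \<mu> * s) * q y) \<le> 3 * exp (1 / 8 * q y)" .
      qed (use D c in auto)
      finally show ?thesis by (simp add: mult_ac)
    qed
    have pt: "\<Phi> (st g) * indicator H (st g) \<le> h g * gaf_inverse_mean N r (st g)" for g
    proof (cases "st g \<in> H")
      case True
      let ?Q = "q (st g)"
      have "cmod (gaf_coeff (st g) 0) \<le> sqrt ?Q"
        by (rule real_le_rsqrt) (simp add: gaf_coeff_norm q_def)
      also have "\<dots> \<le> D * exp (s / 32 * ?Q)"
      proof -
        have "sqrt ?Q / D \<le> exp ((sqrt ?Q / D)\<^sup>2)"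
          using le_exp_half_square[of "sqrt ?Q / D"] by (rule order_trans) simp
        moreover have "(sqrt ?Q / D)\<^sup>2 = s / 32 * ?Q" using D q_nn s by (simp add: power_divide)
        ultimately have "sqrt ?Q / D \<le> exp (s / 32 * ?Q)" by (simp only:)
        then show ?thesis using D(1) by (simp add: pos_divide_le_eq mult.commute)
      qed
      finally have le: "cmod (gaf_coeff (st g) 0) \<le> D * exp (s / 32 * ?Q)" .
      have "\<Phi> (st g) * indicator H (st g) \<le> \<Phi> (st g) * (ennreal (cmod (gaf_coeff (st g) 0)) * gaf_inverse_mean N r (st g))"
        using True by (intro mult_left_mono) (auto simp: H_def)
      also have "\<dots> \<le> \<Phi> (st g) * (ennreal (D * exp (s / 32 * ?Q)) * gaf_inverse_mean N r (st g))"
        by (intro mult_left_mono mult_right_mono ennreal_leI le) auto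
      also have "\<dots> = ennreal (exp (1 / 8 * ?Q) * (D * exp (s / 32 * ?Q))) * gaf_inverse_mean N r (st g)"
        unfolding \<Phi>q by (simp add: ennreal_mult' mult.assoc)
      also have "exp (1 / 8 * ?Q) * (D * exp (s / 32 * ?Q)) = D * exp (\<mu> * ?Q)"
        unfolding \<mu>_def distrib_right exp_add by simp
      finally show ?thesis by (simp add: h_def)
    qed simp
    define U where "U x g = gaf_skip N (st g) (circ r x) + ?\<rho> * gaf_coeff y N * (circ r x ^ N / complex_of_real (sqrt (fact N)))" for x g
    define w where "w x = ?\<sigma> / sqrt 2 * (circ r x ^ N / complex_of_real (sqrt (fact N)))" for x
    have w_norm: "cmod (w x) = ?\<sigma> * ?c / sqrt 2" for x
      unfolding w_def using r norm_circ[of r x] s by (simp add: norm_mult norm_divide norm_power)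
    have w0: "w x \<noteq> 0" for x
    proof -
      have "0 < cmod (w x)" unfolding w_norm using s r by (intro divide_pos_pos mult_pos_pos) auto
      then show ?thesis by simp
    qed
    have split: "gaf_skip N (st g) (circ r x) + gaf_coeff (st g) N * (circ r x ^ N / complex_of_real (sqrt (fact N))) =
        U x g + w x * Complex (g (N, 1)) (g (N, 2))" for x g
    proof -
      have "Complex (g (N, 1)) (g (N, 2)) = sqrt 2 * gaf_coeff g N"
        by (simp add: gaf_coeff_def complex_eq_iff)
      then have "w x * Complex (g (N, 1)) (g (N, 2)) = ?\<sigma> * gaf_coeff g N * (circ r x ^ N / complex_of_real (sqrt (fact N)))"
        unfolding w_def by (simp add: mult_ac)
      then show ?thesis unfolding U_def st_def gaf_coeff_step by (simp add: algebra_simps add_divide_distrib)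
    qed
    have U_meas: "U x \<in> borel_measurable gaf_space" for x
    proof -
      have "(\<lambda>g. gaf_skip N (st g) (circ r x)) \<in> borel_measurable gaf_space"
        using measurable_compose[OF measurable_Pair[OF st_meas measurable_const[of x lborel]] gaf_skip_measurable[of N r]] by simp
      then show ?thesis unfolding U_def by measurable
    qed
    have inner: "(\<integral>\<^sup>+g. h g * ennreal (1 / cmod (U x g + w x * Complex (g (N, 1)) (g (N, 2)))) \<partial>gaf_law) \<le> ennreal (1 / 2 * exp (1 / 8 * q y))" for x
    proof -
      have "(\<integral>\<^sup>+g. h g * ennreal (1 / cmod (U x g + w x * Complex (g (N, 1)) (g (N, 2)))) \<partial>gaf_law) \<le> ennreal (17 / cmod (w x)) * (\<integral>\<^sup>+g. h g \<partial>gaf_law)"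
      proof (rule gaf_law_resample[OF h_meas U_meas w0])
        fix g g' :: "nat \<times> nat \<Rightarrow> real" assume *: "\<And>i. i \<in> gaf_index \<Longrightarrow> fst i \<noteq> N \<Longrightarrow> g i = g' i"
        have "g (0, 1) = g' (0, 1)" "g (0, 2) = g' (0, 2)" using N by (auto intro: *)
        then show "h g = h g'" unfolding h_def q_st by simp
        have "gaf_coeff g n = gaf_coeff g' n" if "n \<noteq> N" for n
          using *[of "(n, 1)"] *[of "(n, 2)"] that by (simp add: gaf_coeff_def)
        then have "(if n = N then 0 else gaf_coeff (st g) n * z) = (if n = N then 0 else gaf_coeff (st g') n * z)" for n z
          unfolding st_def gaf_coeff_step by simp
        then show "U x g = U x g'" unfolding U_def gaf_skip_def by presburger
      qed
      also have "\<dots> \<le> ennreal (17 / cmod (w x)) * ennreal (6 * D * exp (1 / 8 * q y))"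
        by (intro mult_left_mono h_int) simp
      also have "\<dots> = ennreal (17 / cmod (w x) * (6 * D * exp (1 / 8 * q y)))"
        by (intro ennreal_mult'[symmetric]) simp
      also have "\<dots> \<le> ennreal (1 / 2 * exp (1 / 8 * q y))"
      proof (rule ennreal_leI)
        have "D * (sqrt 2 * ?\<sigma>) = 8"
        proof -
          have "D * (sqrt 2 * ?\<sigma>) = sqrt (32 / s * (2 * s))" by (simp add: D_def real_sqrt_mult[symmetric])
          also have "32 / s * (2 * s) = 8\<^sup>2" using s by simp
          finally show ?thesis by simp
        qed
        moreover have "?\<sigma> * ?\<sigma> = s" using s by simp
        moreover have "17 / cmod (w x) * (6 * D) = 102 * (D * (sqrt 2 * ?\<sigma>)) / (?\<sigma> * ?\<sigma> * ?c)"
        proof -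
          have gen: "17 / (a * c / b) * (6 * d) = 102 * (d * (b * a)) / (a * a * c)" if "a \<noteq> 0" for a b c d :: real
            using that by simp
          show ?thesis unfolding w_norm by (rule gen) (use s in simp)
        qed
        ultimately have "17 / cmod (w x) * (6 * D) = 816 / (s * ?c)" by simp
        also have "\<dots> \<le> 1 / 2" using big s c0 by (simp add: field_simps)
        finally have "17 / cmod (w x) * (6 * D) * exp (1 / 8 * q y) \<le> 1 / 2 * exp (1 / 8 * q y)" by (intro mult_right_mono) auto
        then show "17 / cmod (w x) * (6 * D * exp (1 / 8 * q y)) \<le> 1 / 2 * exp (1 / 8 * q y)" by (simp only: mult.assoc)
      qed
      finally show ?thesis .
    qed
    define f where "f g x = h g * (ennreal (1 / cmod (U x g + w x * Complex (g (N, 1)) (g (N, 2)))) * indicator {0..1} x)" for g x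
    have f_meas: "(\<lambda>(g, x). f g x) \<in> borel_measurable (gaf_law \<Otimes>\<^sub>M lborel)"
    proof -
      have [measurable]: "(\<lambda>p. st (fst p)) \<in> gaf_space \<Otimes>\<^sub>M lborel \<rightarrow>\<^sub>M gaf_space" using st_meas by measurable
      have [measurable]: "(\<lambda>p. gaf_skip N (st (fst p)) (circ r (snd p))) \<in> borel_measurable (gaf_space \<Otimes>\<^sub>M lborel)"
      proof -
        have "(\<lambda>p. (st (fst p), snd p)) \<in> gaf_space \<Otimes>\<^sub>M lborel \<rightarrow>\<^sub>M gaf_space \<Otimes>\<^sub>M lborel" by measurable
        from measurable_compose[OF this gaf_skip_measurable[of N r]] show ?thesis by simp
      qed
      note [measurable] = h_meas
      have m1: "(\<lambda>p. f (fst p) (snd p)) \<in> borel_measurable (gaf_space \<Otimes>\<^sub>M lborel)"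
        unfolding f_def split[symmetric] by measurable
      have m2: "sets (gaf_law \<Otimes>\<^sub>M lborel) = sets (gaf_space \<Otimes>\<^sub>M (lborel :: real measure))"
        by (intro sets_pair_measure_cong sets_gaf_law refl)
      show ?thesis unfolding case_prod_beta' measurable_cong_sets[OF m2 refl] by (rule m1)
    qed
    have "(\<integral>\<^sup>+g. \<Phi> (st g) * indicator H (st g) \<partial>gaf_law) \<le> (\<integral>\<^sup>+g. h g * gaf_inverse_mean N r (st g) \<partial>gaf_law)"
      by (intro nn_integral_mono pt)
    also have "\<dots> = (\<integral>\<^sup>+g. \<integral>\<^sup>+x. f g x \<partial>lborel \<partial>gaf_law)"
    proof (rule nn_integral_cong)
      fix g assume "g \<in> space gaf_law"
      then have g: "g \<in> space gaf_space" by (simp add: space_PiM)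
      have "st g \<in> space gaf_space" using measurable_space[OF st_meas g] .
      then have "(\<lambda>x. gaf_skip N (st g) (circ r x)) \<in> borel_measurable lborel"
        using measurable_compose[OF measurable_Pair[OF measurable_const measurable_ident] gaf_skip_measurable[of N r], of "st g"] by simp
      then have "(\<lambda>x. ennreal (1 / cmod (gaf_skip N (st g) (circ r x) + gaf_coeff (st g) N * (circ r x ^ N / complex_of_real (sqrt (fact N))))) * indicator {0..1} x) \<in> borel_measurable lborel"
        by measurable
      then show "h g * gaf_inverse_mean N r (st g) = (\<integral>\<^sup>+x. f g x \<partial>lborel)"
        unfolding gaf_inverse_mean_def f_def split[symmetric] by (intro nn_integral_cmult[symmetric])
    qed
    also have "\<dots> = (\<integral>\<^sup>+x. \<integral>\<^sup>+g. f g x \<partial>gaf_law \<partial>lborel)"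
      by (rule P.Fubini'[OF f_meas, symmetric])
    also have "\<dots> \<le> (\<integral>\<^sup>+x. ennreal (1 / 2 * exp (1 / 8 * q y)) * indicator {0..1::real} x \<partial>lborel)"
    proof (rule nn_integral_mono)
      fix x :: real
      show "(\<integral>\<^sup>+g. f g x \<partial>gaf_law) \<le> ennreal (1 / 2 * exp (1 / 8 * q y)) * indicator {0..1} x"
        using inner[of x] by (cases "x \<in> {0..1}") (simp_all add: f_def)
    qed
    also have "\<dots> = ennreal (1 / 2 * exp (1 / 8 * q y))" by (simp add: nn_integral_cmult_indicator)
    also have "\<dots> = ennreal (1 / 2) * \<Phi> y" unfolding \<Phi>q by (rule ennreal_mult') simp
    finally show ?thesis .
  qed
qed

section \<open>Some decay for every radius\<close>

lemma dominant_linear_term_zero: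
  fixes c :: "nat \<Rightarrow> complex"
  assumes R: "0 < R" and s: "summable (\<lambda>n. cmod (c n) * (R ^ n / sqrt (fact n)))"
    and dom: "(\<Sum>n. if n = 1 then 0 else cmod (c n) * (R ^ n / sqrt (fact n))) < cmod (c 1) * R"
  obtains z where "z \<in> cball 0 R" "(\<Sum>n. c n * (z ^ n / complex_of_real (sqrt (fact n)))) = 0"
proof -
  define c' where "c' n = (if n = 1 then 0 else c n)" for n
  have eq: "cmod (c' n) * (R ^ n / sqrt (fact n)) = (if n = 1 then 0 else cmod (c n) * (R ^ n / sqrt (fact n)))" for n
    by (simp add: c'_def)
  have s': "summable (\<lambda>n. cmod (c' n) * (R ^ n / sqrt (fact n)))"
    by (rule summable_comparison_test'[OF s, where N=0]) (use R in \<open>simp add: c'_def\<close>)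
  define G where "G z = (\<Sum>n. c' n * (z ^ n / complex_of_real (sqrt (fact n))))" for z
  note G = gaf_series[OF s', folded G_def]
  have "c 1 \<noteq> 0"
  proof
    assume "c 1 = 0"
    moreover have "0 \<le> (\<Sum>n. cmod (c' n) * (R ^ n / sqrt (fact n)))" using R by (intro suminf_nonneg s') simp
    ultimately show False using dom unfolding eq by simp
  qed
  have G_le: "cmod (G z) \<le> cmod (c 1) * R" if z: "z \<in> cball 0 R" for z
  proof -
    have le: "cmod (c' n * (z ^ n / complex_of_real (sqrt (fact n)))) \<le> cmod (c' n) * (R ^ n / sqrt (fact n))" for n
    proof -
      have "cmod (c' n) * (cmod z ^ n / sqrt (fact n)) \<le> cmod (c' n) * (R ^ n / sqrt (fact n))"
        using z by (intro mult_left_mono divide_right_mono power_mono) auto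
      then show ?thesis by (simp add: norm_mult norm_divide norm_power)
    qed
    have "cmod (G z) \<le> (\<Sum>n. cmod (c' n) * (R ^ n / sqrt (fact n)))"
      unfolding G_def by (rule norm_suminf_le[OF le s'])
    then show ?thesis using dom unfolding eq by simp
  qed
  obtain z where z: "z \<in> cball 0 R" "- (G z / c 1) = z"
  proof (rule brouwer)
    show "continuous_on (cball 0 R) (\<lambda>z. - (G z / c 1))" using \<open>c 1 \<noteq> 0\<close> by (intro continuous_intros G) auto
    show "(\<lambda>z. - (G z / c 1)) \<in> cball 0 R \<rightarrow> cball 0 R"
      using G_le \<open>c 1 \<noteq> 0\<close> by (auto simp: norm_divide field_simps)
  qed (use R in auto)
  have "(\<lambda>n. c' n * (z ^ n / complex_of_real (sqrt (fact n))) + (if n = 1 then c n * (z ^ n / complex_of_real (sqrt (fact n))) else 0)) sums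
      (G z + c 1 * (z ^ 1 / complex_of_real (sqrt (fact 1))))"
    by (intro sums_add G(1)[OF z(1)] sums_single)
  then have "(\<lambda>n. c n * (z ^ n / complex_of_real (sqrt (fact n)))) sums (G z + c 1 * (z ^ 1 / complex_of_real (sqrt (fact 1))))"
    by (rule sums_cong[THEN iffD1, rotated]) (auto simp: c'_def)
  moreover have "G z + c 1 * (z ^ 1 / complex_of_real (sqrt (fact 1))) = 0"
  proof -
    have "c 1 * z = - G z" using z(2) \<open>c 1 \<noteq> 0\<close> by (simp add: field_simps)
    then show ?thesis by simp
  qed
  ultimately show ?thesis using that z(1) by (simp add: sums_iff)
qed

definition gaf_mass :: "real \<Rightarrow> (nat \<times> nat \<Rightarrow> real) \<Rightarrow> ennreal" where
  "gaf_mass R y = (\<Sum>n. ennreal (cmod (gaf_coeff y n) * (R ^ n / sqrt (fact n))))"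

definition gaf_mass' :: "real \<Rightarrow> (nat \<times> nat \<Rightarrow> real) \<Rightarrow> ennreal" where
  "gaf_mass' R y = (\<Sum>n. if n = 1 then 0 else ennreal (cmod (gaf_coeff y n) * (R ^ n / sqrt (fact n))))"

lemma gaf_mass_measurable[measurable]: "gaf_mass R \<in> borel_measurable gaf_space"
  unfolding gaf_mass_def[abs_def] by measurable

lemma gaf_mass'_measurable[measurable]: "gaf_mass' R \<in> borel_measurable gaf_space"
  unfolding gaf_mass'_def[abs_def] by measurable

lemma gaf_mass'_le: "gaf_mass' R y \<le> gaf_mass R y"
  unfolding gaf_mass_def gaf_mass'_def by (intro suminf_le) auto

lemma gaf_mass_term: "ennreal (cmod (gaf_coeff y n) * (R ^ n / sqrt (fact n))) \<le> gaf_mass R y"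
  unfolding gaf_mass_def
  using sum_le_suminf[of "\<lambda>n. ennreal (cmod (gaf_coeff y n) * (R ^ n / sqrt (fact n)))" "{n}"] by simp

lemma gaf_coeff_step_norm:
  assumes "0 \<le> \<rho>" "0 \<le> \<sigma>"
  shows "cmod (gaf_coeff (ar_step \<rho> \<sigma> gaf_index y g) n) \<le> \<rho> * cmod (gaf_coeff y n) + \<sigma> * cmod (gaf_coeff g n)"
  unfolding gaf_coeff_step using assms norm_triangle_ineq[of "\<rho> * gaf_coeff y n" "\<sigma> * gaf_coeff g n"] by (simp add: norm_mult)

lemma ennreal_step_term:
  assumes "0 \<le> \<rho>" "0 \<le> \<sigma>" "0 \<le> w"
  shows "ennreal (cmod (gaf_coeff (ar_step \<rho> \<sigma> gaf_index y g) n) * w) \<le>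
    ennreal \<rho> * ennreal (cmod (gaf_coeff y n) * w) + ennreal \<sigma> * ennreal (cmod (gaf_coeff g n) * w)"
proof -
  have "cmod (gaf_coeff (ar_step \<rho> \<sigma> gaf_index y g) n) * w \<le> \<rho> * (cmod (gaf_coeff y n) * w) + \<sigma> * (cmod (gaf_coeff g n) * w)"
    using mult_right_mono[OF gaf_coeff_step_norm[OF assms(1,2), of y g n] assms(3)] by (simp add: algebra_simps)
  then show ?thesis using assms by (simp add: ennreal_mult[symmetric] ennreal_plus[symmetric] ennreal_leI del: ennreal_plus)
qed

lemma gaf_mass_step:
  assumes "0 \<le> \<rho>" "0 \<le> \<sigma>" "0 \<le> R"
  shows "gaf_mass R (ar_step \<rho> \<sigma> gaf_index y g) \<le> ennreal \<rho> * gaf_mass R y + ennreal \<sigma> * gaf_mass R g"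
    and "gaf_mass' R (ar_step \<rho> \<sigma> gaf_index y g) \<le> ennreal \<rho> * gaf_mass' R y + ennreal \<sigma> * gaf_mass' R g"
proof -
  have w: "0 \<le> R ^ n / sqrt (fact n)" for n using assms by simp
  show "gaf_mass R (ar_step \<rho> \<sigma> gaf_index y g) \<le> ennreal \<rho> * gaf_mass R y + ennreal \<sigma> * gaf_mass R g"
    unfolding gaf_mass_def ennreal_suminf_cmult[symmetric] suminf_add[OF summableI summableI]
    by (intro suminf_le ennreal_step_term assms w) auto
  show "gaf_mass' R (ar_step \<rho> \<sigma> gaf_index y g) \<le> ennreal \<rho> * gaf_mass' R y + ennreal \<sigma> * gaf_mass' R g"
    unfolding gaf_mass'_def ennreal_suminf_cmult[symmetric] suminf_add[OF summableI summableI]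
    using ennreal_step_term[OF assms(1,2) w] by (intro suminf_le) auto
qed

lemma gaf_mass_mean:
  assumes R: "0 < R"
  obtains C where "0 < C" "(\<integral>\<^sup>+g. gaf_mass R g \<partial>gaf_law) \<le> ennreal C"
proof -
  let ?w = "\<lambda>n. R ^ n / sqrt (fact n)"
  have sw: "summable ?w" using R by (intro summable_pow_sqrt_fact(1)[of 2]) auto
  have co: "(\<integral>\<^sup>+g. ennreal (cmod (gaf_coeff g n) * ?w n) \<partial>gaf_law) \<le> ennreal (2 * ?w n)" for n
  proof -
    have "(\<integral>\<^sup>+g. ennreal (cmod (gaf_coeff g n) * ?w n) \<partial>gaf_law) \<le>
        (\<integral>\<^sup>+g. ennreal (exp (1 / 4 * ((0 * 0 + 1 * g (n, 1))\<^sup>2 + (0 * 0 + 1 * g (n, 2))\<^sup>2))) * ennreal (?w n) \<partial>gaf_law)"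
    proof (rule nn_integral_mono)
      fix g :: "nat \<times> nat \<Rightarrow> real"
      have "cmod (gaf_coeff g n) \<le> exp ((cmod (gaf_coeff g n))\<^sup>2 / 2)" by (rule le_exp_half_square)
      also have "(cmod (gaf_coeff g n))\<^sup>2 / 2 = 1 / 4 * ((0 * 0 + 1 * g (n, 1))\<^sup>2 + (0 * 0 + 1 * g (n, 2))\<^sup>2)"
        by (simp add: gaf_coeff_norm)
      finally show "ennreal (cmod (gaf_coeff g n) * ?w n) \<le> ennreal (exp (1 / 4 * ((0 * 0 + 1 * g (n, 1))\<^sup>2 + (0 * 0 + 1 * g (n, 2))\<^sup>2))) * ennreal (?w n)"
        using R by (simp add: ennreal_mult[symmetric] ennreal_leI mult_right_mono divide_right_mono)
    qed
    also have "\<dots> = (\<integral>\<^sup>+g. ennreal (exp (1 / 4 * ((0 * 0 + 1 * g (n, 1))\<^sup>2 + (0 * 0 + 1 * g (n, 2))\<^sup>2))) \<partial>gaf_law) * ennreal (?w n)"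
    proof (rule nn_integral_multc)
      have [measurable]: "(\<lambda>g. g (n, 1)) \<in> borel_measurable gaf_space" "(\<lambda>g. g (n, 2)) \<in> borel_measurable gaf_space"
        by (auto intro!: measurable_component_singleton)
      show "(\<lambda>g. ennreal (exp (1 / 4 * ((0 * 0 + 1 * g (n, 1))\<^sup>2 + (0 * 0 + 1 * g (n, 2))\<^sup>2)))) \<in> borel_measurable gaf_law"
        unfolding measurable_cong_sets[OF sets_gaf_law refl] by measurable
    qed
    also have "\<dots> = ennreal 2 * ennreal (?w n)"
      by (subst gaf_law_exp_square) simp_all
    also have "\<dots> = ennreal (2 * ?w n)" by (intro ennreal_mult'[symmetric]) simp
    finally show ?thesis .
  qed
  have "(\<integral>\<^sup>+g. gaf_mass R g \<partial>gaf_law) = (\<Sum>n. \<integral>\<^sup>+g. ennreal (cmod (gaf_coeff g n) * ?w n) \<partial>gaf_law)"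
    unfolding gaf_mass_def
    by (intro nn_integral_suminf, unfold measurable_cong_sets[OF sets_gaf_law refl]) measurable
  also have "\<dots> \<le> (\<Sum>n. ennreal (2 * ?w n))" by (intro suminf_le co) auto
  also have "\<dots> = ennreal (\<Sum>n. 2 * ?w n)"
    using R by (intro suminf_ennreal2 summable_mult sw) auto
  finally have "(\<integral>\<^sup>+g. gaf_mass R g \<partial>gaf_law) \<le> ennreal (\<Sum>n. 2 * ?w n)" .
  moreover have "0 < (\<Sum>n. 2 * ?w n)" using R by (intro suminf_pos summable_mult sw) auto
  ultimately show ?thesis using that by blast
qed

lemma gaf_dominant_prob:
  assumes C: "0 < C" "(\<integral>\<^sup>+g. gaf_mass R g \<partial>gaf_law) \<le> ennreal C" and R: "0 < R"
  shows "measure std_normal {2 * l..} / 2 \<le>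
    measure gaf_law {g \<in> space gaf_law. 2 * l \<le> g (1, 1) \<and> gaf_mass' R g < ennreal (2 * C)}"
proof -
  interpret prob_space gaf_law by (rule prob_space_gaf_law)
  let ?A = "{(1, 1)} :: (nat \<times> nat) set" and ?B = "gaf_index - {1} \<times> {1, 2} :: (nat \<times> nat) set"
  let ?SA = "PiM ?A (\<lambda>_. borel) :: (nat \<times> nat \<Rightarrow> real) measure" and ?SB = "PiM ?B (\<lambda>_. borel) :: (nat \<times> nat \<Rightarrow> real) measure"
  have coords: "indep_vars (\<lambda>_. borel) (\<lambda>i g. g i) gaf_index" by (rule indep_vars_PiM_coordinates) auto
  have ind: "indep_var ?SA (\<lambda>g. restrict (\<lambda>i. g i) ?A) ?SB (\<lambda>g. restrict (\<lambda>i. g i) ?B)"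
    by (rule indep_var_restrict[OF coords]) auto
  have m_law: "gaf_mass R \<in> borel_measurable gaf_law" "gaf_mass' R \<in> borel_measurable gaf_law"
    unfolding measurable_cong_sets[OF sets_gaf_law refl] by measurable
  have mass_B: "gaf_mass' R \<in> borel_measurable ?SB"
  proof -
    have "(\<lambda>x. gaf_coeff x n) \<in> borel_measurable ?SB" if "n \<noteq> 1" for n
      using that by (intro gaf_coeff_measurable_PiM) auto
    then have "(\<lambda>x. if n = 1 then 0 else ennreal (cmod (gaf_coeff x n) * (R ^ n / sqrt (fact n)))) \<in> borel_measurable ?SB" for n
      by (cases "n = 1") simp_all
    then show ?thesis unfolding gaf_mass'_def[abs_def] by (intro borel_measurable_suminf_order)
  qed
  define SA where "SA = {x \<in> space ?SA. 2 * l \<le> x (1, 1)}"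
  define SB where "SB = {x \<in> space ?SB. gaf_mass' R x < ennreal (2 * C)}"
  have "(\<lambda>x. x (1, 1)) \<in> borel_measurable ?SA" by (intro measurable_component_singleton) auto
  then have SA: "SA \<in> sets ?SA" unfolding SA_def by measurable
  have SB: "SB \<in> sets ?SB" unfolding SB_def using mass_B by measurable
  have restr: "gaf_mass' R (restrict (\<lambda>i. g i) ?B) = gaf_mass' R g" for g
  proof -
    have "gaf_coeff (restrict (\<lambda>i. g i) ?B) n = gaf_coeff g n" if "n \<noteq> 1" for n
      using that by (simp add: gaf_coeff_def)
    then show ?thesis unfolding gaf_mass'_def by (intro suminf_cong) simp
  qed
  have sp: "g \<in> space gaf_law \<Longrightarrow> restrict (\<lambda>i. g i) ?A \<in> space ?SA \<and> restrict (\<lambda>i. g i) ?B \<in> space ?SB" for g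
    by (simp add: space_PiM)
  have e: "{g \<in> space gaf_law. 2 * l \<le> g (1, 1) \<and> gaf_mass' R g < ennreal (2 * C)} =
      (\<lambda>g. (restrict (\<lambda>i. g i) ?A, restrict (\<lambda>i. g i) ?B)) -` (SA \<times> SB) \<inter> space gaf_law"
    using sp unfolding SA_def SB_def vimage_def Int_def mem_Times_iff mem_Collect_eq fst_conv snd_conv restr by auto
  have "prob ((\<lambda>g. restrict (\<lambda>i. g i) ?A) -` SA \<inter> space gaf_law) = measure (distr gaf_law borel (\<lambda>g. g (1, 1))) {2 * l..}"
  proof -
    have "(\<lambda>g. g (1, 1)) \<in> borel_measurable gaf_law"
      unfolding measurable_cong_sets[OF sets_gaf_law refl] by (intro measurable_component_singleton) auto
    moreover have "(\<lambda>g. restrict (\<lambda>i. g i) ?A) -` SA \<inter> space gaf_law = (\<lambda>g. g (1, 1)) -` {2 * l..} \<inter> space gaf_law"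
      using sp unfolding SA_def vimage_def Int_def mem_Collect_eq atLeast_iff by auto
    ultimately show ?thesis by (subst measure_distr) auto
  qed
  also have "\<dots> = measure std_normal {2 * l..}" by (subst distr_std_component) auto
  finally have pA: "prob ((\<lambda>g. restrict (\<lambda>i. g i) ?A) -` SA \<inter> space gaf_law) = measure std_normal {2 * l..}" .
  have eB: "(\<lambda>g. restrict (\<lambda>i. g i) ?B) -` SB \<inter> space gaf_law = {g \<in> space gaf_law. gaf_mass' R g < ennreal (2 * C)}"
    using sp unfolding SB_def vimage_def Int_def mem_Collect_eq restr by auto
  have "1 / 2 \<le> prob {g \<in> space gaf_law. gaf_mass' R g < ennreal (2 * C)}"
  proof -
    let ?E = "{g \<in> space gaf_law. \<not> gaf_mass' R g < ennreal (2 * C)}"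
    have E: "?E \<in> events" using m_law by measurable
    have "ennreal (2 * C) * emeasure gaf_law ?E = (\<integral>\<^sup>+g. ennreal (2 * C) * indicator ?E g \<partial>gaf_law)"
      using E by (simp add: nn_integral_cmult_indicator)
    also have "\<dots> \<le> (\<integral>\<^sup>+g. gaf_mass R g \<partial>gaf_law)"
      using order_trans[OF _ gaf_mass'_le] by (intro nn_integral_mono) (auto simp: indicator_def not_less)
    also have "\<dots> \<le> ennreal C" by (rule C(2))
    finally have "ennreal (2 * C) * ennreal (prob ?E) \<le> ennreal C" unfolding emeasure_eq_measure .
    then have "ennreal (2 * C * prob ?E) \<le> ennreal C" using C(1) by (subst ennreal_mult') auto
    then have "2 * C * prob ?E \<le> C" using C(1) by (subst (asm) ennreal_le_iff) auto
    then have "prob ?E \<le> 1 / 2" using C(1) by simp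
    then show ?thesis using m_law by (subst (asm) prob_neg) auto
  qed
  then have "measure std_normal {2 * l..} * (1 / 2) \<le> measure std_normal {2 * l..} * prob {g \<in> space gaf_law. gaf_mass' R g < ennreal (2 * C)}"
    by (intro mult_left_mono) auto
  also have "\<dots> = prob {g \<in> space gaf_law. 2 * l \<le> g (1, 1) \<and> gaf_mass' R g < ennreal (2 * C)}"
    unfolding e using indep_varD[OF ind SA SB] unfolding pA eB by simp
  finally show ?thesis by simp
qed

text \<open>For moderate radii it is enough to have some exponential rate. The Lyapunov function is
  \<open>1 + \<epsilon> V\<close>, where \<open>V\<close> bounds the series on the disk: where \<open>V\<close> is large it contracts, and where
  it is bounded the next linear coefficient dominates with positive probability.\<close>

lemma gaf_drift_small:
  fixes R :: real
  assumes R: "0 < R"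
  defines "st \<equiv> ar_step (1 / 2) (sqrt (3 / 4)) gaf_index"
    and "H \<equiv> {y \<in> space gaf_space. ennreal (cmod (gaf_coeff y 1) * R) \<le> gaf_mass' R y}"
  obtains \<epsilon> \<kappa> :: real where "0 < \<epsilon>" "0 < \<kappa>" "\<kappa> < 1"
    "(\<integral>\<^sup>+g. 1 + ennreal \<epsilon> * gaf_mass R g \<partial>gaf_law) < \<infinity>"
    "\<And>y. y \<in> space gaf_space \<Longrightarrow>
      (\<integral>\<^sup>+g. (1 + ennreal \<epsilon> * gaf_mass R (st y g)) * indicator H (st y g) \<partial>gaf_law)
        \<le> ennreal \<kappa> * (1 + ennreal \<epsilon> * gaf_mass R y)"
proof -
  interpret prob_space gaf_law by (rule prob_space_gaf_law)
  obtain C where C: "0 < C" "(\<integral>\<^sup>+g. gaf_mass R g \<partial>gaf_law) \<le> ennreal C"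
    using gaf_mass_mean[OF R] .
  let ?\<sigma> = "sqrt (3 / 4)"
  have \<sigma>: "1 / 2 \<le> ?\<sigma>" "?\<sigma> \<le> 1" by (rule real_le_rsqrt, simp_all add: power2_eq_square)
  define l where "l = 20 * C / R + 1"
  have l: "0 < l" using C R by (simp add: l_def add_pos_pos)
  define p where "p = measure std_normal {2 * l..} / 2"
  have p: "0 < p" using std_normal_pos[of "2 * l" "2 * l + 1" "{2 * l..}"] by (auto simp: p_def)
  have p1: "p \<le> 1 / 2" using std_normal.prob_le_1[of "{2 * l..}"] unfolding p_def by (intro divide_right_mono) auto
  define \<epsilon> where "\<epsilon> = p / (10 * C)"
  define \<kappa> where "\<kappa> = 1 - p / 10"
  have \<epsilon>: "0 < \<epsilon>" "\<epsilon> * C = p / 10" using p C by (auto simp: \<epsilon>_def)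
  have \<kappa>: "0 < \<kappa>" "\<kappa> < 1" using p p1 by (auto simp: \<kappa>_def)
  have m_law: "gaf_mass R \<in> borel_measurable gaf_law" "gaf_mass' R \<in> borel_measurable gaf_law"
    unfolding measurable_cong_sets[OF sets_gaf_law refl] by measurable
  have lin: "(\<integral>\<^sup>+g. a + ennreal b * gaf_mass R g \<partial>gaf_law) \<le> a + ennreal b * ennreal C" for a b
  proof -
    have "(\<integral>\<^sup>+g. a + ennreal b * gaf_mass R g \<partial>gaf_law) = a + ennreal b * (\<integral>\<^sup>+g. gaf_mass R g \<partial>gaf_law)"
      using m_law emeasure_space_1 by (subst nn_integral_add) (auto simp: nn_integral_cmult)
    also have "\<dots> \<le> a + ennreal b * ennreal C" by (intro add_left_mono mult_left_mono C) simp
    finally show ?thesis .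
  qed
  show ?thesis
  proof (rule that[OF \<epsilon>(1) \<kappa>])
    show "(\<integral>\<^sup>+g. 1 + ennreal \<epsilon> * gaf_mass R g \<partial>gaf_law) < \<infinity>"
      by (rule le_less_trans[OF lin]) (simp add: ennreal_mult_less_top)
    fix y :: "nat \<times> nat \<Rightarrow> real" assume y: "y \<in> space gaf_space"
    have st_meas: "st y \<in> gaf_law \<rightarrow>\<^sub>M gaf_space"
      unfolding measurable_cong_sets[OF sets_gaf_law refl]
      using measurable_compose[OF measurable_Pair1'[OF y, of gaf_space] ar_step_measurable] by (simp add: st_def)
    have H: "H \<in> sets gaf_space" unfolding H_def by measurable
    have V_step: "gaf_mass R (st y g) \<le> ennreal (1 / 2) * gaf_mass R y + gaf_mass R g" for g
    proof -
      have "gaf_mass R (st y g) \<le> ennreal (1 / 2) * gaf_mass R y + ennreal ?\<sigma> * gaf_mass R g"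
        unfolding st_def using R by (intro gaf_mass_step) auto
      also have "ennreal ?\<sigma> * gaf_mass R g \<le> 1 * gaf_mass R g"
        using \<sigma> by (intro mult_right_mono) (simp_all add: ennreal_le_1)
      finally show ?thesis by (simp add: add_left_mono)
    qed
    show "(\<integral>\<^sup>+g. (1 + ennreal \<epsilon> * gaf_mass R (st y g)) * indicator H (st y g) \<partial>gaf_law)
        \<le> ennreal \<kappa> * (1 + ennreal \<epsilon> * gaf_mass R y)"
    proof (cases "gaf_mass R y = \<infinity>")
      case True
      then show ?thesis using \<epsilon> \<kappa> by (simp add: ennreal_mult_top)
    next
      case False
      define v where "v = enn2real (gaf_mass R y)"
      have v: "gaf_mass R y = ennreal v" "0 \<le> v" using False by (auto simp: v_def less_top)
      have half_v: "ennreal (1 / 2) * ennreal v = ennreal (v / 2)"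
        by (subst ennreal_mult'[symmetric]) auto
      have V_mean: "(\<integral>\<^sup>+g. a + ennreal \<epsilon> * gaf_mass R (st y g) \<partial>gaf_law) \<le> a + ennreal (\<epsilon> * (v / 2 + C))" for a
      proof -
        have "(\<integral>\<^sup>+g. a + ennreal \<epsilon> * gaf_mass R (st y g) \<partial>gaf_law) \<le> (\<integral>\<^sup>+g. (a + ennreal (\<epsilon> * (v / 2))) + ennreal \<epsilon> * gaf_mass R g \<partial>gaf_law)"
        proof (rule nn_integral_mono)
          fix g
          have "ennreal \<epsilon> * gaf_mass R (st y g) \<le> ennreal \<epsilon> * (ennreal (1 / 2) * ennreal v + gaf_mass R g)"
            using V_step[of g] unfolding v by (intro mult_left_mono) auto
          also have "\<dots> = ennreal (\<epsilon> * (v / 2)) + ennreal \<epsilon> * gaf_mass R g"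
            unfolding half_v distrib_left using \<epsilon> by (subst ennreal_mult') auto
          finally show "a + ennreal \<epsilon> * gaf_mass R (st y g) \<le> (a + ennreal (\<epsilon> * (v / 2))) + ennreal \<epsilon> * gaf_mass R g"
            by (simp add: add.assoc add_left_mono)
        qed
        also have "\<dots> \<le> (a + ennreal (\<epsilon> * (v / 2))) + ennreal \<epsilon> * ennreal C" by (rule lin)
        also have "\<dots> = a + ennreal (\<epsilon> * (v / 2 + C))"
          using \<epsilon> v C by (simp add: add.assoc ennreal_mult[symmetric] ennreal_plus[symmetric] distrib_left del: ennreal_plus)
        finally show ?thesis .
      qed
      have rhs: "ennreal \<kappa> * (1 + ennreal \<epsilon> * gaf_mass R y) = ennreal (\<kappa> * (1 + \<epsilon> * v))"
      proof -
        have "1 + ennreal \<epsilon> * ennreal v = ennreal (1 + \<epsilon> * v)"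
          using \<epsilon> v by (simp add: ennreal_mult)
        then show ?thesis unfolding v using \<kappa> by (simp only: ennreal_mult'[symmetric])
      qed
      show ?thesis
      proof (cases "8 * C \<le> v")
        case True
        have "(\<integral>\<^sup>+g. (1 + ennreal \<epsilon> * gaf_mass R (st y g)) * indicator H (st y g) \<partial>gaf_law) \<le> (\<integral>\<^sup>+g. 1 + ennreal \<epsilon> * gaf_mass R (st y g) \<partial>gaf_law)"
          by (intro nn_integral_mono) (simp add: indicator_def)
        also have "\<dots> \<le> 1 + ennreal (\<epsilon> * (v / 2 + C))" by (rule V_mean)
        also have "\<dots> = ennreal (1 + \<epsilon> * (v / 2 + C))" using \<epsilon> v C by simp
        also have "\<dots> \<le> ennreal (\<kappa> * (1 + \<epsilon> * v))"
        proof (rule ennreal_leI)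
          have "\<epsilon> * (8 * C) \<le> \<epsilon> * v" using True \<epsilon> by (intro mult_left_mono) auto
          moreover have "\<epsilon> * (8 * C) = 8 * (p / 10)" unfolding \<epsilon>(2)[symmetric] by simp
          ultimately have "8 * (p / 10) \<le> \<epsilon> * v" by simp
          moreover have "p / 10 * (\<epsilon> * v) \<le> 1 / 20 * (\<epsilon> * v)" using p1 \<epsilon> v by (intro mult_right_mono) auto
          moreover have "\<epsilon> * (v / 2 + C) = \<epsilon> * v / 2 + p / 10" unfolding distrib_left \<epsilon>(2) by simp
          moreover have "\<kappa> * (1 + \<epsilon> * v) = 1 + \<epsilon> * v - p / 10 - p / 10 * (\<epsilon> * v)" by (simp add: \<kappa>_def algebra_simps)
          ultimately show "1 + \<epsilon> * (v / 2 + C) \<le> \<kappa> * (1 + \<epsilon> * v)" using p by linarith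
        qed
        finally show ?thesis unfolding rhs .
      next
        case small: False
        define E where "E = {g \<in> space gaf_law. 2 * l \<le> g (1, 1) \<and> gaf_mass' R g < ennreal (2 * C)}"
        have E: "E \<in> events"
        proof -
          have [measurable]: "(\<lambda>g. g (1, 1)) \<in> borel_measurable gaf_law"
            unfolding measurable_cong_sets[OF sets_gaf_law refl] by (intro measurable_component_singleton) auto
          show ?thesis unfolding E_def using m_law by measurable
        qed
        have pE: "p \<le> prob E" unfolding p_def E_def by (rule gaf_dominant_prob[OF C R])
        have notH: "st y g \<notin> H" if g: "g \<in> E" for g
        proof
          assume "st y g \<in> H"
          then have "ennreal (cmod (gaf_coeff (st y g) 1) * R) \<le> gaf_mass' R (st y g)" by (simp add: H_def)
          also have "\<dots> \<le> ennreal (1 / 2) * gaf_mass' R y + ennreal ?\<sigma> * gaf_mass' R g"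
            unfolding st_def using R by (intro gaf_mass_step) auto
          also have "\<dots> \<le> ennreal (1 / 2) * ennreal v + 1 * ennreal (2 * C)"
            using gaf_mass'_le[of R y] g \<sigma> unfolding v E_def
            by (intro add_mono mult_mono) (auto simp: ennreal_le_1 less_imp_le)
          also have "\<dots> = ennreal (v / 2 + 2 * C)"
            unfolding half_v using v C by (subst ennreal_plus) auto
          finally have "cmod (gaf_coeff (st y g) 1) * R \<le> v / 2 + 2 * C" using v C by (subst (asm) ennreal_le_iff) auto
          then have up: "cmod (gaf_coeff (st y g) 1) * R \<le> 6 * C" using small by linarith
          have "ennreal (cmod (gaf_coeff y 1) * R) \<le> ennreal v"
            using gaf_mass_term[of y 1 R] unfolding v by simp
          then have y1: "cmod (gaf_coeff y 1) * R \<le> 8 * C" using v small by (subst (asm) ennreal_le_iff) auto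
          have "l \<le> g (1, 1) / sqrt 2"
          proof -
            have "l * sqrt 2 \<le> l * 2" using l by (intro mult_left_mono) (auto intro: real_le_lsqrt)
            also have "\<dots> \<le> g (1, 1)" using g by (simp add: E_def)
            finally show ?thesis by (simp add: pos_le_divide_eq)
          qed
          also have "\<dots> \<le> cmod (gaf_coeff g 1)" using complex_Re_le_cmod[of "gaf_coeff g 1"] by (simp add: gaf_coeff_def)
          finally have g1: "l \<le> cmod (gaf_coeff g 1)" .
          have "?\<sigma> * cmod (gaf_coeff g 1) - 1 / 2 * cmod (gaf_coeff y 1) \<le> cmod (gaf_coeff (st y g) 1)"
          proof -
            have "?\<sigma> * gaf_coeff g 1 = gaf_coeff (st y g) 1 - 1 / 2 * gaf_coeff y 1"
              unfolding st_def gaf_coeff_step by simp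
            then have "cmod (?\<sigma> * gaf_coeff g 1) \<le> cmod (gaf_coeff (st y g) 1) + cmod (1 / 2 * gaf_coeff y 1)"
              by (metis norm_triangle_ineq4)
            then show ?thesis by (simp add: norm_mult norm_divide)
          qed
          moreover have "1 / 2 * l \<le> ?\<sigma> * cmod (gaf_coeff g 1)" using \<sigma> g1 l by (intro mult_mono) auto
          ultimately have "(1 / 2 * l - 1 / 2 * cmod (gaf_coeff y 1)) * R \<le> cmod (gaf_coeff (st y g) 1) * R"
            using R by (intro mult_right_mono) auto
          moreover have "l * R = 20 * C + R" using R by (simp add: l_def distrib_right)
          ultimately show False using up y1 R C(1) unfolding left_diff_distrib mult.assoc by linarith
        qed
        have "(\<integral>\<^sup>+g. (1 + ennreal \<epsilon> * gaf_mass R (st y g)) * indicator H (st y g) \<partial>gaf_law) \<le>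
            (\<integral>\<^sup>+g. indicator (space gaf_law - E) g + ennreal \<epsilon> * gaf_mass R (st y g) \<partial>gaf_law)"
          using notH by (intro nn_integral_mono) (auto simp: indicator_def)
        also have "\<dots> = (\<integral>\<^sup>+g. indicator (space gaf_law - E) g \<partial>gaf_law) + (\<integral>\<^sup>+g. 0 + ennreal \<epsilon> * gaf_mass R (st y g) \<partial>gaf_law)"
          using E measurable_compose[OF st_meas gaf_mass_measurable[of R]] by (subst nn_integral_add) auto
        also have "\<dots> \<le> ennreal (1 - p) + (0 + ennreal (\<epsilon> * (v / 2 + C)))"
        proof (intro add_mono V_mean)
          have "(\<integral>\<^sup>+g. indicator (space gaf_law - E) g \<partial>gaf_law) = emeasure gaf_law (space gaf_law - E)"
            using E by (intro nn_integral_indicator) auto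
          also have "\<dots> = ennreal (1 - prob E)" unfolding emeasure_eq_measure prob_compl[OF E] ..
          also have "\<dots> \<le> ennreal (1 - p)" using pE by (intro ennreal_leI) simp
          finally show "(\<integral>\<^sup>+g. indicator (space gaf_law - E) g \<partial>gaf_law) \<le> ennreal (1 - p)" .
        qed
        also have "\<dots> = ennreal (1 - p + \<epsilon> * (v / 2 + C))" using p1 \<epsilon> v C by (simp add: ennreal_plus[symmetric] del: ennreal_plus)
        also have "\<dots> \<le> ennreal (\<kappa> * (1 + \<epsilon> * v))"
        proof (rule ennreal_leI)
          have "\<epsilon> * (v / 2 + C) \<le> \<epsilon> * (5 * C)" using small \<epsilon> by (intro mult_left_mono) auto
          also have "\<dots> = p / 2" using \<epsilon>(2) by (simp add: mult.left_commute)
          finally have "1 - p + \<epsilon> * (v / 2 + C) \<le> \<kappa> * 1" using p by (simp add: \<kappa>_def)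
          also have "\<dots> \<le> \<kappa> * (1 + \<epsilon> * v)" using \<kappa> \<epsilon> v by (intro mult_left_mono) auto
          finally show "1 - p + \<epsilon> * (v / 2 + C) \<le> \<kappa> * (1 + \<epsilon> * v)" .
        qed
        finally show ?thesis unfolding rhs .
      qed
    qed
  qed
qed

lemma hole_Limsup_small:
  fixes R :: real
  assumes R: "0 < R"
  obtains c where "0 < c"
    "\<And>M (B :: nat \<Rightarrow> nat \<Rightarrow> real \<Rightarrow> 'a \<Rightarrow> real). independent_brownian_motions M B \<Longrightarrow>
      Limsup at_top (\<lambda>T::real. ereal (1 / T) * log_prob (hole_prob M B T R)) \<le> - ereal c"
proof -
  have e1: "exp (- ln 4 / 2) = (1 / 2 :: real)" "sqrt (1 - exp (- ln 4)) = sqrt (3 / 4 :: real)"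
  proof -
    have "ln (4::real) = 2 * ln 2" using ln_realpow[of 2 2] by simp
    then show "exp (- ln 4 / 2) = (1 / 2 :: real)" by (simp add: exp_minus)
    show "sqrt (1 - exp (- ln 4)) = sqrt (3 / 4 :: real)" by (simp add: exp_minus)
  qed
  show ?thesis
  proof (rule gaf_drift_small[OF R])
    fix \<epsilon> \<kappa> :: real
    assume d: "0 < \<epsilon>" "0 < \<kappa>" "\<kappa> < 1"
      "(\<integral>\<^sup>+g. 1 + ennreal \<epsilon> * gaf_mass R g \<partial>gaf_law) < \<infinity>"
      "\<And>y. y \<in> space gaf_space \<Longrightarrow>
        (\<integral>\<^sup>+g. (1 + ennreal \<epsilon> * gaf_mass R (ar_step (1 / 2) (sqrt (3 / 4)) gaf_index y g)) *
          indicator {y \<in> space gaf_space. ennreal (cmod (gaf_coeff y 1) * R) \<le> gaf_mass' R y} (ar_step (1 / 2) (sqrt (3 / 4)) gaf_index y g) \<partial>gaf_law)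
          \<le> ennreal \<kappa> * (1 + ennreal \<epsilon> * gaf_mass R y)"
    show ?thesis
    proof (rule that[of "- ln \<kappa> / ln 4"])
      show "0 < - ln \<kappa> / ln 4" using d by (simp add: divide_neg_pos)
      fix M and B :: "nat \<Rightarrow> nat \<Rightarrow> real \<Rightarrow> 'a \<Rightarrow> real"
      assume B: "independent_brownian_motions M B"
      have "Limsup at_top (\<lambda>T::real. ereal (1 / T) * log_prob (hole_prob M B T R)) \<le> ereal (ln \<kappa> / ln 4)"
      proof (rule hole_Limsup_drift[where \<delta> = "ln 4", OF B _ d(2,3) R _ _ _ d(4), unfolded e1])
        show "(\<lambda>g. 1 + ennreal \<epsilon> * gaf_mass R g) \<in> borel_measurable gaf_space" by measurable
        show "{y \<in> space gaf_space. ennreal (cmod (gaf_coeff y 1) * R) \<le> gaf_mass' R y} \<in> sets gaf_space" by measurable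
        fix y assume y: "y \<in> space gaf_space"
        show "(\<integral>\<^sup>+g. (1 + ennreal \<epsilon> * gaf_mass R (ar_step (1 / 2) (sqrt (3 / 4)) gaf_index y g)) *
          indicator {y \<in> space gaf_space. ennreal (cmod (gaf_coeff y 1) * R) \<le> gaf_mass' R y} (ar_step (1 / 2) (sqrt (3 / 4)) gaf_index y g) \<partial>gaf_law)
          \<le> ennreal \<kappa> * (1 + ennreal \<epsilon> * gaf_mass R y)" by (rule d(5)[OF y])
        assume s: "summable (\<lambda>n. cmod (gaf_coeff y n) * (R ^ n / sqrt (fact n)))"
          and nz: "\<And>z. z \<in> cball 0 R \<Longrightarrow> (\<Sum>n. gaf_coeff y n * (z ^ n / complex_of_real (sqrt (fact n)))) \<noteq> 0"
        have "cmod (gaf_coeff y 1) * R \<le> (\<Sum>n. if n = 1 then 0 else cmod (gaf_coeff y n) * (R ^ n / sqrt (fact n)))"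
        proof (rule ccontr)
          assume "\<not> ?thesis"
          then have "(\<Sum>n. if n = 1 then 0 else cmod (gaf_coeff y n) * (R ^ n / sqrt (fact n))) < cmod (gaf_coeff y 1) * R"
            by (rule not_le_imp_less)
          then show False by (rule dominant_linear_term_zero[OF R s]) (use nz in blast)
        qed
        moreover have "gaf_mass' R y = ennreal (\<Sum>n. if n = 1 then 0 else cmod (gaf_coeff y n) * (R ^ n / sqrt (fact n)))"
        proof -
          have "gaf_mass' R y = (\<Sum>n. ennreal (if n = 1 then 0 else cmod (gaf_coeff y n) * (R ^ n / sqrt (fact n))))"
            unfolding gaf_mass'_def by (intro suminf_cong) simp
          also have "\<dots> = ennreal (\<Sum>n. if n = 1 then 0 else cmod (gaf_coeff y n) * (R ^ n / sqrt (fact n)))"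
            by (intro suminf_ennreal2 summable_comparison_test'[OF s, where N=0]) (use R in simp_all)
          finally show ?thesis .
        qed
        ultimately show "y \<in> {y \<in> space gaf_space. ennreal (cmod (gaf_coeff y 1) * R) \<le> gaf_mass' R y}"
          using y by (simp add: ennreal_leI)
      qed auto
      then show "Limsup at_top (\<lambda>T::real. ereal (1 / T) * log_prob (hole_prob M B T R)) \<le> - ereal (- ln \<kappa> / ln 4)" by simp
    qed
  qed
qed

lemma fact_le_stirling:
  assumes "0 < N"
  shows "fact N \<le> real N ^ (N + 1) * exp (1 - real N)"
  using assms
proof (induction N rule: nat_induct_non_zero)
  case (Suc N)
  let ?x = "real N"
  have "ln (?x / (?x + 1)) \<le> ?x / (?x + 1) - 1" using Suc by (intro ln_le_minus_one) auto
  also have "\<dots> = - 1 / (?x + 1)" using Suc by (simp add: field_simps)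
  finally have "(?x + 1) * ln (?x / (?x + 1)) \<le> - 1" using Suc by (simp add: field_simps)
  then have "exp ((?x + 1) * ln (?x / (?x + 1))) \<le> exp (- 1)" by (subst exp_le_cancel_iff)
  moreover have "exp ((?x + 1) * ln (?x / (?x + 1))) = (?x / (?x + 1)) ^ (N + 1)"
  proof -
    have "exp ((?x + 1) * ln (?x / (?x + 1))) = exp (ln (?x / (?x + 1))) ^ (N + 1)"
      using exp_of_nat_mult[of "N + 1" "ln (?x / (?x + 1))"] by (simp only: of_nat_add of_nat_1)
    moreover have "exp (ln (?x / (?x + 1))) = ?x / (?x + 1)" using Suc by simp
    ultimately show ?thesis by (simp only:)
  qed
  ultimately have "?x ^ (N + 1) \<le> exp (- 1) * (?x + 1) ^ (N + 1)"
    using Suc by (simp only: power_divide) (simp add: pos_divide_le_eq)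
  then have "(?x + 1) * exp (1 - ?x) * ?x ^ (N + 1) \<le> (?x + 1) * exp (1 - ?x) * (exp (- 1) * (?x + 1) ^ (N + 1))"
    by (intro mult_left_mono) auto
  also have "\<dots> = (?x + 1) ^ (N + 2) * (exp (1 - ?x) * exp (- 1))" by simp
  also have "exp (1 - ?x) * exp (- 1) = exp (1 - real (Suc N))" by (simp add: exp_add[symmetric])
  finally have "(?x + 1) * exp (1 - ?x) * ?x ^ (N + 1) \<le> real (Suc N) ^ (Suc N + 1) * exp (1 - real (Suc N))"
    by (simp add: add.commute)
  moreover have "fact (Suc N) \<le> (?x + 1) * exp (1 - ?x) * ?x ^ (N + 1)"
    using mult_left_mono[OF Suc.IH, of "?x + 1"] by (simp add: mult_ac add.commute)
  ultimately show ?case by (rule order_trans[rotated])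
qed simp

lemma sqrt_power_fact_ge:
  assumes "0 < N"
  shows "exp ((real N - 1) / 2) / sqrt N \<le> sqrt N ^ N / sqrt (fact N)"
proof -
  have "fact N \<le> real N ^ N * (N * exp (1 - real N))" using fact_le_stirling[OF assms] by (simp add: mult_ac)
  then have "exp (real N - 1) / N \<le> real N ^ N / fact N"
    using assms by (simp add: exp_diff field_simps)
  then have "sqrt (exp (real N - 1) / N) \<le> sqrt (real N ^ N / fact N)" by (rule real_sqrt_le_mono)
  moreover have "sqrt (exp (real N - 1)) = exp ((real N - 1) / 2)"
    by (rule real_sqrt_unique) (simp_all add: exp_double[symmetric])
  ultimately show ?thesis by (simp add: real_sqrt_divide real_sqrt_power)
qed

lemma hole_Limsup_large:
  obtains R0 where "0 < R0"
    "\<And>M (B :: nat \<Rightarrow> nat \<Rightarrow> real \<Rightarrow> 'a \<Rightarrow> real) R. independent_brownian_motions M B \<Longrightarrow> R0 \<le> R \<Longrightarrow>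
      Limsup at_top (\<lambda>T::real. ereal (1 / T) * log_prob (hole_prob M B T R)) \<le> - ereal (ln 2 / 2 * exp (R\<^sup>2 / 3))"
proof -
  have "\<forall>\<^sub>F R in at_top. 1632 \<le> exp (- R\<^sup>2 / 3) * (exp ((R\<^sup>2 - 2) / 2) / R) \<and> exp (- R\<^sup>2 / 3) \<le> 1 / 2 \<and> (2::real) \<le> R"
    by (intro eventually_conj) real_asymp+
  then obtain R1 where R1: "\<And>R. R1 \<le> R \<Longrightarrow> 1632 \<le> exp (- R\<^sup>2 / 3) * (exp ((R\<^sup>2 - 2) / 2) / R) \<and> exp (- R\<^sup>2 / 3) \<le> 1 / 2 \<and> (2::real) \<le> R"
    by (auto simp: eventually_at_top_linorder)
  show ?thesis
  proof (rule that[of "max 1 R1"])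
    fix M and B :: "nat \<Rightarrow> nat \<Rightarrow> real \<Rightarrow> 'a \<Rightarrow> real" and R :: real
    assume B: "independent_brownian_motions M B" and "max 1 R1 \<le> R"
    then have R: "1632 \<le> exp (- R\<^sup>2 / 3) * (exp ((R\<^sup>2 - 2) / 2) / R)" "exp (- R\<^sup>2 / 3) \<le> 1 / 2" "2 \<le> R"
      using R1[of R] by auto
    define s where "s = exp (- R\<^sup>2 / 3)"
    have s: "0 < s" "s \<le> 1 / 2" using R by (auto simp: s_def)
    define N where "N = nat \<lfloor>R\<^sup>2\<rfloor>"
    have "4 \<le> R\<^sup>2" using power_mono[OF R(3), of 2] by simp
    then have N: "0 < N" "real N \<le> R\<^sup>2" "R\<^sup>2 - 1 \<le> real N" unfolding N_def by (auto simp: of_nat_nat)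
    define r where "r = sqrt N"
    have r: "0 < r" "r \<le> R" using N R by (auto simp: r_def intro: real_le_lsqrt)
    have big: "1632 \<le> s * (r ^ N / sqrt (fact N))"
    proof -
      have "exp ((R\<^sup>2 - 2) / 2) / R \<le> exp ((real N - 1) / 2) / sqrt N"
        using N r R by (intro frac_le) (auto simp: r_def)
      also have "\<dots> \<le> r ^ N / sqrt (fact N)" unfolding r_def by (rule sqrt_power_fact_ge[OF N(1)])
      finally have "s * (exp ((R\<^sup>2 - 2) / 2) / R) \<le> s * (r ^ N / sqrt (fact N))" using s by (intro mult_left_mono) auto
      then show ?thesis using R(1) by (simp only: s_def)
    qed
    define \<delta> where "\<delta> = - ln (1 - s)"
    have \<delta>: "0 < \<delta>" "exp (- \<delta>) = 1 - s" using s by (auto simp: \<delta>_def)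
    have "exp (- 2 * s) \<le> 1 - s" using s by (intro one_minus_ge_exp) auto
    then have "- 2 * s \<le> ln (1 - s)" using s by (simp add: ln_ge_iff)
    then have \<delta>2: "\<delta> \<le> 2 * s" by (simp add: \<delta>_def)
    have \<rho>: "exp (- \<delta> / 2) = sqrt (1 - s)" "sqrt (1 - exp (- \<delta>)) = sqrt s"
    proof -
      have "(exp (- \<delta> / 2))\<^sup>2 = 1 - s" using \<delta>(2) by (simp add: exp_double[symmetric])
      then show "exp (- \<delta> / 2) = sqrt (1 - s)" by (intro real_sqrt_unique[symmetric]) auto
      show "sqrt (1 - exp (- \<delta>)) = sqrt s" unfolding \<delta>(2) by simp
    qed
    let ?\<Phi> = "\<lambda>y :: nat \<times> nat \<Rightarrow> real. ennreal (exp (((y (0, 1))\<^sup>2 + (y (0, 2))\<^sup>2) / 8))"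
    let ?H = "{y \<in> space gaf_space. 1 \<le> ennreal (cmod (gaf_coeff y 0)) * gaf_inverse_mean N r y}"
    have "Limsup at_top (\<lambda>T::real. ereal (1 / T) * log_prob (hole_prob M B T R)) \<le> ereal (ln (1 / 2) / \<delta>)"
    proof (rule hole_Limsup_drift[OF B \<delta>(1), unfolded \<rho>])
      have [measurable]: "(\<lambda>y. y (0, 1)) \<in> borel_measurable gaf_space" "(\<lambda>y. y (0, 2)) \<in> borel_measurable gaf_space"
        by (auto intro!: measurable_component_singleton)
      show "?\<Phi> \<in> borel_measurable gaf_space" by measurable
      note [measurable] = gaf_inverse_mean_measurable[of N r]
      show "?H \<in> sets gaf_space" by measurable
      show "1 \<le> ?\<Phi> y" for y by simp
      show "(\<integral>\<^sup>+g. ?\<Phi> g \<partial>gaf_law) < \<infinity>"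
        using gaf_law_exp_square[of "1 / 8" 1 0 0 0 0] by simp
      fix y assume y: "y \<in> space gaf_space"
      show "(\<integral>\<^sup>+g. ?\<Phi> (ar_step (sqrt (1 - s)) (sqrt s) gaf_index y g) * indicator ?H (ar_step (sqrt (1 - s)) (sqrt s) gaf_index y g) \<partial>gaf_law) \<le> ennreal (1 / 2) * ?\<Phi> y"
        by (rule gaf_drift_large[OF s N(1) r(1) big y])
      assume "summable (\<lambda>n. cmod (gaf_coeff y n) * (R ^ n / sqrt (fact n)))"
        and "\<And>z. z \<in> cball 0 R \<Longrightarrow> (\<Sum>n. gaf_coeff y n * (z ^ n / complex_of_real (sqrt (fact n)))) \<noteq> 0"
      from gaf_hole_inverse_mean[OF this r] show "y \<in> ?H" using y by simp
    qed (use R in auto)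
    also have "ereal (ln (1 / 2) / \<delta>) \<le> - ereal (ln 2 / 2 * exp (R\<^sup>2 / 3))"
    proof -
      have "ln 2 / (2 * s) \<le> ln 2 / \<delta>" using \<delta> \<delta>2 s by (intro divide_left_mono) auto
      moreover have "ln 2 / (2 * s) = ln 2 / 2 * exp (R\<^sup>2 / 3)" by (simp add: s_def exp_minus field_simps)
      moreover have "ln (1 / 2) = - ln (2::real)" by (simp add: ln_div)
      ultimately show ?thesis by simp
    qed
    finally show "Limsup at_top (\<lambda>T::real. ereal (1 / T) * log_prob (hole_prob M B T R)) \<le> - ereal (ln 2 / 2 * exp (R\<^sup>2 / 3))" .
  qed simp
qed

theorem theorem1:
  shows "\<exists>\<epsilon>\<^sub>1 \<epsilon>\<^sub>2 :: real \<Rightarrow> real.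
    (\<epsilon>\<^sub>1 \<longlongrightarrow> 0) at_top \<and> (\<epsilon>\<^sub>2 \<longlongrightarrow> 0) at_top \<and>
    (\<forall>(M :: 'a measure) (B :: nat \<Rightarrow> nat \<Rightarrow> real \<Rightarrow> 'a \<Rightarrow> real).
      independent_brownian_motions M B \<longrightarrow>
      (\<forall>R>0.
        Limsup at_top (\<lambda>T::real. ereal (1 / T) * log_prob (hole_prob M B T R))
          \<le> - ereal (exp ((1/3 - \<epsilon>\<^sub>1 R) * R\<^sup>2)) \<and>
        Liminf at_top (\<lambda>T::real. ereal (1 / T) * log_prob (hole_prob M B T R))
          \<ge> - ereal (exp ((1/2 + \<epsilon>\<^sub>2 R) * R\<^sup>2))))"
proof -
  let ?rate = "\<lambda>M (B :: nat \<Rightarrow> nat \<Rightarrow> real \<Rightarrow> 'a \<Rightarrow> real) R T. ereal (1 / T) * log_prob (hole_prob M B T R)"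
  obtain R0 where R0: "0 < R0"
    "\<And>M (B :: nat \<Rightarrow> nat \<Rightarrow> real \<Rightarrow> 'a \<Rightarrow> real) R. independent_brownian_motions M B \<Longrightarrow> R0 \<le> R \<Longrightarrow>
      Limsup at_top (?rate M B R) \<le> - ereal (ln 2 / 2 * exp (R\<^sup>2 / 3))"
    using hole_Limsup_large by blast
  have "\<forall>R. \<exists>c. 0 < R \<longrightarrow> 0 < c \<and> (\<forall>M (B :: nat \<Rightarrow> nat \<Rightarrow> real \<Rightarrow> 'a \<Rightarrow> real). independent_brownian_motions M B \<longrightarrow>
      Limsup at_top (?rate M B R) \<le> - ereal c)"
    using hole_Limsup_small by metis
  then obtain c where c: "\<And>R. 0 < R \<Longrightarrow> 0 < c R"
    "\<And>R M (B :: nat \<Rightarrow> nat \<Rightarrow> real \<Rightarrow> 'a \<Rightarrow> real). 0 < R \<Longrightarrow> independent_brownian_motions M B \<Longrightarrow>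
      Limsup at_top (?rate M B R) \<le> - ereal (c R)"
    by metis
  obtain \<epsilon>2 where e2: "(\<epsilon>2 \<longlongrightarrow> 0) at_top" "\<And>R. 0 < R \<Longrightarrow> hole_rate R = exp ((1 / 2 + \<epsilon>2 R) * R\<^sup>2)"
    using hole_rate_exponent by blast
  define \<epsilon>1 where "\<epsilon>1 R = (if R0 \<le> R then - ln (ln 2 / 2) / R\<^sup>2 else 1 / 3 - ln (c R) / R\<^sup>2)" for R :: real
  have "((\<lambda>R::real. - ln (ln 2 / 2) / R\<^sup>2) \<longlongrightarrow> 0) at_top" by real_asymp
  then have e1: "(\<epsilon>1 \<longlongrightarrow> 0) at_top"
    by (rule Lim_transform_eventually) (use eventually_ge_at_top[of R0] in eventually_elim, simp add: \<epsilon>1_def)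
  have up: "Limsup at_top (?rate M B R) \<le> - ereal (exp ((1 / 3 - \<epsilon>1 R) * R\<^sup>2))"
    if B: "independent_brownian_motions M B" and R: "0 < R" for M and B :: "nat \<Rightarrow> nat \<Rightarrow> real \<Rightarrow> 'a \<Rightarrow> real" and R
  proof (cases "R0 \<le> R")
    case True
    have "(1 / 3 - \<epsilon>1 R) * R\<^sup>2 = ln (ln 2 / 2) + R\<^sup>2 / 3" using True R by (simp add: \<epsilon>1_def field_simps)
    then have "exp ((1 / 3 - \<epsilon>1 R) * R\<^sup>2) = ln 2 / 2 * exp (R\<^sup>2 / 3)" by (simp only: exp_add) simp
    then show ?thesis using R0(2)[OF B True] by (simp only:)
  next
    case False
    have "(1 / 3 - \<epsilon>1 R) * R\<^sup>2 = ln (c R)" using False R by (simp add: \<epsilon>1_def)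
    then have "exp ((1 / 3 - \<epsilon>1 R) * R\<^sup>2) = c R" using c(1)[OF R] by simp
    then show ?thesis using c(2)[OF R B] by (simp only:)
  qed
  have low: "- ereal (exp ((1 / 2 + \<epsilon>2 R) * R\<^sup>2)) \<le> Liminf at_top (?rate M B R)"
    if B: "independent_brownian_motions M B" and R: "0 < R" for M and B :: "nat \<Rightarrow> nat \<Rightarrow> real \<Rightarrow> 'a \<Rightarrow> real" and R
    using hole_Liminf[OF B R] unfolding e2(2)[OF R] .
  show ?thesis
    using e1 e2(1) up low by blast
qed

end
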